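(* If $\alpha<1$ then there exists a positive constant $c$ such that \[\mathbb{P}_{\beta_c,r}(x\leftrightarrow y) \preceq \|x-y\|^{-d+\alpha}\exp\left[-c\frac{\|x-y\|}{r}\right]\] for every $r\geq 1$ and distinct $x,y\in \mathbb{Z}^d$.
   Context: Setting: fix an integer $d\geq 1$, a real $\alpha>0$, a norm $\|\cdot\|$ on $\mathbb{R}^d$, and a kernel of the form $J(x,y)=\mathbf{1}(x\neq y)J(\|x-y\|)$ for $x,y\in\mathbb{Z}^d$, where $J:(0,\infty)\to(0,\infty)$ is decreasing and differentiable, tends to $0$ at infinity (so that $J(x,y)\sim \mathrm{const.}\,\|x-y\|^{-d-\alpha}$), and satisfies $|J'(r)|=C(1+\delta_r)r^{-d-\alpha-1}$ for some constant $C>0$ and some measurable error function $r\mapsto\delta_r$ with $\delta_r\to0$ as $r\to\infty$ and $\int_{r_0}^\infty \frac{|\delta_r|}{r}\,dr<\infty$ for some $r_0<\infty$. Long-range percolation with parameter $\beta\ge 0$ is the random graph on $\mathbb{Z}^d$ in which each pair of distinct vertices $x,y$ is joined by an (open) edge independently with probability $1-e^{-\beta J(x,y)}$; $\mathbb{P}_\beta$ denotes its law. The critical point is $\beta_c=\inf\{\beta\ge0:\mathbb{P}_\beta(\text{there is an infinite cluster})>0\}$, where clusters are connected components. $\{x\leftrightarrow y\}$ is the event that $x$ and $y$ are in the same cluster. Cut-off measures: for $r>0$ let $J_r(x,y)=\mathbf{1}(x\neq y,\|x-y\|\le r)\int_{\|x-y\|}^r|J'(s)|\,ds$, and let $\mathbb{P}_{\beta,r}$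 denote the law of long-range percolation with kernel $J_r$ at parameter $\beta$. $\beta_c$ always denotes the critical point of the original kernel $J$. The notation $\preceq$ means inequality up to a positive multiplicative constant depending only on $d$, $\alpha$, and the kernel $J$ (including the norm); $c$ likewise does not depend on $r,x,y$. *)

theory Defs
  imports "HOL-Probability.Probability"
begin

definition is_norm :: "('a::real_vector \<Rightarrow> real) \<Rightarrow> bool" where
  "is_norm N \<longleftrightarrow>
     (\<forall>x. N x \<ge> 0) \<and> (\<forall>x. N x = 0 \<longleftrightarrow> x = 0) \<and>
     (\<forall>a x. N (a *\<^sub>R x) = \<bar>a\<bar> * N x) \<and>
     (\<forall>x y. N (x + y) \<le> N x + N y)"

definition lattice_dist :: "(real ^ 'd \<Rightarrow> real) \<Rightarrow> int ^ 'd \<Rightarrow> int ^ 'd \<Rightarrow> real" where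
  "lattice_dist N x y = N (\<chi> i. real_of_int (x $ i - y $ i))"

definition edges :: "'v set set" where
  "edges = {e. \<exists>x y. x \<noteq> y \<and> e = {x, y}}"

(* Well defined on edges for symmetric kernels, the only ones used. *)
definition edge_weight :: "('v \<Rightarrow> 'v \<Rightarrow> real) \<Rightarrow> 'v set \<Rightarrow> real" where
  "edge_weight K e = (THE w. \<exists>x y. e = {x, y} \<and> w = K x y)"

definition percolation :: "('v \<Rightarrow> 'v \<Rightarrow> real) \<Rightarrow> real \<Rightarrow> ('v set \<Rightarrow> bool) measure" where
  "percolation K \<beta> =
     PiM edges (\<lambda>e. measure_pmf (bernoulli_pmf (1 - exp (- \<beta> * edge_weight K e))))"

definition linked :: "('v set \<Rightarrow> bool) \<Rightarrow> 'v \<Rightarrow> 'v \<Rightarrow> bool" where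
  "linked \<omega> x y \<longleftrightarrow> (x, y) \<in> {(u, v). u \<noteq> v \<and> \<omega> {u, v}}\<^sup>*"

definition cluster :: "('v set \<Rightarrow> bool) \<Rightarrow> 'v \<Rightarrow> 'v set" where
  "cluster \<omega> x = {y. linked \<omega> x y}"

definition two_point :: "('v \<Rightarrow> 'v \<Rightarrow> real) \<Rightarrow> real \<Rightarrow> 'v \<Rightarrow> 'v \<Rightarrow> real" where
  "two_point K \<beta> x y =
     measure (percolation K \<beta>) {\<omega> \<in> space (percolation K \<beta>). linked \<omega> x y}"

(* A real infimum: for the power-law kernels with exponent less than 1 considered
   below the set is nonempty in every dimension, so this is the usual critical point. *)
definition critical_point :: "('v \<Rightarrow> 'v \<Rightarrow> real) \<Rightarrow> real" where
  "critical_point K =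
     Inf {\<beta>. 0 \<le> \<beta> \<and>
        measure (percolation K \<beta>)
          {\<omega> \<in> space (percolation K \<beta>). \<exists>x. infinite (cluster \<omega> x)} > 0}"

definition lr_kernel ::
    "(real ^ 'd \<Rightarrow> real) \<Rightarrow> (real \<Rightarrow> real) \<Rightarrow> int ^ 'd \<Rightarrow> int ^ 'd \<Rightarrow> real" where
  "lr_kernel N J x y = (if x \<noteq> y then J (lattice_dist N x y) else 0)"

definition cutoff_kernel ::
    "(real ^ 'd \<Rightarrow> real) \<Rightarrow> (real \<Rightarrow> real) \<Rightarrow> real \<Rightarrow> int ^ 'd \<Rightarrow> int ^ 'd \<Rightarrow> real" where
  "cutoff_kernel N J r x y =
     (if x \<noteq> y \<and> lattice_dist N x y \<le> r
      then (LBINT s:{lattice_dist N x y..r}. \<bar>deriv J s\<bar>) else 0)"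

end

theory Submission
  imports Defs
begin

text \<open>For a finite block let X be the number of ordered pairs of vertices connected inside the
  block. Four vertices of one cluster can be paired up by edge-disjoint paths, so the BK inequality
  gives E X^2 <= 3 (E X)^2, hence X >= E X / 2 with probability at least 1/16. Adding the edges between
  independent blocks of side N then shows that E X >= A N^(d + alpha) propagates from side N to side k N
  and so to all sides k^n N. This contradicts a finite susceptibility, which holds for beta < beta_c by
  a sprinkling form of the Duminil-Copin--Tassion argument. So, below beta_c and uniformly near it, the
  expected cluster size in a cube of radius n is at most of order n^alpha.

  As alpha < 1, averaging the Simon--Lieb inequality over cubes whose radius is a large multiple of r
  turns this into sum_y P_r(x <-> y) exp(c |x - y| / r) <= C r^alpha for the kernel truncated at r.
  By BK, the two-point functions at r / 2 and r differ by at most the kernel increment, of order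
  r^(-d - alpha) on |a - b| <= r, summed against P_r(x <-> a) P_r(b <-> y); the weighted bound makes this
  a multiple of r^(-d + alpha) exp(-c |x - y| / r). Summing over dyadic r and letting beta increase to
  beta_c gives the theorem.\<close>

section \<open>Product measures on finite edge sets and the BK inequality\<close>

text \<open>The obstacle is uniformity. Finite susceptibility at each beta < beta_c comes with no
  control as beta approaches beta_c, while the bounds must survive that limit. Finiteness therefore
  serves only to forbid growth: were E X above a threshold at side N, it would outgrow the volume
  along the sides k^n N. The threshold depends on beta only through a factor 1 / beta, so nothing
  degenerates near a positive beta_c; beta_c = 0 is a separate trivial case. The same bound at large
  beta would push the mean cluster size below 1 if percolation never occurred, which is why beta_c
  is finite, even for d = 1.

  The block step needs k^(2 d) / 1024 to beat k^(d + alpha), possible as alpha < d. The condition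
  alpha < 1 is stronger: it makes long edges dominate the first moment of the truncated kernel. For
  a suitable radius of order n the mean number of open edges from the origin's cluster in the cube
  to the outside is then at most of order (n / r)^(alpha - 1), small once n / r is large.

  Estimates are finite sums over finite edge sets, with constants free of the set; measure theory
  enters only in the passage to infinite volume.\<close>

definition expect :: "'e set \<Rightarrow> ('e \<Rightarrow> real) \<Rightarrow> ('e set \<Rightarrow> real) \<Rightarrow> real" where
  "expect E p f = (\<Sum>\<omega>\<in>Pow E. (\<Prod>e\<in>\<omega>. p e) * (\<Prod>e\<in>E - \<omega>. 1 - p e) * f \<omega>)"

definition prb :: "'e set \<Rightarrow> ('e \<Rightarrow> real) \<Rightarrow> ('e set \<Rightarrow> bool) \<Rightarrow> real" where
  "prb E p A = expect E p (\<lambda>\<omega>. of_bool (A \<omega>))"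

text \<open>Separate from \<open>expect\<close> because the identities for \<open>expect\<close> are
  polynomial identities in the weights; the range [0, 1] enters with positivity and
  monotonicity.\<close>

definition probs :: "'e set \<Rightarrow> ('e \<Rightarrow> real) \<Rightarrow> bool" where
  "probs E p \<longleftrightarrow> finite E \<and> (\<forall>e\<in>E. 0 \<le> p e \<and> p e \<le> 1)"

lemma probs_subset: "probs E p \<Longrightarrow> F \<subseteq> E \<Longrightarrow> probs F p"
  by (auto simp: probs_def intro: finite_subset)

lemma probs_finite: "probs E p \<Longrightarrow> finite E"
  by (simp add: probs_def)

lemma probs_insertD: "probs (insert e E) p \<Longrightarrow> probs E p"
  by (rule probs_subset) auto

lemma expect_empty [simp]: "expect {} p f = f {}"
  by (simp add: expect_def)

text \<open>Conditioning on the state of one edge. This recursion is the engine of the inductions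
  over edge sets that follow.\<close>

lemma expect_insert:
  assumes "finite E" "e \<notin> E"
  shows "expect (insert e E) p f = p e * expect E p (\<lambda>\<omega>. f (insert e \<omega>)) + (1 - p e) * expect E p f"
proof -
  have inj: "inj_on (insert e) (Pow E)"
    using assms(2) by (auto simp: inj_on_def)
  have disj: "Pow E \<inter> insert e ` Pow E = {}"
    using assms(2) by auto
  have 1: "(\<Prod>x\<in>insert e E - \<omega>. 1 - p x) = (1 - p e) * (\<Prod>x\<in>E - \<omega>. 1 - p x)" if "\<omega> \<in> Pow E" for \<omega>
  proof -
    have "insert e E - \<omega> = insert e (E - \<omega>)" using that assms(2) by auto
    then show ?thesis using assms by simp
  qed
  have 2: "(\<Prod>x\<in>insert e \<omega>. p x) = p e * (\<Prod>x\<in>\<omega>. p x)" if "\<omega> \<in> Pow E" for \<omega>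
    using that assms by (subst prod.insert) (auto intro: finite_subset)
  have 3: "insert e E - insert e \<omega> = E - \<omega>" if "\<omega> \<in> Pow E" for \<omega>
    using that assms by auto
  have "expect (insert e E) p f =
     (\<Sum>\<omega>\<in>Pow E. (\<Prod>e\<in>\<omega>. p e) * (\<Prod>x\<in>insert e E - \<omega>. 1 - p x) * f \<omega>)
     + (\<Sum>\<omega>\<in>insert e ` Pow E. (\<Prod>e\<in>\<omega>. p e) * (\<Prod>x\<in>insert e E - \<omega>. 1 - p x) * f \<omega>)"
    unfolding expect_def Pow_insert using assms disj by (subst sum.union_disjoint) auto
  also have "(\<Sum>\<omega>\<in>Pow E. (\<Prod>e\<in>\<omega>. p e) * (\<Prod>x\<in>insert e E - \<omega>. 1 - p x) * f \<omega>) = (1 - p e) * expect E p f"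
    unfolding expect_def sum_distrib_left by (rule sum.cong) (auto simp: 1)
  also have "(\<Sum>\<omega>\<in>insert e ` Pow E. (\<Prod>e\<in>\<omega>. p e) * (\<Prod>x\<in>insert e E - \<omega>. 1 - p x) * f \<omega>)
     = p e * expect E p (\<lambda>\<omega>. f (insert e \<omega>))"
    unfolding expect_def sum_distrib_left sum.reindex[OF inj] o_def
  proof (rule sum.cong)
    fix \<omega> assume "\<omega> \<in> Pow E"
    then show "prod p (insert e \<omega>) * (\<Prod>x\<in>insert e E - insert e \<omega>. 1 - p x) * f (insert e \<omega>)
      = p e * (prod p \<omega> * (\<Prod>e\<in>E - \<omega>. 1 - p e) * f (insert e \<omega>))"
      by (simp only: 2 3 mult.assoc)
  qed simp
  finally show ?thesis by simp
qed

lemma expect_add: "expect E p (\<lambda>\<omega>. f \<omega> + g \<omega>) = expect E p f + expect E p g"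
  by (simp add: expect_def algebra_simps sum.distrib)

lemma expect_diff: "expect E p (\<lambda>\<omega>. f \<omega> - g \<omega>) = expect E p f - expect E p g"
  by (simp add: expect_def algebra_simps sum_subtractf)

lemma expect_cmult: "expect E p (\<lambda>\<omega>. c * f \<omega>) = c * expect E p f"
  by (simp add: expect_def algebra_simps sum_distrib_left)

lemma expect_multc: "expect E p (\<lambda>\<omega>. f \<omega> * c) = expect E p f * c"
  by (simp add: expect_def algebra_simps sum_distrib_left)

lemma expect_sum: "expect E p (\<lambda>\<omega>. \<Sum>i\<in>I. f i \<omega>) = (\<Sum>i\<in>I. expect E p (f i))"
  unfolding expect_def sum_distrib_left by (rule sum.swap)

lemma expect_cong:
  "(\<And>\<omega>. \<omega> \<subseteq> E \<Longrightarrow> f \<omega> = g \<omega>) \<Longrightarrow> expect E p f = expect E p g"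
  unfolding expect_def by (rule sum.cong) auto

lemma expect_cong_prob:
  "(\<And>e. e \<in> E \<Longrightarrow> p e = q e) \<Longrightarrow> expect E p f = expect E q f"
  unfolding expect_def by (intro sum.cong arg_cong2[where f="(*)"] prod.cong refl) auto

lemma expect_const [simp]:
  assumes "finite E"
  shows "expect E p (\<lambda>_. c) = c"
  using assms by induction (simp_all add: expect_insert algebra_simps)

lemma expect_mono:
  assumes "probs E p" "\<And>\<omega>. \<omega> \<subseteq> E \<Longrightarrow> f \<omega> \<le> g \<omega>"
  shows "expect E p f \<le> expect E p g"
  unfolding expect_def
proof (intro sum_mono mult_left_mono mult_nonneg_nonneg prod_nonneg)
qed (use assms in \<open>auto simp: probs_def\<close>)

lemma expect_nonneg:
  assumes "probs E p" "\<And>\<omega>. \<omega> \<subseteq> E \<Longrightarrow> 0 \<le> f \<omega>"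
  shows "0 \<le> expect E p f"
  using expect_mono[OF assms(1), of "\<lambda>_. 0" f] assms(2) probs_finite[OF assms(1)] by simp

lemma prb_mono:
  assumes "probs E p" "\<And>\<omega>. \<omega> \<subseteq> E \<Longrightarrow> A \<omega> \<Longrightarrow> B \<omega>"
  shows "prb E p A \<le> prb E p B"
  unfolding prb_def by (rule expect_mono[OF assms(1)]) (use assms(2) in \<open>auto simp: of_bool_def\<close>)

lemma prb_nonneg: "probs E p \<Longrightarrow> 0 \<le> prb E p A"
  unfolding prb_def by (rule expect_nonneg) auto

lemma prb_le_1: "probs E p \<Longrightarrow> prb E p A \<le> 1"
  using expect_mono[of E p "\<lambda>\<omega>. of_bool (A \<omega>)" "\<lambda>_. 1"] probs_finite[of E p]
  by (simp add: prb_def of_bool_def)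

lemma expect_union:
  assumes "finite E" "finite F" "E \<inter> F = {}"
  shows "expect (E \<union> F) p f = expect E p (\<lambda>\<omega>. expect F p (\<lambda>\<eta>. f (\<omega> \<union> \<eta>)))"
  using assms
proof (induction E arbitrary: f)
  case (insert e E)
  have "expect (insert e E \<union> F) p f = p e * expect (E \<union> F) p (\<lambda>\<omega>. f (insert e \<omega>)) + (1 - p e) * expect (E \<union> F) p f"
    using insert.prems insert.hyps by (simp add: expect_insert)
  with insert show ?case by (simp add: expect_insert)
qed simp

lemma expect_restrict:
  assumes "finite E" "F \<subseteq> E"
  shows "expect E p (\<lambda>\<omega>. f (\<omega> \<inter> F)) = expect F p f"
proof -
  have fin: "finite F" "finite (E - F)" using assms finite_subset by auto
  have "expect (F \<union> (E - F)) p (\<lambda>\<omega>. f (\<omega> \<inter> F)) = expect F p (\<lambda>\<omega>. expect (E - F) p (\<lambda>\<eta>. f ((\<omega> \<union> \<eta>) \<inter> F)))"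
    using fin by (subst expect_union) auto
  also have "\<dots> = expect F p (\<lambda>\<omega>. expect (E - F) p (\<lambda>\<eta>. f \<omega>))"
    by (intro expect_cong arg_cong[where f=f]) auto
  also have "\<dots> = expect F p f" using fin by simp
  also have "F \<union> (E - F) = E" using assms by auto
  finally show ?thesis .
qed

lemma expect_restrict_diff:
  assumes "finite E" "F \<subseteq> E"
  shows "expect E p (\<lambda>\<omega>. f (\<omega> - F)) = expect (E - F) p f"
proof -
  have "expect E p (\<lambda>\<omega>. f (\<omega> - F)) = expect E p (\<lambda>\<omega>. f (\<omega> \<inter> (E - F)))"
    by (intro expect_cong arg_cong[where f=f]) auto
  with expect_restrict[OF assms(1), of "E - F"] show ?thesis by auto
qed

lemma expect_indep:
  assumes "finite E" "F \<subseteq> E"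
  shows "expect E p (\<lambda>\<omega>. g (\<omega> \<inter> F) * h (\<omega> - F)) = expect F p g * expect (E - F) p h"
proof -
  have fin: "finite F" "finite (E - F)" using assms finite_subset by auto
  have "expect (F \<union> (E - F)) p (\<lambda>\<omega>. g (\<omega> \<inter> F) * h (\<omega> - F))
      = expect F p (\<lambda>\<omega>. expect (E - F) p (\<lambda>\<eta>. g ((\<omega> \<union> \<eta>) \<inter> F) * h ((\<omega> \<union> \<eta>) - F)))"
    using fin by (subst expect_union) auto
  also have "\<dots> = expect F p (\<lambda>\<omega>. expect (E - F) p (\<lambda>\<eta>. g \<omega> * h \<eta>))"
    by (intro expect_cong arg_cong2[where f="\<lambda>a b. g a * h b"]) auto
  also have "\<dots> = expect F p g * expect (E - F) p h" by (simp add: expect_cmult expect_multc)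
  also have "F \<union> (E - F) = E" using assms by auto
  finally show ?thesis .
qed

lemma expect_image:
  assumes "inj_on g E" "finite E"
  shows "expect (g ` E) p f = expect E (\<lambda>e. p (g e)) (\<lambda>\<omega>. f (g ` \<omega>))"
  using assms(2,1)
proof (induction E arbitrary: f)
  case (insert e E)
  then show ?case by (simp add: expect_insert)
qed simp

text \<open>An edge is closed in the union of two independent configurations iff it is closed in
  both. For weights of the form 1 - exp (- b w) this makes b additive: raising b by h amounts to
  adding an independent configuration of parameter h.\<close>

lemma expect_sprinkle:
  assumes "finite E"
  shows "expect E (\<lambda>e. 1 - (1 - p e) * (1 - q e)) f = expect E p (\<lambda>\<omega>. expect E q (\<lambda>\<eta>. f (\<omega> \<union> \<eta>)))"
  using assms
proof (induction E arbitrary: f)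
  case (insert e E)
  have "expect (insert e E) p (\<lambda>\<omega>. expect (insert e E) q (\<lambda>\<eta>. f (\<omega> \<union> \<eta>)))
      = p e * expect E p (\<lambda>\<omega>. expect E q (\<lambda>\<eta>. f (insert e (\<omega> \<union> \<eta>)))) +
        (1 - p e) * (q e * expect E p (\<lambda>\<omega>. expect E q (\<lambda>\<eta>. f (insert e (\<omega> \<union> \<eta>)))) +
                     (1 - q e) * expect E p (\<lambda>\<omega>. expect E q (\<lambda>\<eta>. f (\<omega> \<union> \<eta>))))"
    using insert.hyps by (simp add: expect_insert expect_add expect_cmult) (simp add: algebra_simps)
  also have "\<dots> = expect (insert e E) (\<lambda>e. 1 - (1 - p e) * (1 - q e)) f"
    unfolding expect_insert[OF insert.hyps(1,2)] insert.IH by (simp only: algebra_simps)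
  finally show ?case by simp
qed simp

text \<open>In the weight of a single edge the expectation is affine, and its slope is the mean gain
  from opening that edge, nonnegative for increasing \<open>f\<close>.\<close>

lemma expect_mono_prob:
  assumes "probs E p" "probs E q" "\<And>e. e \<in> E \<Longrightarrow> p e \<le> q e"
    and "\<And>\<omega> \<eta>. \<omega> \<subseteq> \<eta> \<Longrightarrow> \<eta> \<subseteq> E \<Longrightarrow> f \<omega> \<le> f \<eta>"
  shows "expect E p f \<le> expect E q f"
  using probs_finite[OF assms(1)] assms
proof (induction E arbitrary: f)
  case (insert e E)
  let ?f = "\<lambda>\<omega>. f (insert e \<omega>)"
  have pr: "probs E p" "probs E q" using insert.prems(1,2) by (auto intro: probs_insertD)
  have pe: "0 \<le> p e" "p e \<le> q e" "q e \<le> 1" using insert.prems by (auto simp: probs_def)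
  have 1: "expect E p ?f \<le> expect E q ?f"
    by (rule insert.IH) (use insert.prems pr in \<open>auto intro!: insert.prems(4)\<close>)
  have 2: "expect E p f \<le> expect E q f"
    by (rule insert.IH) (use insert.prems pr in \<open>auto intro!: insert.prems(4)\<close>)
  have 3: "expect E q f \<le> expect E q ?f"
    by (rule expect_mono[OF pr(2)]) (auto intro!: insert.prems(4))
  have "p e * expect E p ?f + (1 - p e) * expect E p f \<le> p e * expect E q ?f + (1 - p e) * expect E q f"
    using 1 2 pe by (intro add_mono mult_left_mono) auto
  also have "\<dots> = expect E q f + p e * (expect E q ?f - expect E q f)" by (simp add: algebra_simps)
  also have "\<dots> \<le> expect E q f + q e * (expect E q ?f - expect E q f)"
    using 3 pe by (intro add_left_mono mult_right_mono) auto
  also have "\<dots> = q e * expect E q ?f + (1 - q e) * expect E q f" by (simp add: algebra_simps)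
  finally show ?case using insert.hyps by (simp add: expect_insert)
qed simp

lemma prb_none:
  assumes "finite E" "F \<subseteq> E"
  shows "prb E p (\<lambda>\<omega>. \<omega> \<inter> F = {}) = (\<Prod>e\<in>F. 1 - p e)"
proof -
  have fin: "finite F" using assms finite_subset by auto
  have "prb E p (\<lambda>\<omega>. \<omega> \<inter> F = {}) = expect F p (\<lambda>\<omega>. of_bool (\<omega> = {}))"
    unfolding prb_def using expect_restrict[OF assms, of p "\<lambda>\<omega>. of_bool (\<omega> = {})"] by simp
  also have "\<dots> = (\<Prod>e\<in>F. 1 - p e)"
    using fin
  proof induction
    case (insert e F)
    have "expect F p (\<lambda>\<omega>. (0::real)) = 0" using insert by simp
    with insert show ?case by (simp add: expect_insert)
  qed simp
  finally show ?thesis .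
qed

lemma tendsto_expect:
  assumes "finite E" "\<And>e. e \<in> E \<Longrightarrow> ((\<lambda>b. P b e) \<longlongrightarrow> P0 e) F"
  shows "((\<lambda>b. expect E (P b) f) \<longlongrightarrow> expect E P0 f) F"
  unfolding expect_def
  by (intro tendsto_sum tendsto_mult tendsto_prod tendsto_diff tendsto_const) (use assms in auto)

text \<open>One edge of the doubling argument. \<open>Q2\<close> and \<open>Q1\<close> are the event
  with a single copy of the edge open and closed; \<open>P1\<close> to \<open>P4\<close> are the
  event with two independent copies, in the states open-open, open-closed, closed-open,
  closed-closed.\<close>

lemma bk_edge_inequality:
  fixes p :: real
  assumes p: "0 \<le> p" "p \<le> 1"
    and "Q1 \<Longrightarrow> P4" "Q2 \<Longrightarrow> P1 \<and> (P2 \<or> P3)" "P4 \<Longrightarrow> P1 \<and> P2 \<and> P3"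
  shows "p * of_bool Q2 + (1 - p) * of_bool Q1
    \<le> p * (p * of_bool P1 + (1 - p) * of_bool P2) + (1 - p) * (p * of_bool P3 + (1 - p) * of_bool P4)"
    (is "?l \<le> ?r")
proof -
  have r: "0 \<le> ?r" using p by (intro add_nonneg_nonneg mult_nonneg_nonneg) auto
  \<comment> \<open>If \<open>P4\<close> holds the right side is 1. If only \<open>Q2\<close> holds
    the left side is p, and the right side is at least p^2 + p (1 - p) = p.\<close>
  consider "P4" | "\<not> P4" "Q2" | "\<not> P4" "\<not> Q2" by blast
  then show ?thesis
  proof cases
    case 1
    have "?l \<le> p * 1 + (1 - p) * 1" using p by (intro add_mono mult_left_mono) auto
    with 1 assms show ?thesis by (simp add: algebra_simps)
  next
    case 2
    have "0 \<le> p * (1 - p)" using p by simp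
    with 2 assms show ?thesis by (cases P2; cases P3) (auto simp: algebra_simps)
  next
    case 3
    with assms r show ?thesis by auto
  qed
qed

text \<open>The edges are doubled one at a time, so that the second witness may use its own copies.
  A doubled edge is at least as useful to two disjoint witnesses as a single one.\<close>

lemma bk_relation:
  assumes "probs E p"
  shows "prb E p (\<lambda>\<omega>. \<exists>(a, b)\<in>R. a \<inter> b = {} \<and> a \<union> b \<subseteq> \<omega>)
    \<le> expect E p (\<lambda>\<omega>. expect E p (\<lambda>\<eta>. of_bool (\<exists>(a, b)\<in>R. a \<subseteq> \<omega> \<and> b \<subseteq> \<eta>)))"
  using probs_finite[OF assms] assms
proof (induction E arbitrary: R)
  case empty
  show ?case by (auto simp: prb_def)
next
  case (insert e E)
  have pr: "probs E p" using insert.prems by (rule probs_insertD)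
  have pe: "0 \<le> p e" "p e \<le> 1" using insert.prems by (auto simp: probs_def)
  have neE: "e \<notin> E" by fact
  \<comment> \<open>\<open>R1\<close> serves a closed edge e and \<open>R2\<close> an open one. In
    \<open>R2\<close> the edge is erased from the witnesses, and pairs in which both use it are
    dropped: disjoint witnesses cannot share e.\<close>
  define R1 where "R1 = {(a, b)\<in>R. e \<notin> a \<and> e \<notin> b}"
  define R2 where "R2 = (\<lambda>(a, b). (a - {e}, b - {e})) ` {(a, b)\<in>R. \<not> (e \<in> a \<and> e \<in> b)}"
  let ?D = "\<lambda>R \<omega>. \<exists>(a, b)\<in>R. a \<inter> b = {} \<and> a \<union> b \<subseteq> \<omega>"
  let ?P = "\<lambda>R \<omega> \<eta>. \<exists>(a, b)\<in>R. a \<subseteq> \<omega> \<and> b \<subseteq> \<eta>"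
  have D1: "?D R \<omega> \<longleftrightarrow> ?D R1 \<omega>" if "\<omega> \<subseteq> E" for \<omega>
    using that neE unfolding R1_def by blast
  have D2: "?D R2 \<omega>" if w: "\<omega> \<subseteq> E" and D: "?D R (insert e \<omega>)" for \<omega>
  proof -
    from D obtain a b where ab: "(a, b) \<in> R" "a \<inter> b = {}" "a \<union> b \<subseteq> insert e \<omega>" by blast
    then have "(a, b) \<in> {(a, b)\<in>R. \<not> (e \<in> a \<and> e \<in> b)}" by blast
    then have "(a - {e}, b - {e}) \<in> R2" unfolding R2_def by (rule rev_image_eqI) simp
    moreover have "(a - {e}) \<inter> (b - {e}) = {} \<and> (a - {e}) \<union> (b - {e}) \<subseteq> \<omega>" using ab by blast
    ultimately show ?thesis by blast
  qed
  have "prb (insert e E) p (?D R) = p e * prb E p (\<lambda>\<omega>. ?D R (insert e \<omega>)) + (1 - p e) * prb E p (?D R)"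
    using insert.hyps by (simp add: prb_def expect_insert)
  also have "\<dots> \<le> p e * prb E p (?D R2) + (1 - p e) * prb E p (?D R1)"
    using pe D1 D2 by (intro add_mono mult_left_mono prb_mono[OF pr]) auto
  also have "\<dots> \<le> p e * expect E p (\<lambda>\<omega>. expect E p (\<lambda>\<eta>. of_bool (?P R2 \<omega> \<eta>)))
      + (1 - p e) * expect E p (\<lambda>\<omega>. expect E p (\<lambda>\<eta>. of_bool (?P R1 \<omega> \<eta>)))"
    using pe by (intro add_mono mult_left_mono insert.IH pr) auto
  also have "\<dots> = expect E p (\<lambda>\<omega>. expect E p (\<lambda>\<eta>. p e * of_bool (?P R2 \<omega> \<eta>) + (1 - p e) * of_bool (?P R1 \<omega> \<eta>)))"
    by (simp add: expect_add expect_cmult)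
  also have "\<dots> \<le> expect E p (\<lambda>\<omega>. expect E p (\<lambda>\<eta>.
        p e * (p e * of_bool (?P R (insert e \<omega>) (insert e \<eta>)) + (1 - p e) * of_bool (?P R (insert e \<omega>) \<eta>))
      + (1 - p e) * (p e * of_bool (?P R \<omega> (insert e \<eta>)) + (1 - p e) * of_bool (?P R \<omega> \<eta>))))"
  proof (intro expect_mono[OF pr])
    fix \<omega> \<eta> assume w: "\<omega> \<subseteq> E" "\<eta> \<subseteq> E"
    show "p e * of_bool (?P R2 \<omega> \<eta>) + (1 - p e) * of_bool (?P R1 \<omega> \<eta>)
      \<le> p e * (p e * of_bool (?P R (insert e \<omega>) (insert e \<eta>)) + (1 - p e) * of_bool (?P R (insert e \<omega>) \<eta>))
      + (1 - p e) * (p e * of_bool (?P R \<omega> (insert e \<eta>)) + (1 - p e) * of_bool (?P R \<omega> \<eta>))"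
    proof (rule bk_edge_inequality[OF pe])
      show "?P R1 \<omega> \<eta> \<Longrightarrow> ?P R \<omega> \<eta>" unfolding R1_def by blast
      show "?P R \<omega> \<eta> \<Longrightarrow> ?P R (insert e \<omega>) (insert e \<eta>) \<and> ?P R (insert e \<omega>) \<eta> \<and> ?P R \<omega> (insert e \<eta>)"
        by blast
      assume "?P R2 \<omega> \<eta>"
      then obtain a b where ab: "(a, b) \<in> R" "\<not> (e \<in> a \<and> e \<in> b)" "a - {e} \<subseteq> \<omega>" "b - {e} \<subseteq> \<eta>"
        unfolding R2_def by auto
      have "a \<subseteq> insert e \<omega>" "b \<subseteq> insert e \<eta>" "a \<subseteq> \<omega> \<or> b \<subseteq> \<eta>" using ab(2-4) by blast+
      with ab(1) show "?P R (insert e \<omega>) (insert e \<eta>) \<and> (?P R (insert e \<omega>) \<eta> \<or> ?P R \<omega> (insert e \<eta>))"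
        by blast
    qed
  qed
  also have "\<dots> = expect (insert e E) p (\<lambda>\<omega>. expect (insert e E) p (\<lambda>\<eta>. of_bool (?P R \<omega> \<eta>)))"
    unfolding expect_insert[OF insert.hyps(1,2)] expect_add expect_cmult by (simp only: algebra_simps)
  finally show ?case .
qed

text \<open>The witness relation is taken to be all pairs from \<open>A\<close> and
  \<open>B\<close>; for increasing events, containing a witness is the same as belonging to the
  event, so the doubled probability factorises.\<close>

lemma bk:
  assumes "probs E p"
    and "\<And>\<omega>. \<omega> \<subseteq> E \<Longrightarrow> Q \<omega> \<Longrightarrow> \<exists>a b. A a \<and> B b \<and> a \<inter> b = {} \<and> a \<union> b \<subseteq> \<omega>"
    and "\<And>a b. a \<subseteq> b \<Longrightarrow> A a \<Longrightarrow> A b" "\<And>a b. a \<subseteq> b \<Longrightarrow> B a \<Longrightarrow> B b"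
  shows "prb E p Q \<le> prb E p A * prb E p B"
proof -
  let ?R = "{(a, b). A a \<and> B b}"
  have "prb E p Q \<le> prb E p (\<lambda>\<omega>. \<exists>(a, b)\<in>?R. a \<inter> b = {} \<and> a \<union> b \<subseteq> \<omega>)"
    using assms(2) by (intro prb_mono[OF assms(1)]) fastforce
  also have "\<dots> \<le> expect E p (\<lambda>\<omega>. expect E p (\<lambda>\<eta>. of_bool (\<exists>(a, b)\<in>?R. a \<subseteq> \<omega> \<and> b \<subseteq> \<eta>)))"
    by (rule bk_relation[OF assms(1)])
  also have "\<dots> \<le> expect E p (\<lambda>\<omega>. expect E p (\<lambda>\<eta>. of_bool (A \<omega>) * of_bool (B \<eta>)))"
    using assms(3,4) by (intro expect_mono[OF assms(1)]) (auto simp: of_bool_def)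
  also have "\<dots> = prb E p A * prb E p B"
    by (simp add: prb_def expect_cmult expect_multc)
  finally show ?thesis .
qed

section \<open>Connections inside finite vertex sets\<close>

definition conn :: "'v set set \<Rightarrow> 'v \<Rightarrow> 'v \<Rightarrow> bool" where
  "conn W x y \<longleftrightarrow> linked (\<lambda>e. e \<in> W) x y"

definition edges_in :: "'v set \<Rightarrow> 'v set set" where
  "edges_in V = {e. \<exists>x\<in>V. \<exists>y\<in>V. x \<noteq> y \<and> e = {x, y}}"

lemma conn_def': "conn W x y \<longleftrightarrow> (x, y) \<in> {(u, v). u \<noteq> v \<and> {u, v} \<in> W}\<^sup>*"
  by (simp add: conn_def linked_def)

lemma conn_refl [simp]: "conn W x x"
  by (simp add: conn_def')

lemma conn_trans: "conn W x y \<Longrightarrow> conn W y z \<Longrightarrow> conn W x z"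
  unfolding conn_def' by (rule rtrancl_trans)

lemma conn_sym: "conn W x y \<Longrightarrow> conn W y x"
proof -
  have "sym {(u, v). u \<noteq> v \<and> {u, v} \<in> W}" by (auto simp: sym_def insert_commute)
  then show "conn W x y \<Longrightarrow> conn W y x"
    unfolding conn_def' by (rule symD[OF sym_rtrancl])
qed

lemma conn_commute: "conn W x y \<longleftrightarrow> conn W y x"
  by (blast intro: conn_sym)

lemma conn_edge: "{x, y} \<in> W \<Longrightarrow> conn W x y"
  unfolding conn_def' by (cases "x = y") auto

lemma conn_mono: "W \<subseteq> W' \<Longrightarrow> conn W x y \<Longrightarrow> conn W' x y"
  unfolding conn_def' by (rule subsetD[OF rtrancl_mono]) auto

lemma conn_induct [consumes 1, case_names refl step]:
  assumes "conn W x y" "P x"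
    "\<And>u v. conn W x u \<Longrightarrow> u \<noteq> v \<Longrightarrow> {u, v} \<in> W \<Longrightarrow> P u \<Longrightarrow> P v"
  shows "P y"
  using assms(1)[unfolded conn_def'] assms(2)
  by (induction rule: rtrancl_induct) (use assms(3)[unfolded conn_def'] in auto)

lemma conn_edges_in:
  assumes "conn W x y" "W \<subseteq> edges_in V" "x \<in> V"
  shows "y \<in> V"
  using assms by (induction rule: conn_induct) (auto simp: edges_in_def doubleton_eq_iff)

lemma edges_in_mono: "S \<subseteq> V \<Longrightarrow> edges_in S \<subseteq> edges_in V"
  by (auto simp: edges_in_def)

lemma edges_in_iff: "x \<noteq> y \<Longrightarrow> {x, y} \<in> edges_in V \<longleftrightarrow> x \<in> V \<and> y \<in> V"
  by (auto simp: edges_in_def doubleton_eq_iff)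

lemma finite_edges_in: "finite V \<Longrightarrow> finite (edges_in V)"
  by (rule finite_subset[of _ "(\<lambda>(x, y). {x, y}) ` (V \<times> V)"]) (auto simp: edges_in_def)

lemma conn_cluster_edges:
  assumes "conn W x y"
  shows "conn {e \<in> W. e \<inter> {v. conn W x v} \<noteq> {}} x y"
  using assms
proof (induction rule: conn_induct)
  case (step u v)
  then have "{u, v} \<in> {e \<in> W. e \<inter> {v. conn W x v} \<noteq> {}}" by auto
  from conn_trans[OF step.IH conn_edge[OF this]] show ?case .
qed simp

text \<open>The induction along the path carries the most recent edge by which it left
  \<open>K\<close>; every later visit to \<open>K\<close> resets it.\<close>

lemma conn_last_exit:
  assumes "conn W x y" "x \<in> K" "y \<notin> K"
  shows "\<exists>a b. a \<in> K \<and> b \<notin> K \<and> {a, b} \<in> W \<and> conn {e \<in> W. e \<inter> K = {}} b y"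
proof -
  let ?W = "{e \<in> W. e \<inter> K = {}}"
  have "y \<in> K \<or> (\<exists>a b. a \<in> K \<and> b \<notin> K \<and> {a, b} \<in> W \<and> conn ?W b y)"
    using assms(1)
  proof (induction rule: conn_induct)
    case refl
    show ?case using assms(2) ..
  next
    case (step u v)
    show ?case
    proof (cases "v \<in> K")
      case vK: False
      show ?thesis
      proof (cases "u \<in> K")
        case True
        with vK step.hyps show ?thesis by (intro disjI2 exI[of _ u] exI[of _ v]) simp
      next
        case False
        with step.IH obtain a b where ab: "a \<in> K" "b \<notin> K" "{a, b} \<in> W" "conn ?W b u" by auto
        have "{u, v} \<in> ?W" using step.hyps(3) False vK by simp
        then have "conn ?W b v" by (rule conn_trans[OF ab(4) conn_edge])
        with ab show ?thesis by (intro disjI2 exI[of _ a] exI[of _ b]) simp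
      qed
    qed simp
  qed
  with assms(3) show ?thesis by simp
qed

text \<open>Take \<open>K\<close> to be the \<open>F\<close>-cluster of x and cut at the last exit
  from it. The part up to a uses edges that meet \<open>K\<close>, the part from b uses edges that
  miss \<open>K\<close>, and the crossing edge lies in neither. This one decomposition feeds the
  Simon--Lieb inequality, the bound for pivotal edges and the bridge argument.\<close>

lemma conn_split:
  assumes "conn W x y" "F \<subseteq> W" "\<not> conn F x y"
  shows "\<exists>a b A B. a \<noteq> b \<and> {a, b} \<in> W - F \<and> conn F x a \<and> A \<inter> B = {} \<and> A \<subseteq> F \<and> B \<subseteq> W
    \<and> {a, b} \<notin> B \<and> conn A x a \<and> conn B b y"
proof -
  define K where "K = {v. conn F x v}"
  define A where "A = {e \<in> F. e \<inter> K \<noteq> {}}"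
  define B where "B = {e \<in> W. e \<inter> K = {}}"
  have "x \<in> K" "y \<notin> K" using assms(3) by (simp_all add: K_def)
  from conn_last_exit[OF assms(1) this] obtain a b where
    ab: "a \<in> K" "b \<notin> K" "{a, b} \<in> W" "conn B b y" unfolding B_def by metis
  have xa: "conn F x a" using ab(1) by (simp add: K_def)
  have "{a, b} \<notin> F"
  proof
    assume "{a, b} \<in> F"
    from conn_trans[OF xa conn_edge[OF this]] ab(2) show False by (simp add: K_def)
  qed
  with ab have "{a, b} \<in> W - F" "a \<noteq> b" by auto
  moreover have "conn A x a" unfolding A_def K_def by (rule conn_cluster_edges[OF xa])
  moreover have "A \<inter> B = {}" "A \<subseteq> F" "B \<subseteq> W" unfolding A_def B_def by auto
  moreover have "{a, b} \<notin> B" using ab(1) by (simp add: B_def)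
  ultimately show ?thesis using xa ab(4)
    by (intro exI[of _ a] exI[of _ b] exI[of _ A] exI[of _ B]) simp
qed

section \<open>Edge-disjoint pairings of four vertices of a cluster\<close>

definition disj_conn :: "'v set set \<Rightarrow> 'v \<Rightarrow> 'v \<Rightarrow> 'v \<Rightarrow> 'v \<Rightarrow> bool" where
  "disj_conn W x y z w \<longleftrightarrow> (\<exists>A B. conn A x y \<and> conn B z w \<and> A \<inter> B = {} \<and> A \<union> B \<subseteq> W)"

lemma disj_connI: "conn A x y \<Longrightarrow> conn B z w \<Longrightarrow> A \<inter> B = {} \<Longrightarrow> A \<union> B \<subseteq> W \<Longrightarrow> disj_conn W x y z w"
  unfolding disj_conn_def by blast

lemma conn_bridge:
  assumes "conn W z w" "\<not> conn (W - {{x, x'}}) z w"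
  shows "\<exists>A B. A \<inter> B = {} \<and> A \<union> B \<subseteq> W \<and> {x, x'} \<notin> A \<union> B \<and>
    (conn A z x \<and> conn B x' w \<or> conn A z x' \<and> conn B x w)"
proof -
  obtain a b A B where ab: "{a, b} \<in> W - (W - {{x, x'}})" "A \<inter> B = {}" "A \<subseteq> W - {{x, x'}}"
    "B \<subseteq> W" "{a, b} \<notin> B" "conn A z a" "conn B b w"
    using conn_split[OF assms(1) _ assms(2)] by blast
  then have "{a, b} = {x, x'}" by blast
  with ab show ?thesis by (intro exI[of _ A] exI[of _ B]) (auto simp: doubleton_eq_iff)
qed

text \<open>The case x = y is trivial; x is then moved along a path, and the pairing is switched
  whenever the edge just crossed is a bridge of the other path.\<close>

lemma conn_pairing_step:
  assumes D: "disj_conn W x y z w" and e: "{x, x'} \<in> W"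
  shows "disj_conn W x' y z w \<or> disj_conn W x' z y w \<or> disj_conn W x' w y z"
proof -
  obtain A B where AB: "conn A x y" "conn B z w" "A \<inter> B = {}" "A \<union> B \<subseteq> W"
    using D unfolding disj_conn_def by blast
  let ?e = "{x, x'}"
  have x'x: "conn (insert ?e A) x' x" for A
    by (rule conn_sym, rule conn_edge) simp
  have 1: "conn (insert ?e A) x' y"
    using x'x AB(1) by (meson conn_mono conn_trans subset_insertI)
  show ?thesis
  proof (cases "conn (B - {?e}) z w")
    case True
    have "disj_conn W x' y z w"
      by (rule disj_connI[OF 1 True]) (use AB e in auto)
    then show ?thesis by blast
  next
    \<comment> \<open>Here {x, x'} is a bridge between z and w in \<open>B\<close>. The two sides of
      the bridge avoid it and are disjoint from \<open>A\<close>: the side ending at x is glued to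
      the path from x to y, and the side ending at x' serves x' as it is.\<close>
    case False
    from conn_bridge[OF AB(2) False] obtain C D where CD:
      "C \<inter> D = {}" "C \<union> D \<subseteq> B" "conn C z x \<and> conn D x' w \<or> conn C z x' \<and> conn D x w" by blast
    from CD(3) show ?thesis
    proof
      assume c: "conn C z x \<and> conn D x' w"
      then have "conn (A \<union> C) y z"
        using AB(1) by (meson conn_mono conn_sym conn_trans sup_ge1 sup_ge2)
      with c have "disj_conn W x' w y z"
        by (intro disj_connI[of D _ _ "A \<union> C"]) (use AB CD in auto)
      then show ?thesis by blast
    next
      assume c: "conn C z x' \<and> conn D x w"
      then have "conn (A \<union> D) y w"
        using AB(1) by (meson conn_mono conn_sym conn_trans sup_ge1 sup_ge2)
      moreover have "conn C x' z" using c conn_sym by metis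
      ultimately have "disj_conn W x' z y w"
        by (intro disj_connI[of C _ _ "A \<union> D"]) (use AB CD in auto)
      then show ?thesis by blast
    qed
  qed
qed

lemma conn_pairing:
  assumes "conn W x y" "conn W z w"
  shows "disj_conn W x y z w \<or> disj_conn W x z y w \<or> disj_conn W x w y z"
proof -
  have sw: "disj_conn W a b c d \<Longrightarrow> disj_conn W a b d c" for a b c d
    unfolding disj_conn_def by (metis conn_sym)
  have "conn W y x" using assms(1) by (rule conn_sym)
  then show ?thesis
  proof (induction rule: conn_induct)
    case refl
    show ?case using disj_connI[of "{}" y y W z w W] assms(2) by auto
  next
    case (step u v)
    from step.IH show ?case
    proof (elim disjE)
      assume "disj_conn W u y z w"
      from conn_pairing_step[OF this step.hyps(3)] show ?case .
    next
      assume "disj_conn W u z y w"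
      from conn_pairing_step[OF this step.hyps(3)] sw show ?case by blast
    next
      assume "disj_conn W u w y z"
      from conn_pairing_step[OF this step.hyps(3)] sw show ?case by blast
    qed
  qed
qed

section \<open>Two-point functions inside a set and the Simon--Lieb inequality\<close>

definition tau :: "'v set \<Rightarrow> ('v set \<Rightarrow> real) \<Rightarrow> 'v \<Rightarrow> 'v \<Rightarrow> real" where
  "tau V p x y = prb (edges_in V) p (\<lambda>\<omega>. conn \<omega> x y)"

lemma tau_sym: "tau V p x y = tau V p y x"
  unfolding tau_def by (simp only: conn_commute[of _ x y])

lemma tau_nonneg: "probs (edges_in V) p \<Longrightarrow> 0 \<le> tau V p x y"
  unfolding tau_def by (rule prb_nonneg)

lemma prb_mono_set:
  assumes "probs E p" "F \<subseteq> E" "\<And>a b. a \<subseteq> b \<Longrightarrow> A a \<Longrightarrow> A b"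
  shows "prb F p A \<le> prb E p A"
proof -
  have "prb F p A = prb E p (\<lambda>\<omega>. A (\<omega> \<inter> F))"
    unfolding prb_def by (rule expect_restrict[OF probs_finite[OF assms(1)] assms(2), symmetric])
  also have "\<dots> \<le> prb E p A"
    by (rule prb_mono[OF assms(1)]) (rule assms(3)[rotated], auto)
  finally show ?thesis .
qed

lemma tau_mono_set:
  assumes "probs (edges_in V) p" "S \<subseteq> V"
  shows "tau S p x y \<le> tau V p x y"
  unfolding tau_def by (rule prb_mono_set[OF assms(1) edges_in_mono[OF assms(2)]]) (rule conn_mono)

lemma tau_mono_prob:
  assumes "probs (edges_in V) p" "probs (edges_in V) q" "\<And>e. e \<in> edges_in V \<Longrightarrow> p e \<le> q e"
  shows "tau V p x y \<le> tau V q x y"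
  unfolding tau_def prb_def by (rule expect_mono_prob[OF assms]) (auto simp: of_bool_def intro: conn_mono)

lemma prb_edge: 
  assumes "finite E" "e \<in> E"
  shows "prb E p (\<lambda>\<omega>. e \<in> \<omega>) = p e"
proof -
  have "prb E p (\<lambda>\<omega>. e \<in> \<omega>) = expect E p (\<lambda>\<omega>. 1 - of_bool (\<omega> \<inter> {e} = {}))"
    unfolding prb_def by (intro expect_cong) auto
  also have "\<dots> = 1 - prb E p (\<lambda>\<omega>. \<omega> \<inter> {e} = {})"
    using assms by (simp add: expect_diff prb_def)
  also have "\<dots> = p e" using assms by (subst prb_none) auto
  finally show ?thesis .
qed

lemma prb_sum_bound:
  assumes "probs E p" "finite I" "\<And>\<omega>. \<omega> \<subseteq> E \<Longrightarrow> Q \<omega> \<Longrightarrow> \<exists>i\<in>I. A i \<omega>"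
  shows "prb E p Q \<le> (\<Sum>i\<in>I. prb E p (A i))"
proof -
  have "prb E p Q \<le> expect E p (\<lambda>\<omega>. \<Sum>i\<in>I. of_bool (A i \<omega>))"
    unfolding prb_def
  proof (rule expect_mono[OF assms(1)])
    fix \<omega> assume w: "\<omega> \<subseteq> E"
    show "of_bool (Q \<omega>) \<le> (\<Sum>i\<in>I. of_bool (A i \<omega>) :: real)"
    proof (cases "Q \<omega>")
      case True
      with assms(3) w obtain i where i: "i \<in> I" "A i \<omega>" by blast
      have "(of_bool (A i \<omega>) :: real) \<le> (\<Sum>i\<in>I. of_bool (A i \<omega>))"
        by (rule member_le_sum[OF i(1)]) (use assms in auto)
      with i True show ?thesis by simp
    qed (simp add: sum_nonneg)
  qed
  then show ?thesis by (simp add: expect_sum prb_def)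
qed

text \<open>If x and y are connected but not inside \<open>S\<close>, the last exit from the cluster
  of x in \<open>S\<close> gives an edge {a, b} such that "x to a inside \<open>S\<close>, then {a,
  b} open" and "b to y" have disjoint witnesses, and BK applies.\<close>

lemma simon_lieb:
  assumes pr: "probs (edges_in V) p" and fin: "finite V" and S: "S \<subseteq> V" "x \<in> S"
  shows "tau V p x y \<le> tau S p x y +
    (\<Sum>a\<in>S. \<Sum>b\<in>V - S. tau S p x a * p {a, b} * tau V p b y)"
proof -
  let ?E = "edges_in V" and ?F = "edges_in S"
  have finE: "finite ?E" and FE: "?F \<subseteq> ?E" using finite_edges_in[OF fin] edges_in_mono[OF S(1)] by auto
  have finS: "finite S" using fin S finite_subset by auto
  have tS: "tau S p x z = prb ?E p (\<lambda>\<omega>. conn (\<omega> \<inter> ?F) x z)" for z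
    unfolding tau_def prb_def by (rule expect_restrict[OF finE FE, symmetric])
  define A where "A = (\<lambda>(a, b) \<omega>. conn (\<omega> \<inter> ?F) x a \<and> {a, b} \<in> \<omega>)"
  define B where "B = (\<lambda>(a::'a, b) \<omega>. conn \<omega> b y)"
  define Q where "Q = (\<lambda>ab \<omega>. \<exists>c d. A ab c \<and> B ab d \<and> c \<inter> d = {} \<and> c \<union> d \<subseteq> \<omega>)"
  \<comment> \<open>The edge {a, b} leaves \<open>S\<close>, so its state is independent of the
    configuration on the edges inside \<open>S\<close>, and the probability is an exact
    product.\<close>
  have PA: "prb ?E p (A (a, b)) = tau S p x a * p {a, b}" if "a \<in> S" "b \<in> V - S" for a b
  proof -
    have e: "{a, b} \<in> ?E - ?F"
    proof -
      have "a \<noteq> b" using that by auto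
      then show ?thesis using that S by (auto simp: edges_in_iff)
    qed
    have "prb ?E p (A (a, b)) = expect ?E p (\<lambda>\<omega>. of_bool (conn (\<omega> \<inter> ?F) x a) * of_bool ({a, b} \<in> \<omega> - ?F))"
      unfolding A_def prb_def using e by (intro expect_cong) auto
    also have "\<dots> = tau S p x a * prb (?E - ?F) p (\<lambda>\<omega>. {a, b} \<in> \<omega>)"
      by (subst expect_indep[OF finE FE]) (simp add: prb_def tau_def)
    also have "prb (?E - ?F) p (\<lambda>\<omega>. {a, b} \<in> \<omega>) = p {a, b}"
      using e finE by (intro prb_edge) auto
    finally show ?thesis .
  qed
  have "prb ?E p (\<lambda>\<omega>. conn \<omega> x y \<and> \<not> conn (\<omega> \<inter> ?F) x y) \<le> (\<Sum>ab\<in>S \<times> (V - S). prb ?E p (Q ab))"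
  proof (rule prb_sum_bound[OF pr])
    show "finite (S \<times> (V - S))" using finS fin by auto
    fix \<omega> assume w: "\<omega> \<subseteq> ?E" and "conn \<omega> x y \<and> \<not> conn (\<omega> \<inter> ?F) x y"
    with conn_split[of \<omega> x y "\<omega> \<inter> ?F"] obtain a b C D where ab: "a \<noteq> b" "{a, b} \<in> \<omega> - \<omega> \<inter> ?F"
      "conn (\<omega> \<inter> ?F) x a" "C \<inter> D = {}" "C \<subseteq> \<omega> \<inter> ?F" "D \<subseteq> \<omega>" "{a, b} \<notin> D" "conn C x a" "conn D b y"
      by auto
    have aS: "a \<in> S" using conn_edges_in[OF ab(3)] S by auto
    have bV: "b \<in> V - S" using ab(1,2) w aS edges_in_iff[OF ab(1)] by auto
    have "A (a, b) (insert {a, b} C)"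
    proof -
      have "C \<subseteq> insert {a, b} C \<inter> ?F" using ab by auto
      then show ?thesis using conn_mono[OF _ ab(8)] by (auto simp: A_def)
    qed
    moreover have "B (a, b) D" using ab by (simp add: B_def)
    moreover have "insert {a, b} C \<inter> D = {}" "insert {a, b} C \<union> D \<subseteq> \<omega>" using ab by auto
    ultimately have "Q (a, b) \<omega>" unfolding Q_def by blast
    with aS bV show "\<exists>ab\<in>S \<times> (V - S). Q ab \<omega>" by blast
  qed
  also have "\<dots> \<le> (\<Sum>ab\<in>S \<times> (V - S). prb ?E p (A ab) * prb ?E p (B ab))"
  proof (intro sum_mono bk[OF pr])
    fix ab and a b :: "'a set set" assume "a \<subseteq> b"
    then show "A ab a \<Longrightarrow> A ab b" "B ab a \<Longrightarrow> B ab b"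
      unfolding A_def B_def
      by (auto split: prod.splits intro: conn_mono[of "a \<inter> ?F" "b \<inter> ?F"] conn_mono[of a b])
  qed (simp add: Q_def)
  also have "\<dots> = (\<Sum>a\<in>S. \<Sum>b\<in>V - S. tau S p x a * p {a, b} * tau V p b y)"
    unfolding sum.cartesian_product by (rule sum.cong) (auto simp: PA B_def tau_def)
  finally have 1: "prb ?E p (\<lambda>\<omega>. conn \<omega> x y \<and> \<not> conn (\<omega> \<inter> ?F) x y) \<le> \<dots>" .
  have "tau V p x y \<le> expect ?E p (\<lambda>\<omega>. of_bool (conn (\<omega> \<inter> ?F) x y) + of_bool (conn \<omega> x y \<and> \<not> conn (\<omega> \<inter> ?F) x y))"
    unfolding tau_def prb_def by (intro expect_mono[OF pr]) auto
  also have "\<dots> = tau S p x y + prb ?E p (\<lambda>\<omega>. conn \<omega> x y \<and> \<not> conn (\<omega> \<inter> ?F) x y)"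
    unfolding expect_add tS by (simp add: prb_def)
  finally show ?thesis using 1 by linarith
qed

lemma two_disjoint_conn:
  assumes "probs (edges_in V) p"
  shows "prb (edges_in V) p (\<lambda>\<omega>. disj_conn \<omega> x y z w) \<le> tau V p x y * tau V p z w"
  unfolding tau_def
  by (rule bk[OF assms]) (auto simp: disj_conn_def intro: conn_mono)

text \<open>A union bound over the three ways to pair up x, y, z, w by edge-disjoint paths, with BK
  for each. The right side is quadratic in two-point functions, which is what makes the second
  moment comparable to the squared mean.\<close>

lemma four_point:
  assumes pr: "probs (edges_in V) p"
  shows "prb (edges_in V) p (\<lambda>\<omega>. conn \<omega> x y \<and> conn \<omega> z w)
    \<le> tau V p x y * tau V p z w + tau V p x z * tau V p y w + tau V p x w * tau V p y z"
proof -
  let ?E = "edges_in V"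
  have "prb ?E p (\<lambda>\<omega>. conn \<omega> x y \<and> conn \<omega> z w)
    \<le> expect ?E p (\<lambda>\<omega>. of_bool (disj_conn \<omega> x y z w) + of_bool (disj_conn \<omega> x z y w) + of_bool (disj_conn \<omega> x w y z))"
    unfolding prb_def
  proof (intro expect_mono[OF pr])
    fix \<omega>
    show "of_bool (conn \<omega> x y \<and> conn \<omega> z w) \<le> (of_bool (disj_conn \<omega> x y z w)
      + of_bool (disj_conn \<omega> x z y w) + of_bool (disj_conn \<omega> x w y z) :: real)"
      using conn_pairing[of \<omega> x y z w] by (auto simp: of_bool_def)
  qed
  also have "\<dots> \<le> tau V p x y * tau V p z w + tau V p x z * tau V p y w + tau V p x w * tau V p y z"
    unfolding expect_add
    by (intro add_mono two_disjoint_conn[OF pr, unfolded prb_def])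
  finally show ?thesis .
qed

text \<open>Equals the sum of the squared cluster sizes; the diagonal pairs are included.\<close>

definition npairs :: "'v set \<Rightarrow> 'v set set \<Rightarrow> real" where
  "npairs V \<omega> = (\<Sum>x\<in>V. \<Sum>y\<in>V. of_bool (conn \<omega> x y))"

lemma npairs_nonneg: "0 \<le> npairs V \<omega>"
  unfolding npairs_def by (intro sum_nonneg) auto

lemma expect_npairs: "expect (edges_in V) p (npairs V) = (\<Sum>x\<in>V. \<Sum>y\<in>V. tau V p x y)"
  unfolding npairs_def tau_def prb_def by (simp add: expect_sum)

text \<open>After interchanging sums, each of the three pairings contributes exactly the square of
  the mean; hence the constant 3.\<close>

lemma npairs_second_moment:
  assumes pr: "probs (edges_in V) p"
  shows "expect (edges_in V) p (\<lambda>\<omega>. (npairs V \<omega>)\<^sup>2) \<le> 3 * (expect (edges_in V) p (npairs V))\<^sup>2"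
proof -
  let ?t = "tau V p"
  have "(npairs V \<omega>)\<^sup>2 = (\<Sum>x\<in>V. \<Sum>y\<in>V. \<Sum>z\<in>V. \<Sum>w\<in>V. of_bool (conn \<omega> x y \<and> conn \<omega> z w))" for \<omega>
    unfolding npairs_def power2_eq_square of_bool_conj sum_distrib_right
    unfolding sum_distrib_left ..
  then have "expect (edges_in V) p (\<lambda>\<omega>. (npairs V \<omega>)\<^sup>2) =
     (\<Sum>x\<in>V. \<Sum>y\<in>V. \<Sum>z\<in>V. \<Sum>w\<in>V. prb (edges_in V) p (\<lambda>\<omega>. conn \<omega> x y \<and> conn \<omega> z w))"
    by (simp add: expect_sum prb_def)
  also have "\<dots> \<le> (\<Sum>x\<in>V. \<Sum>y\<in>V. \<Sum>z\<in>V. \<Sum>w\<in>V. ?t x y * ?t z w + ?t x z * ?t y w + ?t x w * ?t y z)"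
    by (intro sum_mono four_point[OF pr])
  also have "\<dots> = (\<Sum>x\<in>V. \<Sum>y\<in>V. \<Sum>z\<in>V. \<Sum>w\<in>V. ?t x y * ?t z w)
    + (\<Sum>x\<in>V. \<Sum>y\<in>V. \<Sum>z\<in>V. \<Sum>w\<in>V. ?t x z * ?t y w)
    + (\<Sum>x\<in>V. \<Sum>y\<in>V. \<Sum>z\<in>V. \<Sum>w\<in>V. ?t x w * ?t y z)"
    by (simp add: sum.distrib)
  also have "(\<Sum>x\<in>V. \<Sum>y\<in>V. \<Sum>z\<in>V. \<Sum>w\<in>V. ?t x z * ?t y w) = (\<Sum>x\<in>V. \<Sum>z\<in>V. \<Sum>y\<in>V. \<Sum>w\<in>V. ?t x z * ?t y w)"
    by (rule sum.cong[OF refl], rule sum.swap)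
  also have "(\<Sum>x\<in>V. \<Sum>y\<in>V. \<Sum>z\<in>V. \<Sum>w\<in>V. ?t x w * ?t y z) = (\<Sum>x\<in>V. \<Sum>w\<in>V. \<Sum>y\<in>V. \<Sum>z\<in>V. ?t x w * ?t y z)"
  proof (rule sum.cong[OF refl])
    fix x
    have "(\<Sum>y\<in>V. \<Sum>z\<in>V. \<Sum>w\<in>V. ?t x w * ?t y z) = (\<Sum>y\<in>V. \<Sum>w\<in>V. \<Sum>z\<in>V. ?t x w * ?t y z)"
      by (rule sum.cong[OF refl], rule sum.swap)
    also have "\<dots> = (\<Sum>w\<in>V. \<Sum>y\<in>V. \<Sum>z\<in>V. ?t x w * ?t y z)" by (rule sum.swap)
    finally show "(\<Sum>y\<in>V. \<Sum>z\<in>V. \<Sum>w\<in>V. ?t x w * ?t y z) = (\<Sum>w\<in>V. \<Sum>y\<in>V. \<Sum>z\<in>V. ?t x w * ?t y z)" .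
  qed
  also have "(\<Sum>x\<in>V. \<Sum>y\<in>V. \<Sum>z\<in>V. \<Sum>w\<in>V. ?t x y * ?t z w) + (\<Sum>x\<in>V. \<Sum>y\<in>V. \<Sum>z\<in>V. \<Sum>w\<in>V. ?t x y * ?t z w)
    + (\<Sum>x\<in>V. \<Sum>y\<in>V. \<Sum>z\<in>V. \<Sum>w\<in>V. ?t x y * ?t z w) = 3 * (\<Sum>x\<in>V. \<Sum>y\<in>V. ?t x y)\<^sup>2"
  proof -
    have "(\<Sum>x\<in>V. \<Sum>y\<in>V. \<Sum>z\<in>V. \<Sum>w\<in>V. ?t x y * ?t z w) = (\<Sum>x\<in>V. \<Sum>y\<in>V. ?t x y)\<^sup>2"
      unfolding power2_eq_square sum_distrib_right
      unfolding sum_distrib_left ..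
    then show ?thesis by simp
  qed
  finally show ?thesis by (simp add: expect_npairs)
qed

lemma npairs_lower_tail:
  assumes pr: "probs (edges_in V) p"
  shows "1 / 16 \<le> prb (edges_in V) p (\<lambda>\<omega>. expect (edges_in V) p (npairs V) / 2 \<le> npairs V \<omega>)"
proof -
  let ?E = "edges_in V" and ?X = "npairs V"
  define m where "m = expect ?E p ?X"
  have m0: "0 \<le> m" unfolding m_def by (rule expect_nonneg[OF pr]) (rule npairs_nonneg)
  show ?thesis
  proof (cases "m = 0")
    case True
    then show ?thesis using probs_finite[OF pr] by (simp add: m_def[symmetric] prb_def npairs_nonneg)
  next
    case False
    with m0 have m: "m > 0" by simp
    \<comment> \<open>Paley--Zygmund, with AM-GM in place of Cauchy--Schwarz\<close>
    have "m \<le> expect ?E p (\<lambda>\<omega>. m / 2 + (1 / (16 * m)) * (?X \<omega>)\<^sup>2 + (4 * m) * of_bool (m / 2 \<le> ?X \<omega>))"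
      unfolding m_def
    proof (rule expect_mono[OF pr], fold m_def)
      fix \<omega>
      show "?X \<omega> \<le> m / 2 + (1 / (16 * m)) * (?X \<omega>)\<^sup>2 + (4 * m) * of_bool (m / 2 \<le> ?X \<omega>)"
      proof (cases "m / 2 \<le> ?X \<omega>")
        case True
        have "0 \<le> (?X \<omega> - 8 * m)\<^sup>2" by simp
        then have "16 * m * ?X \<omega> \<le> (?X \<omega>)\<^sup>2 + 64 * m\<^sup>2"
          by (simp add: power2_eq_square algebra_simps)
        then have "?X \<omega> \<le> ((?X \<omega>)\<^sup>2 + 64 * m\<^sup>2) / (16 * m)"
          using m by (simp add: field_simps)
        also have "\<dots> = (1 / (16 * m)) * (?X \<omega>)\<^sup>2 + 4 * m"
          using m by (simp add: field_simps power2_eq_square)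
        finally show ?thesis using True m by simp
      next
        case False
        moreover have "0 \<le> (1 / (16 * m)) * (?X \<omega>)\<^sup>2" using m by simp
        ultimately show ?thesis by simp
      qed
    qed
    also have "\<dots> = m / 2 + (1 / (16 * m)) * expect ?E p (\<lambda>\<omega>. (?X \<omega>)\<^sup>2) + (4 * m) * prb ?E p (\<lambda>\<omega>. m / 2 \<le> ?X \<omega>)"
      using probs_finite[OF pr] by (simp only: expect_add expect_cmult expect_const prb_def)
    \<comment> \<open>Relaxing 3 m^2 to 4 m^2 makes the middle term m / 4, so a quarter of m is left
      for 4 m times the probability; this yields 1 / 16.\<close>
    also have "\<dots> \<le> m / 2 + (1 / (16 * m)) * (4 * m\<^sup>2) + (4 * m) * prb ?E p (\<lambda>\<omega>. m / 2 \<le> ?X \<omega>)"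
      using order_trans[OF npairs_second_moment[OF pr], folded m_def, of "4 * m\<^sup>2"] m
      by (intro add_mono mult_left_mono) auto
    also have "\<dots> = m * (3 / 4 + 4 * prb ?E p (\<lambda>\<omega>. m / 2 \<le> ?X \<omega>))"
      using m by (simp add: field_simps power2_eq_square)
    finally have "1 \<le> 3 / 4 + 4 * prb ?E p (\<lambda>\<omega>. m / 2 \<le> ?X \<omega>)" using m by simp
    then show ?thesis by (simp add: m_def)
  qed
qed

section \<open>Two independent blocks, varying one edge, and sprinkling\<close>

lemma prod_cross:
  assumes "finite A" "finite B" "A \<inter> B = {}"
  shows "(\<Prod>e\<in>(\<lambda>(a, b). {a, b}) ` (A \<times> B). f e) = (\<Prod>a\<in>A. \<Prod>b\<in>B. f {a, b} :: real)"
proof -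
  have "inj_on (\<lambda>(a, b). {a, b}) (A \<times> B)"
    using assms(3) by (auto simp: inj_on_def doubleton_eq_iff)
  then show ?thesis
    by (subst prod.reindex) (auto simp: prod.cartesian_product o_def case_prod_unfold)
qed

text \<open>Both follow from exp (- v) \<le> 1 / (1 + v). The lower bound serves connections between
  two blocks, the second-order bound serves sprinkling in small steps.\<close>

lemma one_minus_exp_ge:
  fixes v :: real
  assumes "0 \<le> v"
  shows "min 1 v / 2 \<le> 1 - exp (- v)" "exp (- v) \<le> 1 - v + v\<^sup>2"
proof -
  have "exp (- v) \<le> 1 / (1 + v)"
    using exp_ge_add_one_self[of v] assms by (simp add: exp_minus field_simps)
  moreover have "1 / (1 + v) \<le> 1 - min 1 v / 2"
    using assms by (auto simp: field_simps min_def mult_left_le)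
  moreover have "1 / (1 + v) \<le> 1 - v + v\<^sup>2"
  proof -
    have "(1 - v + v\<^sup>2) * (1 + v) = 1 + v^3" by (simp add: algebra_simps power2_eq_square power3_eq_cube)
    then show ?thesis using assms by (simp add: field_simps)
  qed
  ultimately show "min 1 v / 2 \<le> 1 - exp (- v)" "exp (- v) \<le> 1 - v + v\<^sup>2" by linarith+
qed

definition csize :: "'v set \<Rightarrow> 'v set set \<Rightarrow> 'v \<Rightarrow> real" where
  "csize V \<omega> x = (\<Sum>a\<in>V. of_bool (conn \<omega> x a))"

lemma csize_nonneg: "0 \<le> csize V \<omega> x"
  unfolding csize_def by (intro sum_nonneg) auto

lemma csize_conn: "conn \<omega> x a \<Longrightarrow> csize V \<omega> x = csize V \<omega> a"
  unfolding csize_def by (intro sum.cong refl arg_cong[where f=of_bool]) (meson conn_sym conn_trans)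

text \<open>The cluster of x alone already supplies the square of its size in ordered pairs.\<close>

lemma csize_square_le:
  shows "(csize V \<omega> x)\<^sup>2 \<le> npairs V \<omega>"
proof -
  have "(csize V \<omega> x)\<^sup>2 = (\<Sum>a\<in>V. of_bool (conn \<omega> x a) * csize V \<omega> x)"
    by (simp add: csize_def power2_eq_square sum_distrib_right)
  also have "\<dots> \<le> (\<Sum>a\<in>V. csize V \<omega> a)"
    by (intro sum_mono) (auto simp: of_bool_def csize_nonneg csize_conn[of \<omega> x])
  finally show ?thesis by (simp add: npairs_def csize_def)
qed

lemma csize_card:
  assumes "finite V"
  shows "csize V \<omega> x = real (card {a \<in> V. conn \<omega> x a})"
  using assms by (simp add: csize_def sum.If_cases of_bool_def Int_def conj_commute)

text \<open>Here \<open>w x\<close> stands for the size of the cluster of x in its block. The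
  constraint (w x)^2 \<le> sum w caps the product w x * w' y by s = sqrt (X * X'), and up to that
  cap 1 - exp (- t u) is at least u * min (1 / s) t / 2. The linear bound sums to min s (t X X') /
  2, no matter how the total is spread over clusters.\<close>

lemma sum_one_minus_exp_ge:
  fixes w w' :: "'v \<Rightarrow> real"
  assumes w: "\<And>x. x \<in> B \<Longrightarrow> 0 \<le> w x \<and> (w x)\<^sup>2 \<le> sum w B"
    and w': "\<And>y. y \<in> B' \<Longrightarrow> 0 \<le> w' y \<and> (w' y)\<^sup>2 \<le> sum w' B'"
    and T: "0 \<le> T" "T \<le> sum w B" "T \<le> sum w' B'" and t: "0 \<le> t"
  shows "min T (t * T\<^sup>2) / 2 \<le> (\<Sum>x\<in>B. \<Sum>y\<in>B'. 1 - exp (- (t * w x * w' y)))"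
proof (cases "T = 0")
  case True
  have "0 \<le> (\<Sum>x\<in>B. \<Sum>y\<in>B'. 1 - exp (- (t * w x * w' y)))"
    using w w' t by (intro sum_nonneg) auto
  with True show ?thesis by simp
next
  case False
  define X where "X = sum w B"
  define X' where "X' = sum w' B'"
  define s where "s = sqrt (X * X')"
  have X: "T \<le> X" "T \<le> X'" "0 < T" using T False by (auto simp: X_def X'_def)
  then have XX: "T\<^sup>2 \<le> X * X'" by (simp add: power2_eq_square mult_mono)
  then have "0 < X * X'" using X(3) zero_less_power[of T 2] by linarith
  then have s: "0 < s" "s * s = X * X'" by (auto simp: s_def)
  have Ts: "T \<le> s" unfolding s_def using XX by (rule real_le_rsqrt)
  have *: "w x * w' y * (min (1 / s) t / 2) \<le> 1 - exp (- (t * w x * w' y))" if "x \<in> B" "y \<in> B'" for x y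
  proof -
    define u where "u = w x * w' y"
    have u0: "0 \<le> u" using w w' that by (simp add: u_def)
    have "u\<^sup>2 \<le> X * X'"
      unfolding u_def power_mult_distrib X_def X'_def using w[OF that(1)] w'[OF that(2)]
      by (intro mult_mono) (auto intro: order_trans[OF zero_le_power2])
    then have us: "u \<le> s" unfolding s_def by (rule real_le_rsqrt)
    have "u * min (1 / s) t \<le> min 1 (t * u)"
    proof (rule min.boundedI)
      have "u * min (1 / s) t \<le> u * (1 / s)" using u0 by (intro mult_left_mono) auto
      also have "\<dots> \<le> 1" using us s by simp
      finally show "u * min (1 / s) t \<le> 1" .
      have "u * min (1 / s) t \<le> u * t" using u0 by (intro mult_left_mono) auto
      then show "u * min (1 / s) t \<le> t * u" by (simp add: mult.commute)
    qed
    also have "\<dots> / 2 \<le> 1 - exp (- (t * u))"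
      using t u0 by (intro one_minus_exp_ge) simp
    finally show ?thesis by (simp add: u_def mult.assoc)
  qed
  have "min T (t * T\<^sup>2) \<le> min s (t * (X * X'))"
    using Ts XX t by (intro min.mono mult_left_mono) auto
  also have "\<dots> = X * X' * min (1 / s) t"
  proof -
    have "X * X' * (1 / s) = s" using s by (simp flip: s(2))
    with \<open>0 < X * X'\<close> show ?thesis by (simp add: min_mult_distrib_left mult.commute)
  qed
  finally have "min T (t * T\<^sup>2) / 2 \<le> X * X' * (min (1 / s) t / 2)" by simp
  also have "\<dots> = (\<Sum>x\<in>B. \<Sum>y\<in>B'. w x * w' y * (min (1 / s) t / 2))"
    unfolding X_def X'_def sum_product
    unfolding sum_distrib_right ..
  also have "\<dots> \<le> (\<Sum>x\<in>B. \<Sum>y\<in>B'. 1 - exp (- (t * w x * w' y)))"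
    by (intro sum_mono *)
  finally show ?thesis .
qed

text \<open>Given the configurations inside the two blocks, x and y fail to connect only if every
  edge between their clusters is closed, which has probability at most exp (- t |K| |K'|). The
  events that each block has at least \<open>T\<close> connected pairs depend on disjoint edge sets,
  so their probabilities multiply.\<close>

lemma sum_tau_two_blocks:
  assumes pr: "probs (edges_in (B \<union> B')) p" and fin: "finite B" "finite B'" and disj: "B \<inter> B' = {}"
    and t: "0 \<le> t" "\<And>a b. a \<in> B \<Longrightarrow> b \<in> B' \<Longrightarrow> 1 - p {a, b} \<le> exp (- t)" and T: "0 \<le> T"
  shows "min T (t * T\<^sup>2) / 2 * (prb (edges_in B) p (\<lambda>\<omega>. T \<le> npairs B \<omega>)
      * prb (edges_in B') p (\<lambda>\<omega>. T \<le> npairs B' \<omega>))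
    \<le> (\<Sum>x\<in>B. \<Sum>y\<in>B'. tau (B \<union> B') p x y)"
proof -
  let ?E = "edges_in B" and ?E' = "edges_in B'"
  let ?cross = "\<lambda>A A'. (\<lambda>(a, b). {a, b}) ` (A \<times> A')"
  let ?C = "?cross B B'"
  have ne: "a \<noteq> b" if "a \<in> B" "b \<in> B'" for a b using that disj by auto
  have finE: "finite ?E" "finite ?E'" "finite ?C" using fin finite_edges_in by auto
  have E: "edges_in (B \<union> B') = ?E \<union> (?E' \<union> ?C)"
  proof (intro equalityI subsetI)
    fix e assume "e \<in> edges_in (B \<union> B')"
    then obtain x y where "x \<in> B \<union> B'" "y \<in> B \<union> B'" "x \<noteq> y" "e = {x, y}"
      by (auto simp: edges_in_def)
    then show "e \<in> ?E \<union> (?E' \<union> ?C)"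
      by (cases "x \<in> B"; cases "y \<in> B") (auto simp: edges_in_iff insert_commute image_iff)
  next
    fix e assume "e \<in> ?E \<union> (?E' \<union> ?C)"
    then show "e \<in> edges_in (B \<union> B')"
      using edges_in_mono[of B "B \<union> B'"] edges_in_mono[of B' "B \<union> B'"] ne by (auto simp: edges_in_iff)
  qed
  have d1: "?E \<inter> (?E' \<union> ?C) = {}" "?E' \<inter> ?C = {}"
    using disj ne by (auto simp: edges_in_def doubleton_eq_iff)
  have prE: "probs ?E p" "probs ?E' p" "probs ?C p"
    by (rule probs_subset[OF pr], use E in blast)+
  have inner: "1 - exp (- (t * csize B \<omega> x * csize B' \<omega>' y))
      \<le> expect ?C p (\<lambda>\<eta>. of_bool (conn (\<omega> \<union> (\<omega>' \<union> \<eta>)) x y))"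
    if "x \<in> B" "y \<in> B'" for \<omega> \<omega>' x y
  proof -
    let ?K = "{a \<in> B. conn \<omega> x a}" and ?K' = "{b \<in> B'. conn \<omega>' y b}"
    have KC: "?cross ?K ?K' \<subseteq> ?C" by auto
    have "expect ?C p (\<lambda>\<eta>. 1 - of_bool (\<eta> \<inter> ?cross ?K ?K' = {})) \<le> expect ?C p (\<lambda>\<eta>. of_bool (conn (\<omega> \<union> (\<omega>' \<union> \<eta>)) x y))"
    proof (rule expect_mono[OF prE(3)])
      fix \<eta>
      show "1 - of_bool (\<eta> \<inter> ?cross ?K ?K' = {}) \<le> (of_bool (conn (\<omega> \<union> (\<omega>' \<union> \<eta>)) x y) :: real)"
      proof (cases "\<eta> \<inter> ?cross ?K ?K' = {}")
        case False
        then obtain a b where ab: "conn \<omega> x a" "conn \<omega>' y b" "{a, b} \<in> \<eta>" by auto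
        let ?W = "\<omega> \<union> (\<omega>' \<union> \<eta>)"
        have "conn ?W x a" by (rule conn_mono[OF _ ab(1)]) auto
        moreover have "conn ?W a b" by (rule conn_edge) (use ab in auto)
        moreover have "conn ?W b y" by (rule conn_sym, rule conn_mono[OF _ ab(2)]) auto
        ultimately have "conn ?W x y" by (meson conn_trans)
        then show ?thesis by simp
      qed simp
    qed
    moreover have "expect ?C p (\<lambda>\<eta>. 1 - of_bool (\<eta> \<inter> ?cross ?K ?K' = {})) = 1 - (\<Prod>a\<in>?K. \<Prod>b\<in>?K'. 1 - p {a, b})"
    proof -
      have "expect ?C p (\<lambda>\<eta>. 1 - of_bool (\<eta> \<inter> ?cross ?K ?K' = {})) = 1 - prb ?C p (\<lambda>\<eta>. \<eta> \<inter> ?cross ?K ?K' = {})"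
        using finE by (simp add: expect_diff prb_def)
      also have "prb ?C p (\<lambda>\<eta>. \<eta> \<inter> ?cross ?K ?K' = {}) = (\<Prod>e\<in>?cross ?K ?K'. 1 - p e)"
        by (rule prb_none[OF finE(3) KC])
      also have "\<dots> = (\<Prod>a\<in>?K. \<Prod>b\<in>?K'. 1 - p {a, b})"
        using fin disj by (intro prod_cross) auto
      finally show ?thesis .
    qed
    moreover have "(\<Prod>a\<in>?K. \<Prod>b\<in>?K'. 1 - p {a, b}) \<le> (\<Prod>a\<in>?K. \<Prod>b\<in>?K'. exp (- t))"
    proof -
      have "0 \<le> 1 - p {a, b} \<and> 1 - p {a, b} \<le> exp (- t)" if "a \<in> ?K" "b \<in> ?K'" for a b
      proof -
        have "{a, b} \<in> ?C" using that by auto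
        then show ?thesis using prE(3) t(2) that by (auto simp: probs_def)
      qed
      then show ?thesis by (intro prod_mono conjI prod_nonneg) simp_all
    qed
    moreover have "(\<Prod>a\<in>?K. \<Prod>b\<in>?K'. exp (- t)) = exp (- (t * csize B \<omega> x * csize B' \<omega>' y))"
      by (simp add: csize_card[OF fin(1)] csize_card[OF fin(2)] mult_ac flip: exp_of_nat_mult)
    ultimately show ?thesis by linarith
  qed
  have "(\<Sum>x\<in>B. \<Sum>y\<in>B'. tau (B \<union> B') p x y) = (\<Sum>x\<in>B. \<Sum>y\<in>B'. expect ?E p (\<lambda>\<omega>. expect ?E' p (\<lambda>\<omega>'.
      expect ?C p (\<lambda>\<eta>. of_bool (conn (\<omega> \<union> (\<omega>' \<union> \<eta>)) x y)))))"
    unfolding tau_def prb_def E using finE d1 by (simp add: expect_union)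
  also have "\<dots> \<ge> (\<Sum>x\<in>B. \<Sum>y\<in>B'. expect ?E p (\<lambda>\<omega>. expect ?E' p (\<lambda>\<omega>'. 1 - exp (- (t * csize B \<omega> x * csize B' \<omega>' y)))))"
    by (intro sum_mono expect_mono[OF prE(1)] expect_mono[OF prE(2)] inner)
  also have "(\<Sum>x\<in>B. \<Sum>y\<in>B'. expect ?E p (\<lambda>\<omega>. expect ?E' p (\<lambda>\<omega>'. 1 - exp (- (t * csize B \<omega> x * csize B' \<omega>' y)))))
    = expect ?E p (\<lambda>\<omega>. expect ?E' p (\<lambda>\<omega>'. \<Sum>x\<in>B. \<Sum>y\<in>B'. 1 - exp (- (t * csize B \<omega> x * csize B' \<omega>' y))))"
    by (simp add: expect_sum)
  also have "\<dots> \<ge> expect ?E p (\<lambda>\<omega>. expect ?E' p (\<lambda>\<omega>'. min T (t * T\<^sup>2) / 2 * (of_bool (T \<le> npairs B \<omega>) * of_bool (T \<le> npairs B' \<omega>'))))"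
  proof (intro expect_mono[OF prE(1)] expect_mono[OF prE(2)])
    fix \<omega> \<omega>'
    have np: "npairs A \<omega> = sum (csize A \<omega>) A" for A and \<omega> :: "'a set set" by (simp add: npairs_def csize_def)
    show "min T (t * T\<^sup>2) / 2 * (of_bool (T \<le> npairs B \<omega>) * of_bool (T \<le> npairs B' \<omega>'))
      \<le> (\<Sum>x\<in>B. \<Sum>y\<in>B'. 1 - exp (- (t * csize B \<omega> x * csize B' \<omega>' y)))"
    proof (cases "T \<le> npairs B \<omega> \<and> T \<le> npairs B' \<omega>'")
      case True
      then have "min T (t * T\<^sup>2) / 2 \<le> (\<Sum>x\<in>B. \<Sum>y\<in>B'. 1 - exp (- (t * csize B \<omega> x * csize B' \<omega>' y)))"
        using T t by (intro sum_one_minus_exp_ge) (auto simp: csize_nonneg csize_square_le simp flip: np)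
      with True show ?thesis by simp
    next
      case False
      have "0 \<le> (\<Sum>x\<in>B. \<Sum>y\<in>B'. 1 - exp (- (t * csize B \<omega> x * csize B' \<omega>' y)))"
        using t by (intro sum_nonneg) (auto simp: csize_nonneg)
      with False show ?thesis by auto
    qed
  qed
  also have "expect ?E p (\<lambda>\<omega>. expect ?E' p (\<lambda>\<omega>'. min T (t * T\<^sup>2) / 2 * (of_bool (T \<le> npairs B \<omega>) * of_bool (T \<le> npairs B' \<omega>'))))
    = min T (t * T\<^sup>2) / 2 * (prb ?E p (\<lambda>\<omega>. T \<le> npairs B \<omega>) * prb ?E' p (\<lambda>\<omega>. T \<le> npairs B' \<omega>))"
    by (simp only: expect_cmult expect_multc prb_def)
  finally show ?thesis .
qed

text \<open>A connection created by opening {c, d} crosses that edge in one of two directions, and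
  its two remaining pieces are disjoint witnesses in the original configuration.\<close>

lemma prb_pivotal:
  assumes pr: "probs E p" and e: "c \<noteq> d"
  shows "prb E p (\<lambda>\<omega>. conn (insert {c, d} \<omega>) x y \<and> \<not> conn \<omega> x y)
    \<le> prb E p (\<lambda>\<omega>. conn \<omega> x c) * prb E p (\<lambda>\<omega>. conn \<omega> d y)
      + prb E p (\<lambda>\<omega>. conn \<omega> x d) * prb E p (\<lambda>\<omega>. conn \<omega> c y)"
proof -
  have "prb E p (\<lambda>\<omega>. conn (insert {c, d} \<omega>) x y \<and> \<not> conn \<omega> x y)
    \<le> expect E p (\<lambda>\<omega>. of_bool (disj_conn \<omega> x c d y) + of_bool (disj_conn \<omega> x d c y))"
    unfolding prb_def
  proof (intro expect_mono[OF pr])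
    fix \<omega>
    have "disj_conn \<omega> x c d y \<or> disj_conn \<omega> x d c y"
      if "conn (insert {c, d} \<omega>) x y \<and> \<not> conn \<omega> x y"
    proof -
      from conn_split[of "insert {c, d} \<omega>" x y \<omega>] that obtain a b A B where
        ab: "{a, b} \<in> insert {c, d} \<omega> - \<omega>" "A \<inter> B = {}" "A \<subseteq> \<omega>" "B \<subseteq> insert {c, d} \<omega>"
          "{a, b} \<notin> B" "conn A x a" "conn B b y" by blast
      from ab(1) have eq: "{a, b} = {c, d}" by blast
      have "B \<subseteq> \<omega>" using ab(4,5) unfolding eq by blast
      moreover have "a = c \<and> b = d \<or> a = d \<and> b = c" using eq by (simp only: doubleton_eq_iff)
      ultimately
      show ?thesis using ab by (auto intro: disj_connI)
    qed
    then show "of_bool (conn (insert {c, d} \<omega>) x y \<and> \<not> conn \<omega> x y)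
      \<le> (of_bool (disj_conn \<omega> x c d y) + of_bool (disj_conn \<omega> x d c y) :: real)"
      by (auto simp: of_bool_def)
  qed
  also have "\<dots> = prb E p (\<lambda>\<omega>. disj_conn \<omega> x c d y) + prb E p (\<lambda>\<omega>. disj_conn \<omega> x d c y)"
    by (simp add: expect_add prb_def)
  also have "\<dots> \<le> prb E p (\<lambda>\<omega>. conn \<omega> x c) * prb E p (\<lambda>\<omega>. conn \<omega> d y)
      + prb E p (\<lambda>\<omega>. conn \<omega> x d) * prb E p (\<lambda>\<omega>. conn \<omega> c y)"
    by (intro add_mono bk[OF pr]) (auto simp: disj_conn_def intro: conn_mono)
  finally show ?thesis .
qed

text \<open>An integrated Russo formula: the weights are raised one edge at a time and each change
  costs its size times the pivotal probability. The two directions through an edge are the two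
  orderings (a, b) and (b, a) in the sum.\<close>

lemma tau_increase:
  assumes pr: "probs (edges_in V) p" "probs (edges_in V) q"
    and pq: "\<And>e. e \<in> edges_in V \<Longrightarrow> p e \<le> q e" and fin: "finite V"
  shows "tau V q x y \<le> tau V p x y +
    (\<Sum>(a, b) | a \<in> V \<and> b \<in> V \<and> a \<noteq> b. (q {a, b} - p {a, b}) * (tau V q x a * tau V q b y))"
proof -
  let ?E = "edges_in V"
  have finE: "finite ?E" by (rule finite_edges_in[OF fin])
  \<comment> \<open>Interpolation: the edges in \<open>F\<close> have already been raised. Since it
    never exceeds \<open>q\<close>, the two-point functions met on the way are bounded by those of
    \<open>q\<close>.\<close>
  define r where "r F e = (if e \<in> F then q e else p e)" for F e
  define D where "D F = {(a, b). a \<in> V \<and> b \<in> V \<and> a \<noteq> b \<and> {a, b} \<in> F}" for F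
  define g where "g = (\<lambda>(a, b). (q {a, b} - p {a, b}) * (tau V q x a * tau V q b y))"
  have finD: "finite (D F)" for F
    by (rule finite_subset[of _ "V \<times> V"]) (use fin in \<open>auto simp: D_def\<close>)
  have prr: "probs ?E (r F)" for F using pr by (auto simp: probs_def r_def)
  have rq: "r F e \<le> q e" if "e \<in> ?E" for F e using pq that by (simp add: r_def)
  have "tau V (r F) x y \<le> tau V p x y + sum g (D F)" if "F \<subseteq> ?E" for F
    using finite_subset[OF that finE] that
  proof (induction F)
    case empty
    have "tau V (r {}) x y = tau V p x y" by (simp add: r_def[abs_def])
    moreover have "D {} = {}" by (simp add: D_def)
    ultimately show ?case by simp
  next
    case (insert e F)
    then obtain c d where cd: "c \<in> V" "d \<in> V" "c \<noteq> d" "e = {c, d}" by (auto simp: edges_in_def)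
    define E0 where "E0 = ?E - {e}"
    have E: "?E = insert e E0" "e \<notin> E0" "finite E0" using insert.prems finE by (auto simp: E0_def)
    have pr0: "probs E0 (r F)" using prr[of F] E by (auto intro: probs_subset)
    have le: "prb E0 (r F) (\<lambda>\<omega>. conn \<omega> u v) \<le> tau V q u v" for u v
    proof -
      have "prb E0 (r F) (\<lambda>\<omega>. conn \<omega> u v) \<le> tau V (r F) u v"
        unfolding tau_def by (rule prb_mono_set[OF prr]) (use E in \<open>auto intro: conn_mono\<close>)
      also have "\<dots> \<le> tau V q u v" by (rule tau_mono_prob[OF prr pr(2) rq])
      finally show ?thesis .
    qed
    have nn: "0 \<le> prb E0 (r F) A" for A by (rule prb_nonneg[OF pr0])
    let ?A = "\<lambda>\<omega>. of_bool (conn \<omega> x y) :: real"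
    have qe: "0 \<le> q e - p e" using pq insert.prems by auto
    have "tau V (r (insert e F)) x y = q e * expect E0 (r F) (\<lambda>\<omega>. ?A (insert e \<omega>)) + (1 - q e) * expect E0 (r F) ?A"
    proof -
      have "expect E0 (r (insert e F)) f = expect E0 (r F) f" for f
        by (rule expect_cong_prob) (use E in \<open>auto simp: r_def\<close>)
      then show ?thesis using E by (simp add: tau_def prb_def expect_insert r_def)
    qed
    moreover have "tau V (r F) x y = p e * expect E0 (r F) (\<lambda>\<omega>. ?A (insert e \<omega>)) + (1 - p e) * expect E0 (r F) ?A"
      using E insert.hyps by (simp add: tau_def prb_def expect_insert r_def)
    ultimately have "tau V (r (insert e F)) x y = tau V (r F) x y +
        (q e - p e) * (expect E0 (r F) (\<lambda>\<omega>. ?A (insert e \<omega>)) - expect E0 (r F) ?A)"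
      by (simp add: algebra_simps)
    also have "expect E0 (r F) (\<lambda>\<omega>. ?A (insert e \<omega>)) - expect E0 (r F) ?A
      \<le> prb E0 (r F) (\<lambda>\<omega>. conn (insert {c, d} \<omega>) x y \<and> \<not> conn \<omega> x y)"
      unfolding prb_def cd(4) expect_diff[symmetric] by (intro expect_mono[OF pr0]) (auto simp: of_bool_def)
    also have "\<dots> \<le> tau V q x c * tau V q d y + tau V q x d * tau V q c y"
      by (rule order_trans[OF prb_pivotal[OF pr0 cd(3)]])
        (intro add_mono mult_mono le nn tau_nonneg[OF pr(2)])
    finally have "tau V (r (insert e F)) x y \<le> tau V (r F) x y +
        (q e - p e) * (tau V q x c * tau V q d y + tau V q x d * tau V q c y)"
      using qe by (simp add: mult_left_mono)
    also have "\<dots> \<le> tau V p x y + (sum g (D F) + (g (c, d) + g (d, c)))"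
      using insert.IH insert.prems cd by (simp add: g_def algebra_simps insert_commute)
    also have "sum g (D F) + (g (c, d) + g (d, c)) = sum g (D (insert e F))"
    proof -
      have "D (insert e F) = insert (c, d) (insert (d, c) (D F))"
        using cd by (auto simp: D_def doubleton_eq_iff insert_commute)
      moreover have "(c, d) \<notin> D F" "(d, c) \<notin> D F" using insert.hyps cd by (auto simp: D_def insert_commute)
      ultimately show ?thesis using finD cd(3) by simp
    qed
    finally show ?case .
  qed
  from this[of ?E] have "tau V (r ?E) x y \<le> tau V p x y + sum g (D ?E)" by simp
  moreover have "tau V (r ?E) x y = tau V q x y"
    unfolding tau_def prb_def by (rule expect_cong_prob) (simp add: r_def)
  moreover have "D ?E = {(a, b). a \<in> V \<and> b \<in> V \<and> a \<noteq> b}" by (auto simp: D_def edges_in_iff)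
  ultimately show ?thesis by (simp add: g_def)
qed

section \<open>Sprinkling and the vertices not reached from outside\<close>

definition edge_prob :: "('v set \<Rightarrow> real) \<Rightarrow> real \<Rightarrow> 'v set \<Rightarrow> real" where
  "edge_prob w b e = 1 - exp (- b * w e)"

lemma probs_edge_prob:
  assumes "finite V" "\<And>x y. 0 \<le> w {x, y}" "0 \<le> b"
  shows "probs (edges_in V) (edge_prob w b)"
  using assms finite_edges_in[OF assms(1)] by (auto simp: probs_def edge_prob_def edges_in_def)

lemma edge_prob_mono: "0 \<le> w e \<Longrightarrow> b \<le> b' \<Longrightarrow> edge_prob w b e \<le> edge_prob w b' e"
  by (simp add: edge_prob_def mult_right_mono)

lemma edge_prob_le: "edge_prob w b e \<le> b * w e"
  using exp_ge_add_one_self[of "- b * w e"] by (simp add: edge_prob_def)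

text \<open>What remains of \<open>V\<close> after exploring all clusters that start outside
  \<open>L\<close>. This is the random set of the Duminil-Copin--Tassion argument.\<close>

definition unreached :: "'v set \<Rightarrow> 'v set \<Rightarrow> 'v set set \<Rightarrow> 'v set" where
  "unreached V L \<omega> = {v \<in> V. \<forall>d\<in>V - L. \<not> conn \<omega> v d}"

lemma unreached_subset: "unreached V L \<omega> \<subseteq> L"
  unfolding unreached_def using conn_refl by fastforce

lemma unreached_antimono: "\<omega> \<subseteq> \<eta> \<Longrightarrow> unreached V L \<eta> \<subseteq> unreached V L \<omega>"
  unfolding unreached_def using conn_mono[of \<omega> \<eta>] by blast

lemma unreached_conn:
  "conn \<omega> u v \<Longrightarrow> v \<in> V \<Longrightarrow> u \<in> unreached V L \<omega> \<Longrightarrow> v \<in> unreached V L \<omega>"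
  unfolding unreached_def by (auto dest: conn_trans)

text \<open>The event that the unreached set equals \<open>S\<close> is decided by the edges not
  inside \<open>S\<close>: a path from outside \<open>S\<close> to the complement of
  \<open>L\<close> never visits \<open>S\<close>, and every edge leaving \<open>S\<close> must be
  closed. Conditionally on this event the configuration inside \<open>S\<close> is therefore
  fresh.\<close>

lemma unreached_outside:
  assumes "\<omega> \<subseteq> edges_in V"
  shows "unreached V L \<omega> = S \<longleftrightarrow> unreached V L (\<omega> - edges_in S) = S"
proof
  assume S: "unreached V L \<omega> = S"
  have "v \<in> S" if v: "v \<in> unreached V L (\<omega> - edges_in S)" for v
  proof (rule ccontr)
    assume vS: "v \<notin> S"
    have vV: "v \<in> V" using v by (simp add: unreached_def)
    with vS S obtain d where d: "d \<in> V - L" "conn \<omega> v d" by (auto simp: unreached_def)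
    have "conn (\<omega> - edges_in S) v d"
      using d(2)
    proof (induction rule: conn_induct)
      case (step u u')
      have "u \<in> V" by (rule conn_edges_in[OF step.hyps(1) assms vV])
      have "u \<notin> S"
      proof
        assume "u \<in> S"
        then have "v \<in> S" using S conn_sym[OF step.hyps(1)] vV unreached_conn by metis
        with vS show False ..
      qed
      then have "{u, u'} \<in> \<omega> - edges_in S" using step.hyps by (simp add: edges_in_iff)
      then show ?case using step.IH conn_edge conn_trans by metis
    qed simp
    with v d(1) show False by (simp add: unreached_def)
  qed
  moreover have "S \<subseteq> unreached V L (\<omega> - edges_in S)"
    using unreached_antimono[of "\<omega> - edges_in S" \<omega> V L] S by auto
  ultimately show "unreached V L (\<omega> - edges_in S) = S" by blast
next
  assume S: "unreached V L (\<omega> - edges_in S) = S"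
  have "v \<in> unreached V L \<omega>" if v: "v \<in> S" for v
  proof -
    have vV: "v \<in> V" using v S by (auto simp: unreached_def)
    have "u \<in> S" if "conn \<omega> v u" for u
      using that
    proof (induction rule: conn_induct)
      case (step u u')
      show ?case
      proof (rule ccontr)
        assume "u' \<notin> S"
        then have e: "{u, u'} \<in> \<omega> - edges_in S" using step.hyps by (simp add: edges_in_iff)
        have "u' \<in> V" using conn_edges_in[OF _ assms vV, of u'] step.hyps conn_edge conn_trans by metis
        then have "u' \<in> S" using unreached_conn[OF conn_edge[OF e], of V L] S step.IH by simp
        with \<open>u' \<notin> S\<close> show False ..
      qed
    qed (rule v)
    moreover have "S \<subseteq> L" using unreached_subset[of V L "\<omega> - edges_in S"] S by simp
    ultimately show ?thesis using vV by (auto simp: unreached_def)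
  qed
  then show "unreached V L \<omega> = S"
    using unreached_antimono[of "\<omega> - edges_in S" \<omega> V L] S by auto
qed

text \<open>A difference inequality in b. For v0 to stay unreached after a sprinkle of strength h,
  all edges from its cluster to the reached region must be missed, which has conditional probability
  exp (- h Y) with \<open>Y\<close> their total weight. The mean of \<open>Y\<close> on the event is
  at least \<open>\<kappa>\<close> times its probability, and \<open>c\<close> is a crude cap on
  \<open>Y\<close> that controls the second-order error.\<close>

lemma unreached_sprinkle:
  fixes w :: "'v set \<Rightarrow> real"
  assumes fin: "finite V" and w: "\<And>x y. 0 \<le> w {x, y}" and b: "0 \<le> \<beta>" "\<beta> \<le> b" "0 \<le> h"
    and L: "L \<subseteq> V" "v0 \<in> L"
    and \<kappa>: "\<And>S. S \<subseteq> L \<Longrightarrow> v0 \<in> S \<Longrightarrow>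
      \<kappa> \<le> (\<Sum>a\<in>S. \<Sum>d\<in>V - S. w {a, d} * tau S (edge_prob w \<beta>) v0 a)"
    and c: "c = (\<Sum>a\<in>V. \<Sum>d\<in>V. w {a, d})"
  shows "prb (edges_in V) (edge_prob w (b + h)) (\<lambda>\<omega>. v0 \<in> unreached V L \<omega>)
    \<le> prb (edges_in V) (edge_prob w b) (\<lambda>\<omega>. v0 \<in> unreached V L \<omega>) * (1 - h * \<kappa> + (h * c)\<^sup>2)"
proof -
  let ?E = "edges_in V" and ?un = "unreached V L" and ?p = "edge_prob w b"
  let ?cross = "\<lambda>A A'. (\<lambda>(a, b). {a, b}) ` (A \<times> A')"
  have finE: "finite ?E" by (rule finite_edges_in[OF fin])
  have pr: "probs ?E ?p" "probs ?E (edge_prob w h)" "probs ?E (edge_prob w \<beta>)"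
    using b by (auto intro!: probs_edge_prob fin w)
  define K where "K \<omega> = {a \<in> V. conn \<omega> v0 a}" for \<omega>
  define Y where "Y \<omega> = (\<Sum>a\<in>K \<omega>. \<Sum>d\<in>V - ?un \<omega>. w {a, d})" for \<omega>
  have v0V: "v0 \<in> V" using L by auto
  have Y0: "0 \<le> Y \<omega>" for \<omega> unfolding Y_def by (intro sum_nonneg w)
  have Yc: "Y \<omega> \<le> c" for \<omega>
  proof -
    have "Y \<omega> \<le> (\<Sum>a\<in>K \<omega>. \<Sum>d\<in>V. w {a, d})"
      unfolding Y_def by (intro sum_mono sum_mono2) (use fin w in auto)
    also have "\<dots> \<le> c" unfolding c by (intro sum_mono2) (use fin w in \<open>auto simp: K_def intro!: sum_nonneg\<close>)
    finally show ?thesis .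
  qed
  have inner: "prb ?E (edge_prob w h) (\<lambda>\<eta>. v0 \<in> ?un (\<omega> \<union> \<eta>))
      \<le> of_bool (v0 \<in> ?un \<omega>) * (1 - h * Y \<omega> + (h * c)\<^sup>2)" for \<omega>
  proof (cases "v0 \<in> ?un \<omega>")
    case True
    have Kun: "K \<omega> \<subseteq> ?un \<omega>" using unreached_conn[OF _ _ True] by (auto simp: K_def)
    let ?C = "?cross (K \<omega>) (V - ?un \<omega>)"
    have CE: "?C \<subseteq> ?E"
    proof
      fix e assume "e \<in> ?C"
      then obtain a d where ad: "a \<in> K \<omega>" "d \<in> V - ?un \<omega>" "e = {a, d}" by auto
      moreover from this Kun have "a \<noteq> d" by auto
      ultimately show "e \<in> ?E" by (simp add: edges_in_iff K_def)
    qed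
    have "prb ?E (edge_prob w h) (\<lambda>\<eta>. v0 \<in> ?un (\<omega> \<union> \<eta>)) \<le> prb ?E (edge_prob w h) (\<lambda>\<eta>. \<eta> \<inter> ?C = {})"
    proof (rule prb_mono[OF pr(2)], rule ccontr)
      fix \<eta> assume un: "v0 \<in> ?un (\<omega> \<union> \<eta>)" and "\<eta> \<inter> ?C \<noteq> {}"
      then obtain a d where ad: "a \<in> K \<omega>" "d \<in> V - ?un \<omega>" "{a, d} \<in> \<eta>" by auto
      then obtain d' where d': "d' \<in> V - L" "conn \<omega> d d'" by (auto simp: unreached_def)
      have "conn (\<omega> \<union> \<eta>) v0 a" by (rule conn_mono[of \<omega>]) (use ad in \<open>auto simp: K_def\<close>)
      moreover have "conn (\<omega> \<union> \<eta>) a d" by (rule conn_edge) (use ad in auto)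
      moreover have "conn (\<omega> \<union> \<eta>) d d'" by (rule conn_mono[OF _ d'(2)]) auto
      ultimately have "conn (\<omega> \<union> \<eta>) v0 d'" by (meson conn_trans)
      with un d'(1) show False by (simp add: unreached_def)
    qed
    also have "\<dots> = (\<Prod>e\<in>?C. 1 - edge_prob w h e)" by (rule prb_none[OF finE CE])
    also have "\<dots> = (\<Prod>a\<in>K \<omega>. \<Prod>d\<in>V - ?un \<omega>. 1 - edge_prob w h {a, d})"
      using Kun fin by (intro prod_cross) (auto simp: K_def)
    also have "\<dots> = exp (- (h * Y \<omega>))"
    proof -
      have fK: "finite (K \<omega>)" "finite (V - ?un \<omega>)" using fin by (auto simp: K_def)
      then show ?thesis by (simp add: edge_prob_def Y_def sum_distrib_left flip: exp_sum sum_negf)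
    qed
    also have "\<dots> \<le> 1 - h * Y \<omega> + (h * Y \<omega>)\<^sup>2"
      using b(3) Y0 by (intro one_minus_exp_ge) simp
    also have "(h * Y \<omega>)\<^sup>2 \<le> (h * c)\<^sup>2"
      using b(3) Y0 Yc by (intro power_mono mult_left_mono) auto
    finally show ?thesis using True by simp
  next
    case False
    then have "v0 \<notin> ?un (\<omega> \<union> \<eta>)" for \<eta> using unreached_antimono[of \<omega> "\<omega> \<union> \<eta>" V L] by auto
    then show ?thesis using False finE by (simp add: prb_def)
  qed
  have "prb ?E (edge_prob w (b + h)) (\<lambda>\<omega>. v0 \<in> ?un \<omega>)
      = expect ?E (\<lambda>e. 1 - (1 - ?p e) * (1 - edge_prob w h e)) (\<lambda>\<omega>. of_bool (v0 \<in> ?un \<omega>))"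
    unfolding prb_def by (rule expect_cong_prob) (simp add: edge_prob_def algebra_simps flip: exp_add)
  also have "\<dots> = expect ?E ?p (\<lambda>\<omega>. prb ?E (edge_prob w h) (\<lambda>\<eta>. v0 \<in> ?un (\<omega> \<union> \<eta>)))"
    unfolding prb_def by (rule expect_sprinkle[OF finE])
  also have "\<dots> \<le> expect ?E ?p (\<lambda>\<omega>. of_bool (v0 \<in> ?un \<omega>) * (1 - h * Y \<omega> + (h * c)\<^sup>2))"
    by (intro expect_mono[OF pr(1)] inner)
  also have "\<dots> = expect ?E ?p (\<lambda>\<omega>. (1 + (h * c)\<^sup>2) * of_bool (v0 \<in> ?un \<omega>) - h * (of_bool (v0 \<in> ?un \<omega>) * Y \<omega>))"
    by (intro expect_cong) (simp add: algebra_simps)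
  also have "\<dots> = (1 + (h * c)\<^sup>2) * prb ?E ?p (\<lambda>\<omega>. v0 \<in> ?un \<omega>) - h * expect ?E ?p (\<lambda>\<omega>. of_bool (v0 \<in> ?un \<omega>) * Y \<omega>)"
    by (simp only: expect_diff expect_cmult prb_def)
  \<comment> \<open>Split according to the value \<open>S\<close> of the unreached set. By
    independence of the inside of \<open>S\<close>, the conditional mean of \<open>Y\<close> is the
    boundary sum over \<open>S\<close>, at least \<open>\<kappa>\<close> at parameter
    \<open>\<beta>\<close> and hence at the larger parameter b.\<close>
  also have "\<kappa> * prb ?E ?p (\<lambda>\<omega>. v0 \<in> ?un \<omega>) \<le> expect ?E ?p (\<lambda>\<omega>. of_bool (v0 \<in> ?un \<omega>) * Y \<omega>)"
  proof -
    define \<S> where "\<S> = {S. S \<subseteq> L \<and> v0 \<in> S}"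
    have fS: "finite \<S>" unfolding \<S>_def using L fin by (auto intro: finite_subset[OF _ finite_Pow_iff[THEN iffD2]] finite_subset)
    have split: "of_bool (v0 \<in> ?un \<omega>) * f (?un \<omega>) = (\<Sum>S\<in>\<S>. of_bool (?un \<omega> = S) * f S)" for \<omega> and f :: "'v set \<Rightarrow> real"
    proof (cases "v0 \<in> ?un \<omega>")
      case True
      then have "?un \<omega> \<in> \<S>" using unreached_subset[of V L \<omega>] by (simp add: \<S>_def)
      then have "(\<Sum>S\<in>\<S>. of_bool (?un \<omega> = S) * f S) = f (?un \<omega>)"
        using fS by (simp add: of_bool_def if_distrib[of "\<lambda>x. x * _"] sum.delta' cong: if_cong)
      with True show ?thesis by simp
    next
      case False
      then have "?un \<omega> \<noteq> S" if "S \<in> \<S>" for S using that by (auto simp: \<S>_def)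
      with False show ?thesis by simp
    qed
    have P: "expect ?E ?p (\<lambda>\<omega>. of_bool (?un \<omega> = S) * (\<Sum>a\<in>S. \<Sum>d\<in>V - S. w {a, d} * of_bool (conn (\<omega> \<inter> edges_in S) v0 a)))
       = prb ?E ?p (\<lambda>\<omega>. ?un \<omega> = S) * (\<Sum>a\<in>S. \<Sum>d\<in>V - S. w {a, d} * tau S ?p v0 a)" if "S \<in> \<S>" for S
    proof -
      have SE: "edges_in S \<subseteq> ?E" using that L by (intro edges_in_mono) (auto simp: \<S>_def)
      have "expect ?E ?p (\<lambda>\<omega>. of_bool (?un \<omega> = S) * (\<Sum>a\<in>S. \<Sum>d\<in>V - S. w {a, d} * of_bool (conn (\<omega> \<inter> edges_in S) v0 a)))
        = expect ?E ?p (\<lambda>\<omega>. (\<Sum>a\<in>S. \<Sum>d\<in>V - S. w {a, d} * of_bool (conn (\<omega> \<inter> edges_in S) v0 a)) * of_bool (?un (\<omega> - edges_in S) = S))"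
        by (intro expect_cong) (simp add: unreached_outside[of _ V L S] mult.commute)
      also have "\<dots> = expect (edges_in S) ?p (\<lambda>\<omega>. \<Sum>a\<in>S. \<Sum>d\<in>V - S. w {a, d} * of_bool (conn \<omega> v0 a))
          * expect (?E - edges_in S) ?p (\<lambda>\<omega>. of_bool (?un \<omega> = S))"
        by (rule expect_indep[OF finE SE])
      also have "expect (?E - edges_in S) ?p (\<lambda>\<omega>. of_bool (?un \<omega> = S)) = expect ?E ?p (\<lambda>\<omega>. of_bool (?un (\<omega> - edges_in S) = S))"
        by (rule expect_restrict_diff[OF finE SE, symmetric])
      also have "\<dots> = prb ?E ?p (\<lambda>\<omega>. ?un \<omega> = S)"
        unfolding prb_def by (intro expect_cong) (simp add: unreached_outside[of _ V L S])
      also have "expect (edges_in S) ?p (\<lambda>\<omega>. \<Sum>a\<in>S. \<Sum>d\<in>V - S. w {a, d} * of_bool (conn \<omega> v0 a))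
        = (\<Sum>a\<in>S. \<Sum>d\<in>V - S. w {a, d} * tau S ?p v0 a)"
        by (simp add: expect_sum expect_cmult tau_def prb_def)
      finally show ?thesis by (simp add: mult.commute)
    qed
    have "\<kappa> * prb ?E ?p (\<lambda>\<omega>. v0 \<in> ?un \<omega>) = (\<Sum>S\<in>\<S>. prb ?E ?p (\<lambda>\<omega>. ?un \<omega> = S) * \<kappa>)"
    proof -
      have "prb ?E ?p (\<lambda>\<omega>. v0 \<in> ?un \<omega>) = expect ?E ?p (\<lambda>\<omega>. \<Sum>S\<in>\<S>. of_bool (?un \<omega> = S))"
        unfolding prb_def using split[of _ "\<lambda>_. 1"] by simp
      then show ?thesis by (simp add: expect_sum prb_def sum_distrib_left mult.commute)
    qed
    also have "\<dots> \<le> (\<Sum>S\<in>\<S>. prb ?E ?p (\<lambda>\<omega>. ?un \<omega> = S) * (\<Sum>a\<in>S. \<Sum>d\<in>V - S. w {a, d} * tau S ?p v0 a))"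
    proof (intro sum_mono mult_left_mono prb_nonneg[OF pr(1)])
      fix S assume S: "S \<in> \<S>"
      then have SV: "edges_in S \<subseteq> ?E" using L by (intro edges_in_mono) (auto simp: \<S>_def)
      have "\<kappa> \<le> (\<Sum>a\<in>S. \<Sum>d\<in>V - S. w {a, d} * tau S (edge_prob w \<beta>) v0 a)"
        using \<kappa> S by (simp add: \<S>_def)
      also have "\<dots> \<le> (\<Sum>a\<in>S. \<Sum>d\<in>V - S. w {a, d} * tau S ?p v0 a)"
      proof (intro sum_mono mult_left_mono w tau_mono_prob)
        show "probs (edges_in S) (edge_prob w \<beta>)" "probs (edges_in S) ?p"
          using pr SV by (auto intro: probs_subset)
      qed (use b w in \<open>auto simp: edges_in_def intro!: edge_prob_mono\<close>)
      finally show "\<kappa> \<le> \<dots>" .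
    qed
    also have "\<dots> = expect ?E ?p (\<lambda>\<omega>. \<Sum>S\<in>\<S>. of_bool (?un \<omega> = S) * (\<Sum>a\<in>S. \<Sum>d\<in>V - S. w {a, d} * of_bool (conn (\<omega> \<inter> edges_in S) v0 a)))"
      unfolding expect_sum by (intro sum.cong refl P[symmetric])
    also have "\<dots> = expect ?E ?p (\<lambda>\<omega>. of_bool (v0 \<in> ?un \<omega>) * Y \<omega>)"
    proof (rule expect_cong)
      fix \<omega> assume w: "\<omega> \<subseteq> ?E"
      have "of_bool (v0 \<in> ?un \<omega>) * (\<Sum>a\<in>?un \<omega>. \<Sum>d\<in>V - ?un \<omega>. w {a, d} * of_bool (conn (\<omega> \<inter> edges_in (?un \<omega>)) v0 a))
        = of_bool (v0 \<in> ?un \<omega>) * Y \<omega>"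
      proof (cases "v0 \<in> ?un \<omega>")
        case True
        have c: "conn (\<omega> \<inter> edges_in (?un \<omega>)) v0 a \<longleftrightarrow> conn \<omega> v0 a" for a
        proof
          assume "conn \<omega> v0 a"
          then show "conn (\<omega> \<inter> edges_in (?un \<omega>)) v0 a"
          proof (induction rule: conn_induct)
            case (step u v)
            have uV: "u \<in> V" by (rule conn_edges_in[OF step.hyps(1) w v0V])
            have "v \<in> V" by (rule conn_edges_in[OF conn_edge[OF step.hyps(3)] w uV])
            have u: "u \<in> ?un \<omega>" by (rule unreached_conn[OF step.hyps(1) uV True])
            have "v \<in> ?un \<omega>" by (rule unreached_conn[OF conn_edge[OF step.hyps(3)] \<open>v \<in> V\<close> u])
            with u step.hyps have "{u, v} \<in> \<omega> \<inter> edges_in (?un \<omega>)" by (simp add: edges_in_iff)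
            from conn_trans[OF step.IH conn_edge[OF this]] show ?case .
          qed simp
        qed (rule conn_mono, auto)
        have sub: "K \<omega> \<subseteq> ?un \<omega>" using unreached_conn[OF _ _ True] by (auto simp: K_def)
        have fun': "finite (?un \<omega>)" using fin by (auto simp: unreached_def)
        have "(\<Sum>a\<in>?un \<omega>. \<Sum>d\<in>V - ?un \<omega>. w {a, d} * of_bool (conn \<omega> v0 a)) = Y \<omega>"
          unfolding Y_def
        proof (rule sum.mono_neutral_cong_right[OF fun' sub])
          show "\<forall>a\<in>?un \<omega> - K \<omega>. (\<Sum>d\<in>V - ?un \<omega>. w {a, d} * of_bool (conn \<omega> v0 a)) = 0"
            by (auto simp: K_def unreached_def)
        qed (simp add: K_def)
        then show ?thesis by (simp only: c)
      qed simp
      then show "(\<Sum>S\<in>\<S>. of_bool (?un \<omega> = S) * (\<Sum>a\<in>S. \<Sum>d\<in>V - S. w {a, d} * of_bool (conn (\<omega> \<inter> edges_in S) v0 a)))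
        = of_bool (v0 \<in> ?un \<omega>) * Y \<omega>"
        by (subst split[symmetric])
    qed
    finally show ?thesis .
  qed
  then have "h * (\<kappa> * prb ?E ?p (\<lambda>\<omega>. v0 \<in> ?un \<omega>)) \<le> h * expect ?E ?p (\<lambda>\<omega>. of_bool (v0 \<in> ?un \<omega>) * Y \<omega>)"
    using b(3) by (rule mult_left_mono)
  then have "(1 + (h * c)\<^sup>2) * prb ?E ?p (\<lambda>\<omega>. v0 \<in> ?un \<omega>) - h * expect ?E ?p (\<lambda>\<omega>. of_bool (v0 \<in> ?un \<omega>) * Y \<omega>)
    \<le> prb ?E ?p (\<lambda>\<omega>. v0 \<in> ?un \<omega>) * (1 - h * \<kappa> + (h * c)\<^sup>2)"
    by (simp add: algebra_simps)
  finally show ?thesis .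
qed

text \<open>The difference inequality is iterated over n equal steps from \<open>\<beta>\<close> to
  \<open>\<beta>'\<close>. The second-order errors add up to order 1 / n and vanish in the limit,
  which stands in for integrating a differential inequality.\<close>

lemma unreached_exponential_bound:
  fixes w :: "'v set \<Rightarrow> real"
  assumes fin: "finite V" and w: "\<And>x y. 0 \<le> w {x, y}" and b: "0 \<le> \<beta>" "\<beta> \<le> \<beta>'"
    and L: "L \<subseteq> V" "v0 \<in> L"
    and \<kappa>: "\<And>S. S \<subseteq> L \<Longrightarrow> v0 \<in> S \<Longrightarrow>
      \<kappa> \<le> (\<Sum>a\<in>S. \<Sum>d\<in>V - S. w {a, d} * tau S (edge_prob w \<beta>) v0 a)"
  shows "prb (edges_in V) (edge_prob w \<beta>') (\<lambda>\<omega>. v0 \<in> unreached V L \<omega>) \<le> exp (- (\<beta>' - \<beta>) * \<kappa>)"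
proof -
  define c where "c = (\<Sum>a\<in>V. \<Sum>d\<in>V. w {a, d})"
  define Q where "Q b = prb (edges_in V) (edge_prob w b) (\<lambda>\<omega>. v0 \<in> unreached V L \<omega>)" for b
  have Q01: "0 \<le> Q b" "Q b \<le> 1" if "0 \<le> b" for b
    unfolding Q_def by (intro prb_nonneg prb_le_1 probs_edge_prob fin w that)+
  have step: "Q (b + h) \<le> Q b * exp (- h * \<kappa> + (h * c)\<^sup>2)" if "\<beta> \<le> b" "0 \<le> h" for b h
  proof -
    have "Q (b + h) \<le> Q b * (1 - h * \<kappa> + (h * c)\<^sup>2)"
      unfolding Q_def by (rule unreached_sprinkle[OF fin w b(1) that L \<kappa> c_def])
    also have "\<dots> \<le> Q b * exp (- h * \<kappa> + (h * c)\<^sup>2)"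
      using exp_ge_add_one_self[of "- h * \<kappa> + (h * c)\<^sup>2"] Q01[of b] b that
      by (intro mult_left_mono) (auto simp: algebra_simps)
    finally show ?thesis .
  qed
  have iter: "Q (\<beta> + real n * h) \<le> exp (real n * (- h * \<kappa> + (h * c)\<^sup>2))" if "0 \<le> h" for n h
  proof (induction n)
    case 0
    show ?case using Q01[of \<beta>] b by simp
  next
    case (Suc n)
    have "Q (\<beta> + real (Suc n) * h) = Q ((\<beta> + real n * h) + h)" by (simp add: algebra_simps)
    also have "\<dots> \<le> Q (\<beta> + real n * h) * exp (- h * \<kappa> + (h * c)\<^sup>2)"
      using that by (intro step) auto
    also have "\<dots> \<le> exp (real n * (- h * \<kappa> + (h * c)\<^sup>2)) * exp (- h * \<kappa> + (h * c)\<^sup>2)"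
      using Suc.IH by (intro mult_right_mono) auto
    also have "\<dots> = exp (real (Suc n) * (- h * \<kappa> + (h * c)\<^sup>2))"
      by (simp add: algebra_simps flip: exp_add)
    finally show ?case .
  qed
  define D where "D = \<beta>' - \<beta>"
  have bound: "Q \<beta>' \<le> exp (- D * \<kappa> + (D * c)\<^sup>2 * inverse (real (Suc n)))" for n
  proof -
    have "\<beta>' = \<beta> + real (Suc n) * (D / real (Suc n))" by (simp add: D_def)
    moreover have "real (Suc n) * (- (D / real (Suc n)) * \<kappa> + (D / real (Suc n) * c)\<^sup>2)
        = - D * \<kappa> + (D * c)\<^sup>2 * inverse (real (Suc n))"
    proof -
      have "m * (- (D / m) * \<kappa> + (D / m * c)\<^sup>2) = - D * \<kappa> + (D * c)\<^sup>2 * inverse m" if "0 < m" for m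
        using that by (simp add: field_simps power2_eq_square)
      then show ?thesis by simp
    qed
    ultimately show ?thesis using iter[of "D / real (Suc n)" "Suc n"] b by (simp add: D_def)
  qed
  have "(\<lambda>n. exp (- D * \<kappa> + (D * c)\<^sup>2 * inverse (real (Suc n)))) \<longlonglongrightarrow> exp (- D * \<kappa> + (D * c)\<^sup>2 * 0)"
    by (intro tendsto_exp tendsto_add tendsto_mult tendsto_const LIMSEQ_inverse_real_of_nat)
  then have "Q \<beta>' \<le> exp (- D * \<kappa> + (D * c)\<^sup>2 * 0)"
    by (rule LIMSEQ_le_const) (use bound in auto)
  then show ?thesis by (simp add: Q_def D_def)
qed

section \<open>Percolation on an infinite vertex set\<close>

lemma edge_weight_pair:
  assumes "\<And>x y. K x y = K y x"
  shows "edge_weight K {x, y} = K x y"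
  unfolding edge_weight_def
  by (rule the_equality) (use assms in \<open>auto simp: doubleton_eq_iff\<close>)

lemma edges_in_subset_edges: "edges_in V \<subseteq> edges"
  by (auto simp: edges_in_def edges_def)

locale symmetric_kernel =
  fixes K :: "'v::countable \<Rightarrow> 'v \<Rightarrow> real"
  assumes K_sym: "K x y = K y x" and K_nonneg: "0 \<le> K x y"
begin

abbreviation "w \<equiv> edge_weight K"
abbreviation "p \<equiv> edge_prob (edge_weight K)"

lemma w_pair: "w {x, y} = K x y"
  by (rule edge_weight_pair) (rule K_sym)

lemma w_nonneg: "0 \<le> w {x, y}"
  by (simp add: w_pair K_nonneg)

lemma probs_p: "finite V \<Longrightarrow> 0 \<le> b \<Longrightarrow> probs (edges_in V) (p b)"
  by (rule probs_edge_prob) (simp_all add: w_nonneg)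

lemma p_pair: "p b {x, y} = 1 - exp (- b * K x y)"
  by (simp add: edge_prob_def w_pair)

text \<open>Cylinder events, the bridge between the finite sums \<open>prb\<close> and the infinite
  product measure.\<close>

definition cyl :: "real \<Rightarrow> 'v set set \<Rightarrow> ('v set set \<Rightarrow> bool) \<Rightarrow> ('v set \<Rightarrow> bool) set" where
  "cyl b E A = {\<omega> \<in> space (percolation K b). A {e \<in> E. \<omega> e}}"

text \<open>The event is a finite disjoint union, over the possible traces of the configuration on
  \<open>E\<close>, of elementary product cylinders.\<close>

lemma
  assumes b: "0 \<le> b" and E: "finite E" "E \<subseteq> edges"
  shows cyl_sets: "cyl b E A \<in> sets (percolation K b)"
    and measure_cyl: "measure (percolation K b) (cyl b E A) = prb E (p b) A"
proof -
  define Mf where "Mf = (\<lambda>e. measure_pmf (bernoulli_pmf (1 - exp (- b * w e))))"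
  interpret prob_space "Mf e" for e
    unfolding Mf_def by (rule prob_space_measure_pmf)
  interpret product_prob_space Mf edges
    by unfold_locales
  have M: "percolation K b = PiM edges Mf" by (simp add: percolation_def Mf_def)
  have sM: "sets (Mf e) = UNIV" for e by (simp add: Mf_def)
  define C where "C S = prod_emb edges Mf E (Pi\<^sub>E E (\<lambda>e. {e \<in> S}))" for S
  have Cs: "C S \<in> sets (percolation K b)" for S
    unfolding M C_def by (intro measurable_prod_emb E sets_PiM_I_finite) (auto simp: sM)
  have Ceq: "C S = {\<omega> \<in> space (percolation K b). {e \<in> E. \<omega> e} = S}" if "S \<subseteq> E" for S
    unfolding C_def M prod_emb_def using that E
    by (auto simp: space_PiM PiE_iff restrict_def extensional_def Mf_def)
  have eq: "cyl b E A = (\<Union>S\<in>{S. S \<subseteq> E \<and> A S}. C S)"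
    unfolding cyl_def using Ceq by auto
  have finS: "finite {S. S \<subseteq> E \<and> A S}" using E by auto
  show "cyl b E A \<in> sets (percolation K b)"
    unfolding eq using Cs finS by (intro sets.finite_UN) auto
  have mC: "measure (percolation K b) (C S) = (\<Prod>e\<in>S. p b e) * (\<Prod>e\<in>E - S. 1 - p b e)" if S: "S \<subseteq> E" for S
  proof -
    have "measure (percolation K b) (C S) = (\<Prod>e\<in>E. measure (Mf e) {e \<in> S})"
      unfolding M C_def by (rule measure_PiM_emb[OF E(2,1)]) (simp add: sM)
    also have "\<dots> = (\<Prod>e\<in>E. if e \<in> S then p b e else 1 - p b e)"
    proof (rule prod.cong[OF refl])
      fix e assume "e \<in> E"
      then obtain x y where "e = {x, y}" using E by (auto simp: edges_def)
      then have "0 \<le> b * w e" using b w_nonneg by auto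
      then have "0 \<le> 1 - exp (- b * w e)" "1 - exp (- b * w e) \<le> 1" by auto
      then show "measure (Mf e) {e \<in> S} = (if e \<in> S then p b e else 1 - p b e)"
        by (auto simp: Mf_def measure_pmf_single edge_prob_def)
    qed
    also have "\<dots> = (\<Prod>e\<in>S. p b e) * (\<Prod>e\<in>E - S. 1 - p b e)"
      using E S by (subst prod.If_cases) (auto simp: Int_absorb1 Diff_eq)
    finally show ?thesis .
  qed
  have "measure (percolation K b) (cyl b E A) = (\<Sum>S\<in>{S. S \<subseteq> E \<and> A S}. measure (percolation K b) (C S))"
    unfolding eq
  proof (rule measure_finite_Union[OF finS])
    show "disjoint_family_on C {S. S \<subseteq> E \<and> A S}"
      by (auto simp: disjoint_family_on_def Ceq)
  qed (use Cs in \<open>auto simp: M\<close>)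
  also have "\<dots> = (\<Sum>S\<in>{S. S \<subseteq> E \<and> A S}. (\<Prod>e\<in>S. p b e) * (\<Prod>e\<in>E - S. 1 - p b e))"
    by (intro sum.cong refl mC) auto
  also have "\<dots> = prb E (p b) A"
    unfolding prb_def expect_def
    by (rule sum.mono_neutral_cong_left) (use E in auto)
  finally show "measure (percolation K b) (cyl b E A) = prb E (p b) A" .
qed

lemma prob_space_percolation: "prob_space (percolation K b)"
  unfolding percolation_def by (rule prob_space_PiM) (simp add: prob_space_measure_pmf)

end

locale exhausted_kernel = symmetric_kernel +
  fixes \<Lambda> :: "nat \<Rightarrow> 'a set"
  assumes \<Lambda>_finite: "finite (\<Lambda> n)" and \<Lambda>_mono: "n \<le> m \<Longrightarrow> \<Lambda> n \<subseteq> \<Lambda> m"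
    and \<Lambda>_cover: "\<exists>n. x \<in> \<Lambda> n"
begin

lemma finite_subset_\<Lambda>: "finite F \<Longrightarrow> \<exists>n. F \<subseteq> \<Lambda> n"
proof (induction F rule: finite_induct)
  case (insert x F)
  then obtain n m where "F \<subseteq> \<Lambda> n" "x \<in> \<Lambda> m" using \<Lambda>_cover by blast
  then have "insert x F \<subseteq> \<Lambda> (max n m)"
    using \<Lambda>_mono[of n "max n m"] \<Lambda>_mono[of m "max n m"] by auto
  then show ?case ..
qed simp

lemma linked_iff: "linked \<omega> x y \<longleftrightarrow> (\<exists>n. conn {e \<in> edges_in (\<Lambda> n). \<omega> e} x y)"
proof
  assume "linked \<omega> x y"
  then have "conn {e. \<omega> e} x y" by (simp add: conn_def)
  then show "\<exists>n. conn {e \<in> edges_in (\<Lambda> n). \<omega> e} x y"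
  proof (induction rule: conn_induct)
    case (step u v)
    then obtain n where n: "conn {e \<in> edges_in (\<Lambda> n). \<omega> e} x u" by blast
    obtain m where m: "{u, v} \<subseteq> \<Lambda> m" using finite_subset_\<Lambda>[of "{u, v}"] by blast
    let ?k = "max n m"
    have e: "{u, v} \<in> {e \<in> edges_in (\<Lambda> ?k). \<omega> e}"
      using step.hyps m \<Lambda>_mono[of m ?k] by (auto simp: edges_in_iff)
    have "conn {e \<in> edges_in (\<Lambda> ?k). \<omega> e} x u"
      by (rule conn_mono[OF _ n]) (use edges_in_mono[OF \<Lambda>_mono[of n ?k]] in auto)
    from conn_trans[OF this conn_edge[OF e]] show ?case ..
  qed auto
next
  assume "\<exists>n. conn {e \<in> edges_in (\<Lambda> n). \<omega> e} x y"
  then obtain n where "conn {e \<in> edges_in (\<Lambda> n). \<omega> e} x y" ..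
  then have "conn {e. \<omega> e} x y" by (rule conn_mono[rotated]) auto
  then show "linked \<omega> x y" by (simp add: conn_def)
qed

lemma linked_event:
  "{\<omega> \<in> space (percolation K b). linked \<omega> x y} = (\<Union>n. cyl b (edges_in (\<Lambda> n)) (\<lambda>\<omega>. conn \<omega> x y))"
  by (auto simp: cyl_def linked_iff)

lemma linked_sets: "0 \<le> b \<Longrightarrow> {\<omega> \<in> space (percolation K b). linked \<omega> x y} \<in> sets (percolation K b)"
  unfolding linked_event
  by (intro sets.countable_UN image_subsetI cyl_sets finite_edges_in \<Lambda>_finite edges_in_subset_edges)

text \<open>Any connection uses finitely many edges, so the event is an increasing union over the
  exhausting sets and a bound uniform in them passes to the limit.\<close>

lemma two_point_le:
  assumes b: "0 \<le> b" and "\<And>n. tau (\<Lambda> n) (p b) x y \<le> B"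
  shows "two_point K b x y \<le> B"
proof -
  interpret prob_space "percolation K b" by (rule prob_space_percolation)
  let ?A = "\<lambda>n. cyl b (edges_in (\<Lambda> n)) (\<lambda>\<omega>. conn \<omega> x y)"
  have "(\<lambda>n. measure (percolation K b) (?A n)) \<longlonglongrightarrow> measure (percolation K b) (\<Union>n. ?A n)"
  proof (rule finite_Lim_measure_incseq)
    show "range ?A \<subseteq> sets (percolation K b)"
      using cyl_sets[OF b finite_edges_in[OF \<Lambda>_finite] edges_in_subset_edges] by auto
    show "incseq ?A"
    proof (rule incseq_SucI, rule subsetI)
      fix n \<omega> assume "\<omega> \<in> ?A n"
      moreover have "{e \<in> edges_in (\<Lambda> n). \<omega> e} \<subseteq> {e \<in> edges_in (\<Lambda> (Suc n)). \<omega> e}"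
        using edges_in_mono[OF \<Lambda>_mono[of n "Suc n"]] by auto
      ultimately show "\<omega> \<in> ?A (Suc n)" using conn_mono[of "{e \<in> edges_in (\<Lambda> n). \<omega> e}" _ x y] by (simp add: cyl_def)
    qed
  qed
  moreover have "measure (percolation K b) (?A n) \<le> B" for n
    using assms(2)[of n] measure_cyl[OF b finite_edges_in[OF \<Lambda>_finite] edges_in_subset_edges]
    by (simp add: tau_def)
  ultimately show ?thesis
    unfolding two_point_def linked_event by (intro LIMSEQ_le_const2) auto
qed

lemma infinite_cluster_iff: "infinite (cluster \<omega> x) \<longleftrightarrow> (\<forall>n. \<exists>d. d \<notin> \<Lambda> n \<and> linked \<omega> x d)"
proof
  assume "infinite (cluster \<omega> x)"
  then have "\<not> cluster \<omega> x \<subseteq> \<Lambda> n" for n using \<Lambda>_finite finite_subset by blast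
  then show "\<forall>n. \<exists>d. d \<notin> \<Lambda> n \<and> linked \<omega> x d" by (auto simp: cluster_def)
next
  assume *: "\<forall>n. \<exists>d. d \<notin> \<Lambda> n \<and> linked \<omega> x d"
  show "infinite (cluster \<omega> x)"
  proof
    assume "finite (cluster \<omega> x)"
    then obtain n where "cluster \<omega> x \<subseteq> \<Lambda> n" using finite_subset_\<Lambda> by blast
    with * show False by (auto simp: cluster_def)
  qed
qed

text \<open>The events that v0 is linked to a point outside \<open>\<Lambda> n\<close> decrease to
  the event that its cluster is infinite, so a lower bound uniform in n survives. The larger set
  \<open>\<Lambda> m\<close> in which the link is found may depend on n.\<close>

lemma percolates:
  assumes b: "0 \<le> b" and c: "0 < c"
    and reach: "\<And>n. \<exists>m\<ge>n. prb (edges_in (\<Lambda> m)) (p b) (\<lambda>\<omega>. v0 \<in> unreached (\<Lambda> m) (\<Lambda> n) \<omega>) \<le> 1 - c"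
    and v0: "\<And>n. v0 \<in> \<Lambda> n"
  shows "0 < measure (percolation K b) {\<omega> \<in> space (percolation K b). \<exists>x. infinite (cluster \<omega> x)}"
proof -
  interpret prob_space "percolation K b" by (rule prob_space_percolation)
  let ?M = "percolation K b"
  define B where "B x n = {\<omega> \<in> space ?M. \<exists>d. d \<notin> \<Lambda> n \<and> linked \<omega> x d}" for x n
  have Bs: "B x n \<in> sets ?M" for x n
  proof -
    have "B x n = (\<Union>d\<in>- \<Lambda> n. {\<omega> \<in> space ?M. linked \<omega> x d})" by (auto simp: B_def)
    also have "\<dots> \<in> sets ?M" by (intro sets.countable_UN') (auto intro!: linked_sets b)
    finally show ?thesis .
  qed
  have inf: "{\<omega> \<in> space ?M. infinite (cluster \<omega> x)} = (\<Inter>n. B x n)" for x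
    by (auto simp: infinite_cluster_iff B_def)
  have infs: "(\<Inter>n. B x n) \<in> sets ?M" for x
    by (rule sets.countable_INT) (use Bs in auto)
  have "{\<omega> \<in> space ?M. \<exists>x. infinite (cluster \<omega> x)} = (\<Union>x. {\<omega> \<in> space ?M. infinite (cluster \<omega> x)})" by auto
  also have "\<dots> \<in> sets ?M" unfolding inf by (intro sets.countable_UN') (auto intro!: infs)
  finally have sets: "{\<omega> \<in> space ?M. \<exists>x. infinite (cluster \<omega> x)} \<in> sets ?M" .
  have lim: "(\<lambda>n. measure ?M (B v0 n)) \<longlonglongrightarrow> measure ?M (\<Inter>n. B v0 n)"
  proof (rule finite_Lim_measure_decseq)
    show "decseq (B v0)"
      unfolding decseq_Suc_iff
    proof (intro allI subsetI)
      fix n \<omega> assume "\<omega> \<in> B v0 (Suc n)"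
      then show "\<omega> \<in> B v0 n" using \<Lambda>_mono[of n "Suc n"] unfolding B_def by auto
    qed
  qed (use Bs in auto)
  have "c \<le> measure ?M (B v0 n)" for n
  proof -
    from reach[of n] obtain m where m: "m \<ge> n"
      "prb (edges_in (\<Lambda> m)) (p b) (\<lambda>\<omega>. v0 \<in> unreached (\<Lambda> m) (\<Lambda> n) \<omega>) \<le> 1 - c" by blast
    let ?E = "edges_in (\<Lambda> m)" and ?U = "\<lambda>\<omega>. v0 \<in> unreached (\<Lambda> m) (\<Lambda> n) \<omega>"
    have E: "finite ?E" "?E \<subseteq> edges" using finite_edges_in[OF \<Lambda>_finite] edges_in_subset_edges by auto
    have "1 - prb ?E (p b) ?U = measure ?M (space ?M - cyl b ?E ?U)"
      using measure_cyl[OF b E] cyl_sets[OF b E] by (simp add: prob_compl)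
    also have "\<dots> \<le> measure ?M (B v0 n)"
    proof (rule finite_measure_mono[OF _ Bs], rule subsetI)
      fix \<omega> assume "\<omega> \<in> space ?M - cyl b ?E ?U"
      then have w: "\<omega> \<in> space ?M" "\<not> ?U {e \<in> ?E. \<omega> e}" by (auto simp: cyl_def)
      then obtain d where "d \<in> \<Lambda> m - \<Lambda> n" "conn {e \<in> ?E. \<omega> e} v0 d"
        using v0 by (auto simp: unreached_def)
      with w(1) show "\<omega> \<in> B v0 n" unfolding B_def linked_iff by blast
    qed
    finally show ?thesis using m(2) by simp
  qed
  then have "c \<le> measure ?M (\<Inter>n. B v0 n)" by (intro LIMSEQ_le_const[OF lim] exI allI impI)
  also have "\<dots> \<le> measure ?M {\<omega> \<in> space ?M. \<exists>x. infinite (cluster \<omega> x)}"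
  proof (rule finite_measure_mono[OF _ sets], rule subsetI)
    fix \<omega> assume "\<omega> \<in> (\<Inter>n. B v0 n)"
    then have "\<omega> \<in> space ?M" "infinite (cluster \<omega> v0)" using inf[of v0] by auto
    then show "\<omega> \<in> {\<omega> \<in> space ?M. \<exists>x. infinite (cluster \<omega> x)}" by auto
  qed
  finally show ?thesis by (rule less_le_trans[OF c])
qed

end

section \<open>Susceptibility bounds\<close>

lemma tau_outside:
  assumes "x \<in> S" "y \<notin> S"
  shows "tau S p x y = 0"
proof -
  have "\<not> conn \<omega> x y" if "\<omega> \<subseteq> edges_in S" for \<omega>
    using conn_edges_in[OF _ that assms(1)] assms(2) by blast
  then have "tau S p x y = expect (edges_in S) p (\<lambda>_. 0)"
    unfolding tau_def prb_def by (intro expect_cong) simp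
  then show ?thesis by (simp add: expect_def)
qed

lemma sum_tau_subset:
  assumes "finite V" "S \<subseteq> V" "x \<in> S"
  shows "(\<Sum>y\<in>V. tau S p x y * g y) = (\<Sum>y\<in>S. tau S p x y * g y)"
  using assms by (intro sum.mono_neutral_right) (auto simp: tau_outside)

text \<open>Simon--Lieb is summed against the submultiplicative weight \<open>g\<close> at the
  vertex where the weighted sum is largest. With \<open>G\<close> that maximum this reads G \<le> m
  + G / 2; finiteness of \<open>V\<close> allows the last term to be absorbed.\<close>

lemma weighted_susceptibility_bound:
  assumes fin: "finite V" and pr: "probs (edges_in V) p"
    and g: "\<And>x y. 0 \<le> g x y" "\<And>x y z. g x z \<le> g x y * g y z"
    and S: "\<And>x. x \<in> V \<Longrightarrow> \<exists>S\<subseteq>V. x \<in> S \<and> (\<Sum>y\<in>S. tau S p x y * g x y) \<le> m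
      \<and> (\<Sum>a\<in>S. \<Sum>b\<in>V - S. tau S p x a * p {a, b} * g x b) \<le> 1 / 2"
    and x: "x \<in> V"
  shows "(\<Sum>y\<in>V. tau V p x y * g x y) \<le> 2 * m"
proof -
  define F where "F x = (\<Sum>y\<in>V. tau V p x y * g x y)" for x
  define G where "G = Max (F ` V)"
  have FG: "F z \<le> G" if "z \<in> V" for z
    unfolding G_def using fin that by (intro Max_ge) auto
  have "G \<in> F ` V" unfolding G_def using fin x by (intro Max_in) auto
  then obtain z where z: "z \<in> V" "G = F z" by blast
  have t0: "0 \<le> tau V p u v" for u v by (rule tau_nonneg[OF pr])
  have G0: "0 \<le> G" unfolding z(2) F_def by (intro sum_nonneg mult_nonneg_nonneg t0 g)
  obtain S where S: "S \<subseteq> V" "z \<in> S" "(\<Sum>y\<in>S. tau S p z y * g z y) \<le> m"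
    "(\<Sum>a\<in>S. \<Sum>b\<in>V - S. tau S p z a * p {a, b} * g z b) \<le> 1 / 2"
    using S[OF z(1)] by blast
  have prS: "probs (edges_in S) p" by (rule probs_subset[OF pr edges_in_mono[OF S(1)]])
  have p0: "0 \<le> p {a, b}" if "a \<in> S" "b \<in> V - S" for a b
  proof -
    have "{a, b} \<in> edges_in V" using that S(1) by (subst edges_in_iff) auto
    then show ?thesis using pr by (simp add: probs_def)
  qed
  have "F z \<le> (\<Sum>y\<in>V. (tau S p z y + (\<Sum>a\<in>S. \<Sum>b\<in>V - S. tau S p z a * p {a, b} * tau V p b y)) * g z y)"
    unfolding F_def by (intro sum_mono mult_right_mono simon_lieb pr fin S g)
  also have "\<dots> = (\<Sum>y\<in>V. tau S p z y * g z y) +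
      (\<Sum>y\<in>V. \<Sum>a\<in>S. \<Sum>b\<in>V - S. tau S p z a * p {a, b} * tau V p b y * g z y)"
    by (simp add: distrib_right sum.distrib sum_distrib_right)
  also have "(\<Sum>y\<in>V. \<Sum>a\<in>S. \<Sum>b\<in>V - S. tau S p z a * p {a, b} * tau V p b y * g z y)
     = (\<Sum>a\<in>S. \<Sum>y\<in>V. \<Sum>b\<in>V - S. tau S p z a * p {a, b} * tau V p b y * g z y)"
    by (rule sum.swap)
  also have "\<dots> = (\<Sum>a\<in>S. \<Sum>b\<in>V - S. \<Sum>y\<in>V. tau S p z a * p {a, b} * tau V p b y * g z y)"
    by (rule sum.cong[OF refl], rule sum.swap)
  also have "\<dots> \<le> (\<Sum>a\<in>S. \<Sum>b\<in>V - S. tau S p z a * p {a, b} * g z b * G)"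
  proof (intro sum_mono)
    fix a b assume ab: "a \<in> S" "b \<in> V - S"
    have "(\<Sum>y\<in>V. tau S p z a * p {a, b} * tau V p b y * g z y)
      \<le> (\<Sum>y\<in>V. tau S p z a * p {a, b} * tau V p b y * (g z b * g b y))"
      using ab by (intro sum_mono mult_left_mono g mult_nonneg_nonneg t0 p0 tau_nonneg[OF prS])
    also have "\<dots> = tau S p z a * p {a, b} * g z b * F b"
      by (simp add: F_def sum_distrib_left mult_ac)
    also have "\<dots> \<le> tau S p z a * p {a, b} * g z b * G"
      using ab by (intro mult_left_mono FG mult_nonneg_nonneg g p0 tau_nonneg[OF prS]) auto
    finally show "(\<Sum>y\<in>V. tau S p z a * p {a, b} * tau V p b y * g z y) \<le> tau S p z a * p {a, b} * g z b * G" .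
  qed
  also have "\<dots> = (\<Sum>a\<in>S. \<Sum>b\<in>V - S. tau S p z a * p {a, b} * g z b) * G"
    by (simp add: sum_distrib_right)
  also have "\<dots> \<le> 1 / 2 * G" by (intro mult_right_mono S G0)
  also have "(\<Sum>y\<in>V. tau S p z y * g z y) \<le> m"
    using S sum_tau_subset[OF fin S(1,2)] by simp
  finally have "G \<le> m + 1 / 2 * G" using z by simp
  with FG[OF x] show ?thesis by (simp add: F_def)
qed

section \<open>Translations and growth from many disjoint blocks\<close>

lemma conn_image:
  assumes "inj f"
  shows "conn ((`) f ` W) (f x) (f y) \<longleftrightarrow> conn W x y"
proof
  assume "conn W x y"
  then show "conn ((`) f ` W) (f x) (f y)"
  proof (induction rule: conn_induct)
    case (step u v)
    then have "{f u, f v} \<in> (`) f ` W" by (metis image_empty image_eqI image_insert)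
    from conn_trans[OF step.IH conn_edge[OF this]] show ?case .
  qed simp
next
  assume "conn ((`) f ` W) (f x) (f y)"
  then have "\<exists>z. f y = f z \<and> conn W x z"
  proof (induction rule: conn_induct)
    case (step u v)
    then obtain z where z: "u = f z" "conn W x z" by blast
    from step.hyps(3) obtain e where e: "e \<in> W" "{u, v} = f ` e" by blast
    then obtain v' where v': "v = f v'" by blast
    have "f ` e = f ` {z, v'}" using e z v' by simp
    then have "e = {z, v'}" using assms by (simp only: inj_image_eq_iff)
    with e have "{z, v'} \<in> W" by simp
    from conn_trans[OF z(2) conn_edge[OF this]] v' show ?case by blast
  qed auto
  with assms show "conn W x y" by (auto dest: injD)
qed

lemma edges_in_image:
  assumes "inj f"
  shows "edges_in (f ` V) = (`) f ` edges_in V"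
proof (intro equalityI subsetI)
  fix e assume "e \<in> edges_in (f ` V)"
  then obtain x y where "x \<in> V" "y \<in> V" "f x \<noteq> f y" "e = f ` {x, y}" by (auto simp: edges_in_def)
  moreover from this have "{x, y} \<in> edges_in V" by (subst edges_in_iff) auto
  ultimately show "e \<in> (`) f ` edges_in V" by blast
next
  fix e assume "e \<in> (`) f ` edges_in V"
  then obtain x y where xy: "x \<in> V" "y \<in> V" "x \<noteq> y" "e = {f x, f y}" by (auto simp: edges_in_def)
  then have "f x \<noteq> f y" using assms by (auto dest: injD)
  then show "e \<in> edges_in (f ` V)" using xy by (simp add: edges_in_iff)
qed

lemma tau_image:
  assumes f: "inj f" and V: "finite V" and p: "\<And>e. e \<in> edges_in V \<Longrightarrow> p (f ` e) = p e"
  shows "tau (f ` V) p (f x) (f y) = tau V p x y"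
proof -
  have "inj_on ((`) f) (edges_in V)" using f by (auto simp: inj_on_def inj_image_eq_iff)
  then have "tau (f ` V) p (f x) (f y) =
      expect (edges_in V) (\<lambda>e. p (f ` e)) (\<lambda>\<omega>. of_bool (conn ((`) f ` \<omega>) (f x) (f y)))"
    unfolding tau_def prb_def edges_in_image[OF f] by (intro expect_image finite_edges_in V)
  also have "\<dots> = tau V p x y"
    unfolding tau_def prb_def conn_image[OF f] by (rule expect_cong_prob) (rule p)
  finally show ?thesis .
qed

definition sum_tau :: "'v set \<Rightarrow> ('v set \<Rightarrow> real) \<Rightarrow> real" where
  "sum_tau V p = (\<Sum>x\<in>V. \<Sum>y\<in>V. tau V p x y)"

lemma sum_tau_blocks:
  assumes fin: "finite V" "finite I" and pr: "probs (edges_in V) p"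
    and B: "\<And>i. i \<in> I \<Longrightarrow> B i \<subseteq> V" "\<And>i j. i \<in> I \<Longrightarrow> j \<in> I \<Longrightarrow> i \<noteq> j \<Longrightarrow> B i \<inter> B j = {}"
  shows "(\<Sum>i\<in>I. \<Sum>j\<in>I - {i}. \<Sum>x\<in>B i. \<Sum>y\<in>B j. tau (B i \<union> B j) p x y) \<le> sum_tau V p"
proof -
  have t0: "0 \<le> tau V p u v" for u v by (rule tau_nonneg[OF pr])
  have finB: "finite (B i)" if "i \<in> I" for i using B(1)[OF that] fin finite_subset by blast
  have UB: "(\<Sum>i\<in>I'. \<Sum>x\<in>B i. f x) \<le> sum f V" if "I' \<subseteq> I" "\<And>x. 0 \<le> f x" for I' and f :: "'a \<Rightarrow> real"
  proof -
    have "(\<Sum>i\<in>I'. \<Sum>x\<in>B i. f x) = sum f (\<Union>i\<in>I'. B i)"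
      using that fin finB by (intro sum.UNION_disjoint[symmetric] ballI impI B(2)) (auto intro: finite_subset)
    also have "\<dots> \<le> sum f V" using that B fin by (intro sum_mono2) auto
    finally show ?thesis .
  qed
  have "(\<Sum>i\<in>I. \<Sum>j\<in>I - {i}. \<Sum>x\<in>B i. \<Sum>y\<in>B j. tau (B i \<union> B j) p x y)
    \<le> (\<Sum>i\<in>I. \<Sum>j\<in>I - {i}. \<Sum>x\<in>B i. \<Sum>y\<in>B j. tau V p x y)"
    using B(1) by (intro sum_mono tau_mono_set[OF pr]) auto
  also have "\<dots> = (\<Sum>i\<in>I. \<Sum>x\<in>B i. \<Sum>j\<in>I - {i}. \<Sum>y\<in>B j. tau V p x y)"
    by (rule sum.cong[OF refl], rule sum.swap)
  also have "\<dots> \<le> (\<Sum>i\<in>I. \<Sum>x\<in>B i. \<Sum>y\<in>V. tau V p x y)"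
    by (intro sum_mono UB t0) auto
  also have "\<dots> \<le> sum_tau V p"
    unfolding sum_tau_def by (intro UB sum_nonneg t0) auto
  finally show ?thesis .
qed

text \<open>Every block holds at least s / 2 connected pairs with probability at least 1 / 16. The
  condition t * s \<ge> 2 puts the two-block bound into its saturated regime, where the minimum is s
  / 2, so each ordered pair of blocks contributes (s / 2) / 2 / 16^2 = s / 1024.\<close>

lemma sum_tau_growth:
  assumes fin: "finite V" "finite I" and pr: "probs (edges_in V) p"
    and B: "\<And>i. i \<in> I \<Longrightarrow> B i \<subseteq> V" "\<And>i j. i \<in> I \<Longrightarrow> j \<in> I \<Longrightarrow> i \<noteq> j \<Longrightarrow> B i \<inter> B j = {}"
    and s: "\<And>i. i \<in> I \<Longrightarrow> sum_tau (B i) p = s" "0 \<le> s"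
    and t: "0 \<le> t" "\<And>a b. a \<in> V \<Longrightarrow> b \<in> V \<Longrightarrow> a \<noteq> b \<Longrightarrow> 1 - p {a, b} \<le> exp (- t)" "2 \<le> t * s"
  shows "real (card I * (card I - 1)) / 1024 * s \<le> sum_tau V p"
proof -
  have "real (card I * (card I - 1)) / 1024 * s = (\<Sum>i\<in>I. \<Sum>j\<in>I - {i}. s / 1024)"
    using fin by (simp add: of_nat_diff)
  also have "\<dots> \<le> (\<Sum>i\<in>I. \<Sum>j\<in>I - {i}. \<Sum>x\<in>B i. \<Sum>y\<in>B j. tau (B i \<union> B j) p x y)"
  proof (intro sum_mono)
    fix i j assume ij: "i \<in> I" "j \<in> I - {i}"
    let ?T = "s / 2"
    have BV: "B i \<subseteq> V" "B j \<subseteq> V" "B i \<inter> B j = {}" using B(1) B(2)[of i j] ij by auto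
    have finB: "finite (B i)" "finite (B j)" using BV fin by (auto intro: finite_subset)
    have half: "1 / 16 \<le> prb (edges_in (B l)) p (\<lambda>\<omega>. ?T \<le> npairs (B l) \<omega>)" if "l \<in> I" for l
      using npairs_lower_tail[OF probs_subset[OF pr edges_in_mono[OF B(1)[OF that]]]] s(1)[OF that]
      by (simp add: expect_npairs sum_tau_def)
    have "1 * ?T \<le> (t * ?T) * ?T" using t s(2) by (intro mult_right_mono) auto
    then have "min ?T (t * ?T\<^sup>2) = ?T" by (simp add: power2_eq_square)
    then have "s / 1024 = min ?T (t * ?T\<^sup>2) / 2 * (1 / 16 * (1 / 16))" by simp
    also have "\<dots> \<le> min ?T (t * ?T\<^sup>2) / 2 * (prb (edges_in (B i)) p (\<lambda>\<omega>. ?T \<le> npairs (B i) \<omega>)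
      * prb (edges_in (B j)) p (\<lambda>\<omega>. ?T \<le> npairs (B j) \<omega>))"
      using half[of i] half[of j] ij t(1) s(2)
      by (intro mult_left_mono mult_mono order_trans[OF _ half[of i]]) auto
    also have "\<dots> \<le> (\<Sum>x\<in>B i. \<Sum>y\<in>B j. tau (B i \<union> B j) p x y)"
    proof (rule sum_tau_two_blocks[OF probs_subset[OF pr edges_in_mono] finB BV(3) t(1)])
      fix a b assume "a \<in> B i" "b \<in> B j"
      then show "1 - p {a, b} \<le> exp (- t)" using BV by (intro t(2)) auto
    qed (use BV s(2) in auto)
    finally show "s / 1024 \<le> \<dots>" .
  qed
  also have "\<dots> \<le> sum_tau V p" by (rule sum_tau_blocks[OF fin pr B])
  finally show ?thesis .
qed

context exhausted_kernel
begin

text \<open>If every finite set around v0 had boundary sum at least \<open>\<kappa>\<close> at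
  \<open>\<beta>\<close>, then at \<open>\<beta>'\<close> v0 would leave every
  \<open>\<Lambda> n\<close> with probability at least 1 - exp (- (\<beta>' - \<beta>) \<kappa>),
  forcing percolation. Quantifying over finite \<open>V\<close> replaces the infinite sum over the
  complement of \<open>S\<close>.\<close>

lemma finite_boundary_sum:
  assumes b: "0 \<le> \<beta>" "\<beta> < \<beta>'" and v0: "\<And>n. v0 \<in> \<Lambda> n" and \<kappa>: "0 < \<kappa>"
    and np: "\<not> 0 < measure (percolation K \<beta>') {\<omega> \<in> space (percolation K \<beta>'). \<exists>x. infinite (cluster \<omega> x)}"
  shows "\<exists>S. finite S \<and> v0 \<in> S \<and>
    (\<forall>V. finite V \<longrightarrow> (\<Sum>a\<in>S. \<Sum>d\<in>V - S. K a d * tau S (p \<beta>) v0 a) < \<kappa>)"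
proof (rule ccontr)
  assume "\<not> ?thesis"
  then have *: "\<exists>V. finite V \<and> \<kappa> \<le> (\<Sum>a\<in>S. \<Sum>d\<in>V - S. K a d * tau S (p \<beta>) v0 a)"
    if "finite S" "v0 \<in> S" for S using that by (meson not_less)
  define c where "c = 1 - exp (- (\<beta>' - \<beta>) * \<kappa>)"
  have "0 < (\<beta>' - \<beta>) * \<kappa>" using b \<kappa> by simp
  then have c: "0 < c" unfolding c_def by (simp add: left_diff_distrib)
  have "0 < measure (percolation K \<beta>') {\<omega> \<in> space (percolation K \<beta>'). \<exists>x. infinite (cluster \<omega> x)}"
  proof (rule percolates[OF _ c _ v0])
    fix n
    \<comment> \<open>The set witnessing a large boundary sum depends on \<open>S\<close>; there are
      finitely many \<open>S\<close> inside \<open>\<Lambda> n\<close>, so a single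
      \<open>\<Lambda> m\<close> contains all the witnesses.\<close>
    have "\<forall>S\<in>Pow (\<Lambda> n). \<exists>V. finite V \<and> (v0 \<in> S \<longrightarrow> \<kappa> \<le> (\<Sum>a\<in>S. \<Sum>d\<in>V - S. K a d * tau S (p \<beta>) v0 a))"
    proof
      fix S assume "S \<in> Pow (\<Lambda> n)"
      then have "finite S" using finite_subset[OF _ \<Lambda>_finite] by simp
      then show "\<exists>V. finite V \<and> (v0 \<in> S \<longrightarrow> \<kappa> \<le> (\<Sum>a\<in>S. \<Sum>d\<in>V - S. K a d * tau S (p \<beta>) v0 a))"
        using *[of S] by (cases "v0 \<in> S") auto
    qed
    from bchoice[OF this] obtain V where V: "\<And>S. S \<subseteq> \<Lambda> n \<Longrightarrow> finite (V S)"
      "\<And>S. S \<subseteq> \<Lambda> n \<Longrightarrow> v0 \<in> S \<Longrightarrow> \<kappa> \<le> (\<Sum>a\<in>S. \<Sum>d\<in>V S - S. K a d * tau S (p \<beta>) v0 a)"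
      by auto
    have "finite (\<Lambda> n \<union> (\<Union>S\<in>Pow (\<Lambda> n). V S))" using V(1) \<Lambda>_finite by auto
    then obtain m0 where m0: "\<Lambda> n \<union> (\<Union>S\<in>Pow (\<Lambda> n). V S) \<subseteq> \<Lambda> m0" using finite_subset_\<Lambda> by blast
    define m where "m = max m0 n"
    have m0m: "\<Lambda> m0 \<subseteq> \<Lambda> m" by (rule \<Lambda>_mono) (simp add: m_def)
    have m: "\<Lambda> n \<subseteq> \<Lambda> m" "n \<le> m" using m0 m0m by (auto simp: m_def)
    have VS: "V S \<subseteq> \<Lambda> m" if "S \<subseteq> \<Lambda> n" for S using m0 m0m that by blast
    have "prb (edges_in (\<Lambda> m)) (p \<beta>') (\<lambda>\<omega>. v0 \<in> unreached (\<Lambda> m) (\<Lambda> n) \<omega>) \<le> exp (- (\<beta>' - \<beta>) * \<kappa>)"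
    proof (rule unreached_exponential_bound[where \<beta> = \<beta>])
      fix S assume S: "S \<subseteq> \<Lambda> n" "v0 \<in> S"
      have pr: "probs (edges_in S) (p \<beta>)" using finite_subset[OF S(1) \<Lambda>_finite] b by (intro probs_p) auto
      have "\<kappa> \<le> (\<Sum>a\<in>S. \<Sum>d\<in>V S - S. K a d * tau S (p \<beta>) v0 a)" by (rule V(2)[OF S])
      also have "\<dots> \<le> (\<Sum>a\<in>S. \<Sum>d\<in>\<Lambda> m - S. K a d * tau S (p \<beta>) v0 a)"
        using VS[OF S(1)] by (intro sum_mono sum_mono2 mult_nonneg_nonneg K_nonneg tau_nonneg[OF pr])
          (auto intro: finite_Diff \<Lambda>_finite)
      finally show "\<kappa> \<le> (\<Sum>a\<in>S. \<Sum>d\<in>\<Lambda> m - S. w {a, d} * tau S (p \<beta>) v0 a)"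
        by (simp add: w_pair)
    qed (use b m(1) v0 w_nonneg \<Lambda>_finite in auto)
    then show "\<exists>m\<ge>n. prb (edges_in (\<Lambda> m)) (p \<beta>') (\<lambda>\<omega>. v0 \<in> unreached (\<Lambda> m) (\<Lambda> n) \<omega>) \<le> 1 - c"
      using m(2) by (intro exI[of _ m]) (simp add: c_def)
  qed (use b in simp)
  with np show False by (rule notE)
qed

end

section \<open>The lattice\<close>

lemma card_vec_box:
  fixes A :: "'a set"
  assumes "finite A"
  shows "finite {x :: 'a ^ 'd. \<forall>i. x $ i \<in> A}" "card {x :: 'a ^ 'd. \<forall>i. x $ i \<in> A} = card A ^ CARD('d)"
proof -
  have eq: "{x :: 'a ^ 'd. \<forall>i. x $ i \<in> A} = vec_lambda ` (UNIV \<rightarrow>\<^sub>E A)"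
  proof (intro equalityI subsetI)
    fix x :: "'a ^ 'd" assume "x \<in> {x. \<forall>i. x $ i \<in> A}"
    then show "x \<in> vec_lambda ` (UNIV \<rightarrow>\<^sub>E A)"
      by (intro image_eqI[of _ _ "vec_nth x"]) auto
  qed auto
  have inj: "inj_on (vec_lambda :: ('d \<Rightarrow> 'a) \<Rightarrow> 'a ^ 'd) (UNIV \<rightarrow>\<^sub>E A)"
    by (rule inj_onI) (metis vec_lambda_beta ext)
  have fin: "finite ((UNIV :: 'd set) \<rightarrow>\<^sub>E A)" using assms by (intro finite_PiE) auto
  show "finite {x :: 'a ^ 'd. \<forall>i. x $ i \<in> A}" unfolding eq using fin by simp
  show "card {x :: 'a ^ 'd. \<forall>i. x $ i \<in> A} = card A ^ CARD('d)"
    unfolding eq card_image[OF inj] by (simp add: card_PiE)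
qed

text \<open>The sup norm as a natural number, so that cubes and shells are indexed by integers; any
  other norm is comparable to it.\<close>

definition supn :: "int ^ 'd \<Rightarrow> nat" where
  "supn x = Max (range (\<lambda>i. nat \<bar>x $ i\<bar>))"

lemma supn_le_iff: "supn x \<le> n \<longleftrightarrow> (\<forall>i. \<bar>x $ i\<bar> \<le> int n)"
  unfolding supn_def by (subst Max_le_iff) (auto simp: nat_le_iff)

lemma supn_ge: "\<bar>x $ i\<bar> \<le> int (supn x)"
  using supn_le_iff[of x "supn x"] by simp

lemma supn_0 [simp]: "supn 0 = 0"
  using supn_le_iff[of 0 0] by simp

lemma supn_pos: "x \<noteq> 0 \<Longrightarrow> 1 \<le> supn x"
proof (rule ccontr)
  assume "x \<noteq> 0" "\<not> 1 \<le> supn x"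
  then have "\<forall>i. x $ i = 0" using supn_le_iff[of x 0] by simp
  with \<open>x \<noteq> 0\<close> show False by (simp add: vec_eq_iff)
qed

lemma supn_triangle: "supn (x + y) \<le> supn x + supn y"
  unfolding supn_le_iff
proof
  fix i
  show "\<bar>(x + y) $ i\<bar> \<le> int (supn x + supn y)"
    using supn_ge[of x i] supn_ge[of y i] by simp
qed

text \<open>Half-open boxes of side \<open>N\<close>, whose translates by multiples of
  \<open>N\<close> tile a box of side k N exactly. The centred \<open>cube\<close> serves the
  estimates around the origin.\<close>

definition corner_box :: "nat \<Rightarrow> (int ^ 'd) set" where
  "corner_box N = {x. \<forall>i. x $ i \<in> {0..<int N}}"

definition cube :: "nat \<Rightarrow> (int ^ 'd) set" where
  "cube n = {x. supn x \<le> n}"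

lemma cube_alt: "cube n = {x. \<forall>i. x $ i \<in> {- int n..int n}}"
  by (auto simp: cube_def supn_le_iff abs_le_iff minus_le_iff)

lemma finite_box [simp]: "finite (corner_box N :: (int ^ 'd) set)"
  and card_box: "card (corner_box N :: (int ^ 'd) set) = N ^ CARD('d)"
  unfolding corner_box_def using card_vec_box[of "{0..<int N}"] by simp_all

lemma finite_cube [simp]: "finite (cube n :: (int ^ 'd) set)"
  and card_cube: "card (cube n :: (int ^ 'd) set) = (2 * n + 1) ^ CARD('d)"
proof -
  have "card {- int n..int n} = 2 * n + 1" by simp
  with card_vec_box[of "{- int n..int n}"]
  show "finite (cube n :: (int ^ 'd) set)" "card (cube n :: (int ^ 'd) set) = (2 * n + 1) ^ CARD('d)"
    unfolding cube_alt by simp_all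
qed

lemma cube_mono: "n \<le> m \<Longrightarrow> cube n \<subseteq> cube m"
  by (auto simp: cube_def)

lemma zero_in_cube [simp]: "0 \<in> cube n"
  by (simp add: cube_def)

locale lattice_kernel = symmetric_kernel K for K :: "int ^ 'd \<Rightarrow> int ^ 'd \<Rightarrow> real" +
  assumes K_shift: "K (z + x) (z + y) = K x y"
begin

sublocale exhausted_kernel K cube
proof unfold_locales
  show "\<exists>n. x \<in> cube n" for x :: "int ^ 'd" by (auto simp: cube_def)
qed (use cube_mono in auto)

lemma tau_shift:
  assumes "finite V"
  shows "tau ((+) z ` V) (p b) (z + x) (z + y) = tau V (p b) x y"
proof (rule tau_image[OF _ assms])
  fix e assume "e \<in> edges_in V"
  then obtain x y where "e = {x, y}" by (auto simp: edges_in_def)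
  then show "p b ((+) z ` e) = p b e" by (simp add: p_pair K_shift)
qed simp

lemma sum_tau_shift: "finite V \<Longrightarrow> sum_tau ((+) z ` V) (p b) = sum_tau V (p b)"
  unfolding sum_tau_def by (simp add: sum.reindex tau_shift)

text \<open>By translation one good set at the origin yields a good set around every x. Near the
  boundary of \<open>V\<close> the translate is cut down to \<open>V\<close>, which leaves its
  complement in \<open>V\<close> unchanged and only lowers the two-point functions.\<close>

lemma local_to_global:
  fixes h :: "int ^ 'd \<Rightarrow> real"
  assumes b: "0 \<le> b" and S: "finite S" "0 \<in> S"
    and h: "\<And>u. 0 \<le> h u" "\<And>u v. h (u + v) \<le> h u * h v"
    and m: "(\<Sum>y\<in>S. tau S (p b) 0 y * h y) \<le> m"
    and half: "\<And>V. finite V \<Longrightarrow> (\<Sum>a\<in>S. \<Sum>d\<in>V - S. tau S (p b) 0 a * p b {a, d} * h d) \<le> 1 / 2"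
    and V: "finite V" "x \<in> V"
  shows "(\<Sum>y\<in>V. tau V (p b) x y * h (y - x)) \<le> 2 * m"
proof (rule weighted_susceptibility_bound[OF V(1) probs_p[OF V(1) b] _ _ _ V(2)])
  fix x y z :: "int ^ 'd"
  show "0 \<le> h (y - x)" by (rule h)
  show "h (z - x) \<le> h (y - x) * h (z - y)" using h(2)[of "y - x" "z - y"] by simp
next
  fix x assume x: "x \<in> V"
  let ?S = "(+) x ` S"
  let ?T = "?S \<inter> V"
  have pr: "probs (edges_in ?S) (p b)" using S b by (intro probs_p) auto
  have t0: "0 \<le> tau ?S (p b) u v" for u v by (rule tau_nonneg[OF pr])
  have le: "tau ?T (p b) u v \<le> tau ?S (p b) u v" for u v by (rule tau_mono_set[OF pr]) auto
  have p0: "0 \<le> p b {u, v}" for u v using K_nonneg[of u v] b by (simp add: p_pair)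
  have "(\<Sum>y\<in>?T. tau ?T (p b) x y * h (y - x)) \<le> (\<Sum>y\<in>?T. tau ?S (p b) x y * h (y - x))"
    by (intro sum_mono mult_right_mono le h)
  also have "\<dots> \<le> (\<Sum>y\<in>?S. tau ?S (p b) x y * h (y - x))"
    using S by (intro sum_mono2 mult_nonneg_nonneg t0 h) auto
  also have "\<dots> = (\<Sum>y\<in>S. tau S (p b) 0 y * h y)"
    using tau_shift[OF S(1), of x b 0] by (simp add: sum.reindex)
  finally have 1: "(\<Sum>y\<in>?T. tau ?T (p b) x y * h (y - x)) \<le> m" using m by linarith
  have VT: "V - ?T = V - ?S" by auto
  define W where "W = (+) (- x) ` V"
  have W: "finite W" "V - ?S = (+) x ` (W - S)"
  proof -
    show "finite W" using V by (simp add: W_def)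
    show "V - ?S = (+) x ` (W - S)"
    proof (intro equalityI subsetI)
      fix y assume y: "y \<in> V - ?S"
      then have "- x + y \<in> W - S" by (force simp: W_def image_iff)
      then show "y \<in> (+) x ` (W - S)" by (rule rev_image_eqI) simp
    qed (auto simp: W_def)
  qed
  have "(\<Sum>a\<in>?T. \<Sum>d\<in>V - ?T. tau ?T (p b) x a * p b {a, d} * h (d - x))
     \<le> (\<Sum>a\<in>?T. \<Sum>d\<in>V - ?S. tau ?S (p b) x a * p b {a, d} * h (d - x))"
    unfolding VT by (intro sum_mono mult_right_mono le h p0)
  also have "\<dots> \<le> (\<Sum>a\<in>?S. \<Sum>d\<in>V - ?S. tau ?S (p b) x a * p b {a, d} * h (d - x))"
    using S by (intro sum_mono2 sum_nonneg mult_nonneg_nonneg t0 h p0) auto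
  also have "\<dots> = (\<Sum>a\<in>S. \<Sum>d\<in>W - S. tau S (p b) 0 a * p b {a, d} * h d)"
    unfolding W(2) using tau_shift[OF S(1), of x b 0] by (simp add: sum.reindex p_pair K_shift)
  also have "\<dots> \<le> 1 / 2" by (rule half[OF W(1)])
  finally have 2: "(\<Sum>a\<in>?T. \<Sum>d\<in>V - ?T. tau ?T (p b) x a * p b {a, d} * h (d - x)) \<le> 1 / 2" .
  have "x \<in> ?T" using x S(2) by (auto intro!: image_eqI[of _ _ 0])
  with 1 2 show "\<exists>S\<subseteq>V. x \<in> S \<and> (\<Sum>y\<in>S. tau S (p b) x y * h (y - x)) \<le> m \<and>
    (\<Sum>a\<in>S. \<Sum>d\<in>V - S. tau S (p b) x a * p b {a, d} * h (d - x)) \<le> 1 / 2"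
    by (intro exI[of _ ?T] conjI) auto
qed

lemma susceptibility_finite:
  assumes b: "0 \<le> \<beta>" "\<beta> < \<beta>'"
    and np: "\<not> 0 < measure (percolation K \<beta>') {\<omega> \<in> space (percolation K \<beta>'). \<exists>x. infinite (cluster \<omega> x)}"
  shows "\<exists>X. \<forall>V x. finite V \<longrightarrow> x \<in> V \<longrightarrow> (\<Sum>y\<in>V. tau V (p \<beta>) x y) \<le> X"
proof -
  \<comment> \<open>Since the edge probability is at most \<open>\<beta>\<close> times the kernel, a
    boundary sum below 1 / (2 (\<beta> + 1)) gives the needed 1 / 2; the added 1 keeps the threshold
    meaningful at \<beta> = 0.\<close>
  obtain S where S: "finite S" "0 \<in> S"
    and half: "\<And>V. finite V \<Longrightarrow> (\<Sum>a\<in>S. \<Sum>d\<in>V - S. K a d * tau S (p \<beta>) 0 a) < 1 / (2 * (\<beta> + 1))"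
    using finite_boundary_sum[OF b zero_in_cube _ np, of "1 / (2 * (\<beta> + 1))"] b by auto
  have pr: "probs (edges_in S) (p \<beta>)" using S b by (intro probs_p)
  have "(\<Sum>y\<in>V. tau V (p \<beta>) x y * 1) \<le> 2 * (\<Sum>y\<in>S. tau S (p \<beta>) 0 y * 1)" if V: "finite V" "x \<in> V" for V x
  proof (rule local_to_global[where h = "\<lambda>_. 1", OF b(1) S _ _ order_refl _ V])
    fix V :: "(int ^ 'd) set" assume V: "finite V"
    have "(\<Sum>a\<in>S. \<Sum>d\<in>V - S. tau S (p \<beta>) 0 a * p \<beta> {a, d} * 1)
      \<le> (\<Sum>a\<in>S. \<Sum>d\<in>V - S. \<beta> * (K a d * tau S (p \<beta>) 0 a))"
    proof (intro sum_mono)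
      fix a d
      have "tau S (p \<beta>) 0 a * p \<beta> {a, d} \<le> tau S (p \<beta>) 0 a * (\<beta> * w {a, d})"
        by (intro mult_left_mono edge_prob_le tau_nonneg[OF pr])
      then show "tau S (p \<beta>) 0 a * p \<beta> {a, d} * 1 \<le> \<beta> * (K a d * tau S (p \<beta>) 0 a)"
        by (simp add: w_pair mult_ac)
    qed
    also have "\<dots> = \<beta> * (\<Sum>a\<in>S. \<Sum>d\<in>V - S. K a d * tau S (p \<beta>) 0 a)"
      by (simp add: sum_distrib_left)
    also have "\<dots> \<le> \<beta> * (1 / (2 * (\<beta> + 1)))"
      using half[OF V] b by (intro mult_left_mono) auto
    also have "\<dots> \<le> 1 / 2" using b by (simp add: field_simps)
    finally show "(\<Sum>a\<in>S. \<Sum>d\<in>V - S. tau S (p \<beta>) 0 a * p \<beta> {a, d} * 1) \<le> 1 / 2" .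
  qed auto
  then show ?thesis by auto
qed

text \<open>The big box is tiled by k^d translates of the small one, and any two of its points are
  at sup distance at most k N. This fixes the strength \<open>t\<close> of every edge between
  blocks; \<open>k\<close> is large enough for k^d (k^d - 1) / 1024 to exceed k^\<gamma>.\<close>

lemma sum_tau_box_step:
  fixes \<gamma> cl :: real
  assumes b: "0 < b" and cl: "0 < cl" and \<gamma>: "0 < \<gamma>"
    and lower: "\<And>x y. x \<noteq> y \<Longrightarrow> cl * real (supn (x - y)) powr (- \<gamma>) \<le> K x y"
    and k: "1024 * real k powr \<gamma> \<le> real k ^ CARD('d) * (real k ^ CARD('d) - 1)" "1 \<le> k" and N: "1 \<le> N"
    and large: "2 \<le> b * cl * real (k * N) powr (- \<gamma>) * sum_tau (corner_box N) (p b)"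
  shows "real k powr \<gamma> * sum_tau (corner_box N) (p b) \<le> sum_tau (corner_box (k * N)) (p b)"
proof -
  define B where "B i = (+) (\<chi> j. int N * i $ j) ` (corner_box N :: (int ^ 'd) set)" for i :: "int ^ 'd"
  let ?I = "corner_box k :: (int ^ 'd) set" and ?V = "corner_box (k * N) :: (int ^ 'd) set"
  define t where "t = b * cl * real (k * N) powr (- \<gamma>)"
  have pr: "probs (edges_in A) (p b)" if "finite A" for A using that b by (intro probs_p) auto
  have s0: "0 \<le> sum_tau (corner_box N) (p b)"
    unfolding sum_tau_def by (intro sum_nonneg tau_nonneg pr) auto
  have "real (card ?I * (card ?I - 1)) / 1024 * sum_tau (corner_box N) (p b) \<le> sum_tau ?V (p b)"
  proof (rule sum_tau_growth[OF finite_box finite_box pr[OF finite_box], where B = B and t = t])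
    fix i assume i: "i \<in> ?I"
    show "B i \<subseteq> ?V"
    proof
      fix x assume "x \<in> B i"
      then obtain y where y: "y \<in> corner_box N" "x = (\<chi> j. int N * i $ j) + y" by (auto simp: B_def)
      show "x \<in> ?V"
        unfolding corner_box_def
      proof (intro CollectI allI)
        fix j
        have yj: "0 \<le> y $ j" "y $ j < int N" and ij: "0 \<le> i $ j" "i $ j + 1 \<le> int k"
          using y(1) i by (simp_all add: corner_box_def add1_zle_eq)
        have "int N * i $ j + int N \<le> int N * int k"
          using mult_left_mono[OF ij(2), of "int N"] by (simp add: algebra_simps)
        then show "x $ j \<in> {0..<int (k * N)}" using yj ij by (simp add: y(2) mult.commute)
      qed
    qed
    show "sum_tau (B i) (p b) = sum_tau (corner_box N) (p b)"
      unfolding B_def by (rule sum_tau_shift) simp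
  next
    fix i j assume ij: "i \<in> ?I" "j \<in> ?I" "i \<noteq> j"
    show "B i \<inter> B j = {}"
    proof (rule ccontr)
      assume "B i \<inter> B j \<noteq> {}"
      then obtain y z where yz: "y \<in> corner_box N" "z \<in> corner_box N"
        "(\<chi> l. int N * i $ l) + y = (\<chi> l. int N * j $ l) + z" unfolding B_def by auto
      have "i $ l = j $ l" for l
      proof -
        have e: "int N * i $ l + y $ l = int N * j $ l + z $ l"
          using arg_cong[OF yz(3), of "\<lambda>v. v $ l"] by simp
        \<comment> \<open>Integer division by \<open>N\<close> recovers the block index from a point
          of the block.\<close>
        have "i $ l = (int N * i $ l + y $ l) div int N" using yz(1) N by (simp add: corner_box_def)
        also have "\<dots> = j $ l" unfolding e using yz(2) N by (simp add: corner_box_def)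
        finally show ?thesis .
      qed
      with ij(3) show False by (simp add: vec_eq_iff)
    qed
  next
    show "0 \<le> t" using b cl by (simp add: t_def)
    fix x y assume xy: "x \<in> ?V" "y \<in> ?V" "x \<noteq> y"
    have sup: "1 \<le> supn (x - y)" using xy(3) by (intro supn_pos) auto
    have "supn (x - y) \<le> k * N"
      unfolding supn_le_iff
    proof
      fix i show "\<bar>(x - y) $ i\<bar> \<le> int (k * N)"
        using xy(1,2)[unfolded corner_box_def mem_Collect_eq, rule_format, of i] by auto
    qed
    then have "real (k * N) powr (- \<gamma>) \<le> real (supn (x - y)) powr (- \<gamma>)"
      using sup \<gamma> by (intro powr_mono2') (auto simp del: of_nat_mult)
    then have "cl * real (k * N) powr (- \<gamma>) \<le> K x y"
      using cl by (intro order_trans[OF mult_left_mono lower[OF xy(3)]]) auto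
    then have "t \<le> b * K x y" using b by (simp add: t_def mult.assoc)
    then show "1 - p b {x, y} \<le> exp (- t)" by (simp add: p_pair)
  qed (use large s0 in \<open>auto simp: t_def\<close>)
  moreover have "real k powr \<gamma> \<le> real (card ?I * (card ?I - 1)) / 1024"
  proof -
    have "1 \<le> k ^ CARD('d)" using k(2) by simp
    then show ?thesis using k(1) by (simp add: card_box of_nat_diff)
  qed
  ultimately show ?thesis using order_trans[OF mult_right_mono] s0 by blast
qed

text \<open>The bound fails only if the hypothesis \<open>large\<close> of the growth step holds at
  side \<open>N\<close>. That hypothesis then reproduces itself at all sides k^n N, because growth
  by k^\<gamma> exactly compensates the decay of the kernel. So the sum grows like the side to the
  power \<gamma> > d, whereas finite susceptibility allows only a multiple of the volume. The value
  of \<open>X\<close> does not enter the bound.\<close>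

lemma sum_tau_box_bound:
  fixes \<gamma> cl :: real
  assumes b: "0 < b" and cl: "0 < cl" and \<gamma>: "real CARD('d) < \<gamma>"
    and lower: "\<And>x y. x \<noteq> y \<Longrightarrow> cl * real (supn (x - y)) powr (- \<gamma>) \<le> K x y"
    and k: "1024 * real k powr \<gamma> \<le> real k ^ CARD('d) * (real k ^ CARD('d) - 1)" "2 \<le> k" and N: "1 \<le> N"
    and X: "\<And>V x. finite V \<Longrightarrow> x \<in> V \<Longrightarrow> (\<Sum>y\<in>V. tau V (p b) x y) \<le> X"
  shows "sum_tau (corner_box N) (p b) \<le> 2 / (b * cl) * real (k * N) powr \<gamma>"
proof (rule ccontr)
  assume "\<not> ?thesis"
  define U where "U N = sum_tau (corner_box N) (p b)" for N
  let ?d = "CARD('d)"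
  from \<open>\<not> ?thesis\<close> have U: "2 / (b * cl) * real (k * N) powr \<gamma> < U N" by (simp add: U_def)
  have kN: "0 < real (k * N)" using k N by simp
  have \<gamma>0: "0 < \<gamma>" by (rule le_less_trans[OF of_nat_0_le_iff \<gamma>])
  have large0: "2 \<le> b * cl * real (k * N) powr (- \<gamma>) * U N"
  proof -
    have "2 = b * cl * real (k * N) powr (- \<gamma>) * (2 / (b * cl) * real (k * N) powr \<gamma>)"
    proof -
      have "real (k * N) powr (- \<gamma>) * real (k * N) powr \<gamma> = 1"
        using kN by (simp flip: powr_add del: of_nat_mult)
      then show ?thesis using b cl by (simp add: field_simps del: of_nat_mult)
    qed
    also have "\<dots> \<le> b * cl * real (k * N) powr (- \<gamma>) * U N"
      using U b cl by (intro mult_left_mono) auto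
    finally show ?thesis .
  qed
  have "0 < 2 / (b * cl) * real (k * N) powr \<gamma>" using b cl k(2) N by simp
  then have U0: "0 < U N" using U by linarith
  have ind: "real (k ^ n) powr \<gamma> * U N \<le> U (k ^ n * N)" for n
  proof (induction n)
    case (Suc n)
    have kn: "1 \<le> k ^ n * N" "0 < real (k ^ n)" using k N by auto
    have "real (k * (k ^ n * N)) powr (- \<gamma>) * real (k ^ n) powr \<gamma> = real (k * N) powr (- \<gamma>)"
      using kn k N by (simp add: powr_mult powr_minus field_simps)
    then have "b * cl * real (k * N) powr (- \<gamma>) * U N =
        b * cl * real (k * (k ^ n * N)) powr (- \<gamma>) * (real (k ^ n) powr \<gamma> * U N)"
      by (simp add: mult_ac)
    also have "\<dots> \<le> b * cl * real (k * (k ^ n * N)) powr (- \<gamma>) * U (k ^ n * N)"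
      using Suc.IH b cl by (intro mult_left_mono) auto
    finally have large: "2 \<le> b * cl * real (k * (k ^ n * N)) powr (- \<gamma>) * U (k ^ n * N)"
      using large0 by linarith
    have "real (k ^ Suc n) powr \<gamma> * U N = real k powr \<gamma> * (real (k ^ n) powr \<gamma> * U N)"
      by (simp add: powr_mult)
    also have "\<dots> \<le> real k powr \<gamma> * U (k ^ n * N)"
      using Suc.IH by (intro mult_left_mono) auto
    also have "\<dots> \<le> U (k * (k ^ n * N))"
      unfolding U_def using sum_tau_box_step[OF b cl \<gamma>0 lower k(1) _ kn(1)] large k(2) by (simp add: U_def)
    finally show ?case by (simp add: mult.assoc)
  qed simp
  have upper: "U (k ^ n * N) \<le> real ((k ^ n * N) ^ ?d) * X" for n
  proof -
    have "U (k ^ n * N) \<le> (\<Sum>x\<in>(corner_box (k ^ n * N) :: (int ^ 'd) set). X)"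
      unfolding U_def sum_tau_def by (intro sum_mono X) auto
    then show ?thesis by (simp add: card_box)
  qed
  \<comment> \<open>The factor by which the sum gains on the volume at each step; it exceeds 1
    because \<gamma> > d.\<close>
  define \<rho> where "\<rho> = real k powr (\<gamma> - real ?d)"
  have "1 < \<rho>" unfolding \<rho>_def using k \<gamma> by (intro gr_one_powr) auto
  then obtain n where n: "real N ^ ?d * X / U N < \<rho> ^ n" using real_arch_pow by blast
  have k0: "0 < real k" using k by simp
  have "\<rho> ^ n * U N * real (k ^ n) ^ ?d = real (k ^ n) powr \<gamma> * U N"
  proof -
    have "\<rho> ^ n = real k powr ((\<gamma> - real ?d) * real n)"
      using k0 by (simp add: \<rho>_def powr_powr flip: powr_realpow)
    moreover have "real (k ^ n) ^ ?d = real k powr (real ?d * real n)"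
      using k0 by (simp add: powr_realpow[symmetric] powr_powr mult.commute)
    moreover have "real (k ^ n) powr \<gamma> = real k powr (\<gamma> * real n)"
      using k0 by (simp add: powr_realpow[symmetric] powr_powr mult.commute)
    ultimately show ?thesis by (simp add: left_diff_distrib powr_diff)
  qed
  also have "\<dots> \<le> real ((k ^ n * N) ^ ?d) * X" using ind[of n] upper[of n] by linarith
  also have "\<dots> = (real N ^ ?d * X) * real (k ^ n) ^ ?d" by (simp add: power_mult_distrib)
  finally have "\<rho> ^ n * U N \<le> real N ^ ?d * X" using k0 by simp
  then have "\<rho> ^ n \<le> real N ^ ?d * X / U N" using U0 by (simp add: field_simps)
  with n show False by simp
qed

text \<open>Each x in \<open>cube n\<close> sees its own translated cube inside
  \<open>cube (2 * n)\<close>, which is a translate of a corner box of side 4 n + 1. A sum over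
  pairs thereby controls the susceptibility at the centre.\<close>

lemma sum_tau_cube_le:
  assumes b: "0 \<le> b"
  shows "real ((2 * n + 1) ^ CARD('d)) * (\<Sum>y\<in>cube n. tau (cube n) (p b) 0 y) \<le> sum_tau (corner_box (4 * n + 1)) (p b)"
proof -
  let ?C = "cube (2 * n) :: (int ^ 'd) set"
  have pr: "probs (edges_in ?C) (p b)" using b by (intro probs_p) auto
  have "real ((2 * n + 1) ^ CARD('d)) * (\<Sum>y\<in>cube n. tau (cube n) (p b) 0 y)
     = (\<Sum>x\<in>(cube n :: (int ^ 'd) set). \<Sum>y\<in>cube n. tau (cube n) (p b) 0 y)"
    by (simp add: card_cube)
  also have "\<dots> = (\<Sum>x\<in>cube n. \<Sum>y\<in>(+) x ` cube n. tau ((+) x ` cube n) (p b) x y)"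
    using tau_shift[OF finite_cube, of _ n b 0] by (simp add: sum.reindex)
  also have "\<dots> \<le> (\<Sum>x\<in>cube n. \<Sum>y\<in>?C. tau ?C (p b) x y)"
  proof (rule sum_mono)
    fix x :: "int ^ 'd" assume x: "x \<in> cube n"
    have sub: "(+) x ` cube n \<subseteq> ?C"
    proof
      fix y assume "y \<in> (+) x ` cube n"
      then obtain z where "z \<in> cube n" "y = x + z" by auto
      then show "y \<in> ?C" using x supn_triangle[of x z] by (simp add: cube_def)
    qed
    have "(\<Sum>y\<in>(+) x ` cube n. tau ((+) x ` cube n) (p b) x y) \<le> (\<Sum>y\<in>(+) x ` cube n. tau ?C (p b) x y)"
      by (intro sum_mono tau_mono_set[OF pr sub])
    also have "\<dots> \<le> (\<Sum>y\<in>?C. tau ?C (p b) x y)"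
      by (intro sum_mono2 sub tau_nonneg[OF pr]) simp
    finally show "(\<Sum>y\<in>(+) x ` cube n. tau ((+) x ` cube n) (p b) x y) \<le> (\<Sum>y\<in>?C. tau ?C (p b) x y)" .
  qed
  also have "\<dots> \<le> sum_tau ?C (p b)"
    unfolding sum_tau_def by (intro sum_mono2 sum_nonneg tau_nonneg[OF pr] cube_mono) auto
  also have "?C = (+) (\<chi> i. - int (2 * n)) ` corner_box (4 * n + 1)"
  proof (intro equalityI subsetI)
    fix x assume "x \<in> ?C"
    then have x: "- int (2 * n) \<le> x $ i" "x $ i \<le> int (2 * n)" for i by (auto simp: cube_alt)
    have "x + (\<chi> i. int (2 * n)) \<in> corner_box (4 * n + 1)"
      unfolding corner_box_def
    proof (intro CollectI allI)
      fix i show "(x + (\<chi> i. int (2 * n))) $ i \<in> {0..<int (4 * n + 1)}" using x[of i] by simp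
    qed
    moreover have "x = (\<chi> i. - int (2 * n)) + (x + (\<chi> i. int (2 * n)))" by (simp add: vec_eq_iff)
    ultimately show "x \<in> (+) (\<chi> i. - int (2 * n)) ` corner_box (4 * n + 1)" by (rule rev_image_eqI)
  next
    fix x :: "int ^ 'd" assume "x \<in> (+) (\<chi> i. - int (2 * n)) ` corner_box (4 * n + 1)"
    then obtain y :: "int ^ 'd" where y: "y \<in> corner_box (4 * n + 1)" "x = (\<chi> i. - int (2 * n)) + y" by blast
    show "x \<in> ?C"
      unfolding cube_alt
    proof (intro CollectI allI)
      fix i show "x $ i \<in> {- int (2 * n)..int (2 * n)}"
        using y(1)[unfolded corner_box_def, simplified, rule_format, of i] by (simp add: y(2))
    qed
  qed
  also have "sum_tau ((+) (\<chi> i. - int (2 * n)) ` corner_box (4 * n + 1)) (p b) = sum_tau (corner_box (4 * n + 1)) (p b)"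
    by (rule sum_tau_shift) simp
  finally show ?thesis .
qed

lemma cube_susceptibility:
  fixes \<alpha> cl :: real
  assumes b: "0 < b" and cl: "0 < cl" and \<alpha>: "0 < \<alpha>"
    and lower: "\<And>x y. x \<noteq> y \<Longrightarrow> cl * real (supn (x - y)) powr (- (real CARD('d) + \<alpha>)) \<le> K x y"
    and k: "1024 * real k powr (real CARD('d) + \<alpha>) \<le> real k ^ CARD('d) * (real k ^ CARD('d) - 1)" "2 \<le> k"
    and X: "\<And>V x. finite V \<Longrightarrow> x \<in> V \<Longrightarrow> (\<Sum>y\<in>V. tau V (p b) x y) \<le> X"
    and n: "1 \<le> n"
  shows "(\<Sum>y\<in>cube n. tau (cube n) (p b) 0 y)
    \<le> 2 * real (5 * k) powr (real CARD('d) + \<alpha>) / (b * cl) * real n powr \<alpha>"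
proof -
  let ?d = "CARD('d)"
  define \<gamma> where "\<gamma> = real ?d + \<alpha>"
  define M where "M = (\<Sum>y\<in>cube n. tau (cube n) (p b) 0 (y :: int ^ 'd))"
  have n0: "0 < real n" using n by simp
  have pr: "probs (edges_in (cube n :: (int ^ 'd) set)) (p b)" using b by (intro probs_p) auto
  have M0: "0 \<le> M" unfolding M_def by (intro sum_nonneg tau_nonneg[OF pr])
  have "real n powr real ?d * M \<le> real ((2 * n + 1) ^ ?d) * M"
    using n0 M0 by (intro mult_right_mono) (auto simp: powr_realpow intro!: power_mono)
  also have "\<dots> \<le> sum_tau (corner_box (4 * n + 1) :: (int ^ 'd) set) (p b)"
    unfolding M_def using b by (intro sum_tau_cube_le) auto
  also have "\<dots> \<le> 2 / (b * cl) * real (k * (4 * n + 1)) powr \<gamma>"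
    using lower k X \<alpha> b cl by (intro sum_tau_box_bound) (auto simp: \<gamma>_def)
  also have "\<dots> \<le> 2 / (b * cl) * real (k * (5 * n)) powr \<gamma>"
    using n \<alpha> b cl by (intro mult_left_mono powr_mono2 of_nat_mono mult_le_mono) (auto simp: \<gamma>_def)
  also have "real (k * (5 * n)) powr \<gamma> = real (5 * k) powr \<gamma> * (real n powr real ?d * real n powr \<alpha>)"
    using n0 by (simp add: \<gamma>_def powr_add powr_mult)
  finally have "real n powr real ?d * M \<le> real n powr real ?d * (2 * real (5 * k) powr \<gamma> / (b * cl) * real n powr \<alpha>)"
    by (simp add: mult_ac)
  moreover have "0 < real n powr real ?d" using n by simp
  ultimately show ?thesis unfolding M_def \<gamma>_def by (rule mult_left_le_imp_le)
qed

end

text \<open>As \<alpha> < 1 \<le> d, a large \<open>k\<close> has k^(d - \<alpha>) \<ge> 2048. Half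
  of 2048 is spent on replacing k^d by k^d - 1.\<close>

lemma exists_growth_scale:
  fixes \<alpha> :: real
  assumes "0 < d" "\<alpha> < 1" "0 < \<alpha>"
  shows "\<exists>k\<ge>2. 1024 * real k powr (real d + \<alpha>) \<le> real k ^ d * (real k ^ d - 1)"
proof -
  define e where "e = real d - \<alpha>"
  have e: "0 < e" using assms by (simp add: e_def)
  define k where "k = nat \<lceil>2048 powr (1 / e)\<rceil> + 2"
  have k2: "2 \<le> k" by (simp add: k_def)
  have "2048 powr (1 / e) \<le> real k" unfolding k_def by linarith
  then have "(2048 powr (1 / e)) powr e \<le> real k powr e"
    using e by (intro powr_mono2) auto
  then have ke: "2048 \<le> real k powr e" using e by (simp add: powr_powr)
  have kd: "real k ^ d = real k powr e * real k powr \<alpha>"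
    using k2 by (simp add: e_def powr_realpow flip: powr_add)
  have k1: "1 \<le> real k powr \<alpha>" using k2 assms by (intro ge_one_powr_ge_zero) auto
  have "2048 * real k powr \<alpha> \<le> real k ^ d" unfolding kd using ke by (intro mult_right_mono) auto
  with k1 have "1024 * real k powr \<alpha> \<le> real k ^ d - 1" by linarith
  then have "real k ^ d * (1024 * real k powr \<alpha>) \<le> real k ^ d * (real k ^ d - 1)"
    by (intro mult_left_mono) auto
  moreover have "1024 * real k powr (real d + \<alpha>) = real k ^ d * (1024 * real k powr \<alpha>)"
    using k2 by (simp add: powr_add powr_realpow)
  ultimately show ?thesis using k2 by (intro exI[of _ k]) simp
qed

section \<open>Norms, power laws and sums\<close>

lemma is_norm_sum_le:
  assumes "is_norm N" "finite I"
  shows "N (\<Sum>i\<in>I. f i) \<le> (\<Sum>i\<in>I. N (f i))"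
  using assms(2)
proof induction
  case empty
  have "N 0 = 0" using assms(1) by (simp add: is_norm_def)
  then show ?case by simp
next
  case (insert i I)
  have "N (f i + sum f I) \<le> N (f i) + N (sum f I)" using assms(1) by (simp add: is_norm_def)
  with insert show ?case by simp
qed

text \<open>Expansion in the standard basis bounds \<open>N\<close> from above and makes it
  Lipschitz; its minimum over the compact Euclidean sphere is positive and gives the lower
  bound.\<close>

lemma is_norm_equivalence:
  fixes N :: "real ^ 'd \<Rightarrow> real"
  assumes N: "is_norm N"
  shows "\<exists>s1>0. \<exists>s2>0. \<forall>v. (\<forall>M. (\<forall>i. \<bar>v $ i\<bar> \<le> M) \<longrightarrow> N v \<le> s2 * M) \<and> (\<forall>i. s1 * \<bar>v $ i\<bar> \<le> N v)"
proof -
  have N0: "0 \<le> N v" and Nz: "N v = 0 \<longleftrightarrow> v = 0" and Ns: "N (a *\<^sub>R v) = \<bar>a\<bar> * N v"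
    and Nt: "N (v + u) \<le> N v + N u" for v u a
    using N by (auto simp: is_norm_def)
  define s2 where "s2 = (\<Sum>i\<in>UNIV. N (axis i 1)) + 1"
  have s2: "0 < s2" unfolding s2_def using N0 by (intro add_nonneg_pos sum_nonneg) auto
  have upper: "N v \<le> s2 * M" if "\<And>i. \<bar>v $ i\<bar> \<le> M" for v M
  proof -
    have M0: "0 \<le> M" using that[of undefined] by linarith
    have "v = (\<Sum>i\<in>UNIV. (v $ i) *\<^sub>R axis i 1)"
      by (simp add: vec_eq_iff axis_def if_distrib cong: if_cong)
    then have "N v \<le> (\<Sum>i\<in>UNIV. N ((v $ i) *\<^sub>R axis i 1))"
      using is_norm_sum_le[OF N, of UNIV "\<lambda>i. (v $ i) *\<^sub>R axis i 1"] by simp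
    also have "\<dots> \<le> (\<Sum>i\<in>UNIV. M * N (axis i 1))"
      unfolding Ns by (intro sum_mono mult_right_mono that N0)
    also have "\<dots> \<le> s2 * M" using M0 by (simp add: s2_def sum_distrib_left[symmetric] algebra_simps)
    finally show ?thesis .
  qed
  have lip: "\<bar>N u - N v\<bar> \<le> s2 * norm (u - v)" for u v
  proof -
    have 1: "N (u - v) \<le> s2 * norm (u - v)" by (rule upper) (rule component_le_norm_cart)
    have 2: "N (v - u) \<le> s2 * norm (u - v)"
      using upper[of "v - u" "norm (v - u)"] component_le_norm_cart[of "v - u"] by (simp add: norm_minus_commute)
    show ?thesis using 1 2 Nt[of "u - v" v] Nt[of "v - u" u] by (simp add: abs_le_iff)
  qed
  have "continuous_on (sphere 0 1) N"
  proof (rule continuous_onI)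
    fix x e assume e: "(0::real) < e"
    show "\<exists>d>0. \<forall>x'\<in>sphere 0 1. dist x' x < d \<longrightarrow> dist (N x') (N x) \<le> e"
    proof (intro exI[of _ "e / s2"] conjI ballI impI)
      fix x' assume "dist x' x < e / s2"
      then have "s2 * norm (x' - x) \<le> e" using s2 by (simp add: dist_norm field_simps)
      then show "dist (N x') (N x) \<le> e" using lip[of x' x] by (simp add: dist_real_def)
    qed (use e s2 in simp)
  qed
  moreover have "sphere (0 :: real ^ 'd) 1 \<noteq> {}" by simp
  ultimately obtain v0 where v0: "v0 \<in> sphere 0 1" "\<And>v. v \<in> sphere 0 1 \<Longrightarrow> N v0 \<le> N v"
    using continuous_attains_inf[OF compact_sphere] by metis
  have s1: "0 < N v0"
  proof -
    have "v0 \<noteq> 0" using v0(1) by auto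
    then show ?thesis using N0[of v0] Nz[of v0] by linarith
  qed
  have lower: "N v0 * \<bar>v $ i\<bar> \<le> N v" for v i
  proof (cases "v = 0")
    case False
    have "N v0 \<le> N (inverse (norm v) *\<^sub>R v)" using False by (intro v0(2)) simp
    then have "N v0 * norm v \<le> N v" using False by (simp add: Ns field_simps)
    then show ?thesis
      using mult_left_mono[OF component_le_norm_cart[of v i], of "N v0"] s1 by linarith
  qed (use N0 in simp)
  show ?thesis using s1 s2 upper lower by blast
qed

definition lnorm :: "(real ^ 'd \<Rightarrow> real) \<Rightarrow> int ^ 'd \<Rightarrow> real" where
  "lnorm N x = N (\<chi> i. real_of_int (x $ i))"

lemma lattice_dist_lnorm: "lattice_dist N x y = lnorm N (x - y)"
  by (simp add: lattice_dist_def lnorm_def)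

lemma lnorm_equivalence:
  fixes N :: "real ^ 'd \<Rightarrow> real"
  assumes N: "is_norm N"
  shows "\<exists>s1>0. \<exists>s2>0. \<forall>x. s1 * real (supn x) \<le> lnorm N x \<and> lnorm N x \<le> s2 * real (supn x)"
proof -
  obtain s1 s2 where s: "0 < s1" "0 < s2" and
    up: "\<And>v M. (\<And>i. \<bar>v $ i\<bar> \<le> M) \<Longrightarrow> N v \<le> s2 * M" and lo: "\<And>v i. s1 * \<bar>v $ i\<bar> \<le> N v"
    using is_norm_equivalence[OF N] by blast
  have "lnorm N x \<le> s2 * real (supn x)" for x
    unfolding lnorm_def
  proof (rule up)
    fix i show "\<bar>(\<chi> i. real_of_int (x $ i)) $ i\<bar> \<le> real (supn x)"
      using supn_ge[of x i] by simp
  qed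
  moreover have "s1 * real (supn x) \<le> lnorm N x" for x
  proof -
    have "supn x \<in> range (\<lambda>i. nat \<bar>x $ i\<bar>)" unfolding supn_def by (rule Max_in) auto
    then obtain i where "supn x = nat \<bar>x $ i\<bar>" by blast
    then have "real (supn x) = \<bar>(\<chi> i. real_of_int (x $ i)) $ i\<bar>" by simp
    then show ?thesis unfolding lnorm_def using lo by metis
  qed
  ultimately show ?thesis using s by blast
qed

lemma lnorm_triangle: "is_norm N \<Longrightarrow> lnorm N (x + y) \<le> lnorm N x + lnorm N y"
proof -
  assume N: "is_norm N"
  have "(\<chi> i. real_of_int ((x + y) $ i)) = (\<chi> i. real_of_int (x $ i)) + (\<chi> i. real_of_int (y $ i))"
    by (simp add: vec_eq_iff)
  with N show ?thesis by (simp add: lnorm_def is_norm_def)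
qed

lemma lnorm_minus: "is_norm N \<Longrightarrow> lnorm N (- x) = lnorm N x"
proof -
  assume N: "is_norm N"
  have "(\<chi> i. real_of_int ((- x) $ i)) = (-1) *\<^sub>R (\<chi> i. real_of_int (x $ i))"
    by (simp add: vec_eq_iff)
  moreover have "N ((-1) *\<^sub>R v) = N v" for v
  proof -
    have "N ((-1) *\<^sub>R v) = \<bar>-1\<bar> * N v" using N unfolding is_norm_def by blast
    then show ?thesis by simp
  qed
  ultimately show ?thesis unfolding lnorm_def by metis
qed

lemma deriv_nonpos_of_antimono:
  assumes "antimono_on {0<..} J" "\<And>r. 0 < r \<Longrightarrow> J differentiable (at r)" "0 < (r::real)"
  shows "deriv J r \<le> 0"
proof -
  have D: "(J has_real_derivative deriv J r) (at r)"
    using assms(2)[OF assms(3)] by (simp add: DERIV_deriv_iff_real_differentiable)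
  have "mono_on {0<..} (\<lambda>r. - J r)" using assms(1) by (auto simp: monotone_on_def)
  moreover have "((\<lambda>r. - J r) has_real_derivative - deriv J r) (at r)" by (intro DERIV_minus D)
  moreover have "r \<in> interior {0<..}" using assms(3) by (simp add: interior_open)
  ultimately have "0 \<le> - deriv J r" by (rule mono_on_imp_deriv_nonneg)
  then show ?thesis by simp
qed

text \<open>Beyond a radius where |\<delta>| < 1 / 2, the difference between J and a suitable
  multiple of r^(- \<gamma>) is monotone and tends to 0, which fixes its sign. Between
  \<open>\<rho>\<close> and that radius J is bounded through its monotonicity.\<close>

lemma power_law_bounds:
  fixes J \<delta> :: "real \<Rightarrow> real"
  assumes J: "\<And>r. 0 < r \<Longrightarrow> 0 < J r" "antimono_on {0<..} J" "\<And>r. 0 < r \<Longrightarrow> J differentiable (at r)"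
      "(J \<longlongrightarrow> 0) at_top"
    and C: "0 < C" and \<gamma>: "0 < \<gamma>"
    and J': "\<And>r. 0 < r \<Longrightarrow> \<bar>deriv J r\<bar> = C * (1 + \<delta> r) * r powr (- \<gamma> - 1)"
    and \<delta>: "(\<delta> \<longlongrightarrow> 0) at_top" and \<rho>: "0 < \<rho>"
  shows "\<exists>cl>0. \<exists>cu>0. \<forall>r\<ge>\<rho>. cl * r powr (- \<gamma>) \<le> J r \<and> J r \<le> cu * r powr (- \<gamma>)"
proof -
  have "eventually (\<lambda>r. dist (\<delta> r) 0 < 1 / 2) at_top"
    using \<delta> by (rule tendstoD) simp
  then obtain R0 where R0: "\<And>r. R0 \<le> r \<Longrightarrow> \<bar>\<delta> r\<bar> < 1 / 2" by (auto simp: eventually_at_top_linorder)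
  define R where "R = max (max R0 \<rho>) 1"
  have R: "R0 \<le> R" "\<rho> \<le> R" "0 < R" by (auto simp: R_def)
  have D: "(J has_real_derivative deriv J r) (at r)" if "0 < r" for r
    using J(3)[OF that] by (simp add: DERIV_deriv_iff_real_differentiable)
  have neg: "deriv J r \<le> 0" if "0 < r" for r by (rule deriv_nonpos_of_antimono[OF J(2,3) that])
  have Dp: "((\<lambda>r. c / \<gamma> * r powr (- \<gamma>)) has_real_derivative - c * r powr (- \<gamma> - 1)) (at r)" if "0 < r" for r c
    using that \<gamma> by (auto intro!: derivative_eq_intros)
  have lim: "((\<lambda>r. J r - c / \<gamma> * r powr (- \<gamma>)) \<longlongrightarrow> 0) at_top" for c
  proof -
    have "((\<lambda>r. J r - c / \<gamma> * r powr (- \<gamma>)) \<longlongrightarrow> 0 - c / \<gamma> * 0) at_top"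
      using \<gamma> by (intro tendsto_diff J(4) tendsto_mult tendsto_const tendsto_neg_powr filterlim_ident) auto
    then show ?thesis by simp
  qed
  have up: "J r \<le> (2 * C) / \<gamma> * r powr (- \<gamma>)" if r: "R \<le> r" for r
  proof -
    let ?h = "\<lambda>r. J r - (2 * C) / \<gamma> * r powr (- \<gamma>)"
    have "?h r \<le> ?h s" if "r \<le> s" for s
    proof (rule DERIV_nonneg_imp_nondecreasing[OF that])
      fix x assume x: "r \<le> x" "x \<le> s"
      have x0: "0 < x" using x r R by linarith
      have "\<bar>\<delta> x\<bar> < 1 / 2" using x r R by (intro R0) linarith
      then have "C * (1 + \<delta> x) * x powr (- \<gamma> - 1) \<le> 2 * C * x powr (- \<gamma> - 1)"
        using C by (intro mult_right_mono) auto
      then have "0 \<le> deriv J x - - (2 * C) * x powr (- \<gamma> - 1)"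
        using J'[OF x0] neg[OF x0] by simp
      then show "\<exists>y. (?h has_real_derivative y) (at x) \<and> 0 \<le> y"
        using DERIV_diff[OF D[OF x0] Dp[OF x0, of "2 * C"]] by blast
    qed
    then have "?h r \<le> 0"
      by (intro tendsto_lowerbound[OF lim[of "2 * C"]]) (auto simp: eventually_at_top_linorder)
    then show ?thesis by simp
  qed
  have lo: "(C / 2) / \<gamma> * r powr (- \<gamma>) \<le> J r" if r: "R \<le> r" for r
  proof -
    let ?h = "\<lambda>r. J r - (C / 2) / \<gamma> * r powr (- \<gamma>)"
    have "?h s \<le> ?h r" if "r \<le> s" for s
    proof (rule DERIV_nonpos_imp_nonincreasing[OF that])
      fix x assume x: "r \<le> x" "x \<le> s"
      have x0: "0 < x" using x r R by linarith
      have "\<bar>\<delta> x\<bar> < 1 / 2" using x r R by (intro R0) linarith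
      then have "1 / 2 \<le> 1 + \<delta> x" by linarith
      from mult_left_mono[OF this, of C] C
      have "(C / 2) * x powr (- \<gamma> - 1) \<le> C * (1 + \<delta> x) * x powr (- \<gamma> - 1)"
        by (intro mult_right_mono) auto
      then have "deriv J x - - (C / 2) * x powr (- \<gamma> - 1) \<le> 0"
        using J'[OF x0] neg[OF x0] by simp
      then show "\<exists>y. (?h has_real_derivative y) (at x) \<and> y \<le> 0"
        using DERIV_diff[OF D[OF x0] Dp[OF x0, of "C / 2"]] by blast
    qed
    then have "0 \<le> ?h r"
      by (intro tendsto_upperbound[OF lim[of "C / 2"]]) (auto simp: eventually_at_top_linorder)
    then show ?thesis by simp
  qed
  have anti: "J s \<le> J r" if "0 < r" "r \<le> s" for r s using J(2) that by (auto simp: monotone_on_def)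
  define cl where "cl = min ((C / 2) / \<gamma>) (J R * \<rho> powr \<gamma>)"
  define cu where "cu = max ((2 * C) / \<gamma>) (J \<rho> * R powr \<gamma>)"
  have "0 < cl" "0 < cu" using C \<gamma> J(1)[OF R(3)] \<rho> by (auto simp: cl_def cu_def less_max_iff_disj)
  moreover have "cl * r powr (- \<gamma>) \<le> J r \<and> J r \<le> cu * r powr (- \<gamma>)" if r: "\<rho> \<le> r" for r
  proof (cases "R \<le> r")
    case True
    have "cl * r powr (- \<gamma>) \<le> (C / 2) / \<gamma> * r powr (- \<gamma>)" "(2 * C) / \<gamma> * r powr (- \<gamma>) \<le> cu * r powr (- \<gamma>)"
      by (intro mult_right_mono; simp add: cl_def cu_def)+
    with up[OF True] lo[OF True] show ?thesis by linarith
  next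
    case False
    have r0: "0 < r" using r \<rho> by linarith
    have "cl * r powr (- \<gamma>) \<le> J R * \<rho> powr \<gamma> * \<rho> powr (- \<gamma>)"
      using r \<rho> \<gamma> J(1)[OF R(3)] \<open>0 < cl\<close>
      by (intro mult_mono powr_mono2') (auto simp: cl_def)
    also have "\<dots> = J R" using \<rho> by (simp add: powr_minus)
    also have "\<dots> \<le> J r" using False r0 by (intro anti) auto
    finally have 1: "cl * r powr (- \<gamma>) \<le> J r" .
    have "J r \<le> J \<rho>" using r \<rho> by (intro anti)
    also have "\<dots> = J \<rho> * R powr \<gamma> * R powr (- \<gamma>)" using R by (simp add: powr_minus)
    also have "\<dots> \<le> cu * r powr (- \<gamma>)"
      using False r0 \<gamma> J(1)[OF \<rho>] \<open>0 < cu\<close> by (intro mult_mono powr_mono2') (auto simp: cu_def)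
    finally show ?thesis using 1 by simp
  qed
  ultimately show ?thesis by blast
qed

text \<open>The fundamental theorem of calculus gives the gauge integral. To turn it into a Lebesgue
  integral the derivative must be measurable, and this comes from its expression through the
  measurable \<open>\<delta>\<close>.\<close>

lemma integral_abs_deriv:
  fixes J \<delta> :: "real \<Rightarrow> real"
  assumes J: "antimono_on {0<..} J" "\<And>r. 0 < r \<Longrightarrow> J differentiable (at r)"
    and J': "\<And>r. 0 < r \<Longrightarrow> \<bar>deriv J r\<bar> = C * (1 + \<delta> r) * r powr e"
    and \<delta>: "set_borel_measurable borel {0<..} \<delta>" and ab: "0 < a" "a \<le> b"
  shows "(LBINT s:{a..b}. \<bar>deriv J s\<bar>) = J a - J b"
proof -
  let ?f = "\<lambda>s. \<bar>deriv J s\<bar>"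
  have I: "(?f has_integral (J a - J b)) {a..b}"
  proof -
    have "((\<lambda>s. - deriv J s) has_integral (- J b - - J a)) {a..b}"
    proof (rule fundamental_theorem_of_calculus[OF ab(2)])
      fix x assume "x \<in> {a..b}"
      then have "(J has_real_derivative deriv J x) (at x)"
        using J(2)[of x] ab by (simp add: DERIV_deriv_iff_real_differentiable)
      from DERIV_minus[OF this]
      show "((\<lambda>s. - J s) has_vector_derivative - deriv J x) (at x within {a..b})"
        by (simp add: has_real_derivative_iff_has_vector_derivative has_vector_derivative_at_within)
    qed
    then have "((\<lambda>s. - deriv J s) has_integral (J a - J b)) {a..b}" by simp
    moreover have "- deriv J s = ?f s" if "s \<in> {a..b}" for s
      using deriv_nonpos_of_antimono[OF J, of s] that ab by auto
    ultimately show ?thesis by (rule has_integral_eq[rotated])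
  qed
  have "(\<lambda>s. indicator {a..b} s *\<^sub>R ?f s) = (\<lambda>s. indicator {a..b} s * (C * (1 + indicator {0<..} s *\<^sub>R \<delta> s) * s powr e))"
    using J' ab by (auto simp: indicator_def fun_eq_iff)
  also have "\<dots> \<in> borel_measurable borel"
    using \<delta> unfolding set_borel_measurable_def by measurable
  finally have meas: "(\<lambda>s. indicator {a..b} s *\<^sub>R ?f s) \<in> borel_measurable lborel" by simp
  have "(LBINT s:{a..b}. ?f s) = (LINT s:{a..b}|lebesgue. ?f s)"
    unfolding set_lebesgue_integral_def by (rule integral_completion[OF meas, symmetric])
  also have "\<dots> = integral {a..b} ?f"
    by (rule set_lebesgue_integral_eq_integral, rule nonnegative_absolutely_integrable_1)
      (use I in \<open>auto simp: integrable_on_def\<close>)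
  also have "\<dots> = J a - J b" using I by (rule integral_unique)
  finally show ?thesis .
qed

section \<open>Lattice shells, power sums and the dyadic profile\<close>

lemma power_diff_le:
  fixes x y :: real
  assumes "0 \<le> y" "y \<le> x"
  shows "x ^ Suc d - y ^ Suc d \<le> real (Suc d) * (x - y) * x ^ d"
proof (induction d)
  case (Suc d)
  have "x ^ Suc (Suc d) - y ^ Suc (Suc d) = x * (x ^ Suc d - y ^ Suc d) + (x - y) * y ^ Suc d"
    by (simp add: algebra_simps)
  also have "\<dots> \<le> x * (real (Suc d) * (x - y) * x ^ d) + (x - y) * x ^ Suc d"
    using assms Suc.IH by (intro add_mono mult_left_mono power_mono) auto
  also have "\<dots> = real (Suc (Suc d)) * (x - y) * x ^ Suc d" by (simp add: algebra_simps)
  finally show ?case .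
qed simp

lemma card_supn_eq:
  assumes "1 \<le> j"
  shows "real (card {x :: int ^ 'd. supn x = j}) \<le> 2 * real CARD('d) * 3 ^ CARD('d) * real j powr (real CARD('d) - 1)"
proof -
  obtain m where m: "CARD('d) = Suc m" using not0_implies_Suc[of "CARD('d)"] by auto
  have j0: "0 < real j" using assms by simp
  have eq: "{x :: int ^ 'd. supn x = j} = cube j - cube (j - 1)" using assms by (auto simp: cube_def)
  have "real (card {x :: int ^ 'd. supn x = j}) = real (card (cube j :: (int ^ 'd) set)) - real (card (cube (j - 1) :: (int ^ 'd) set))"
    unfolding eq using cube_mono[of "j - 1" j] by (subst card_Diff_subset) (auto simp: of_nat_diff card_mono)
  also have "\<dots> = (2 * real j + 1) ^ Suc m - (2 * real j - 1) ^ Suc m"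
  proof -
    have r: "real (2 * (j - 1) + 1) = 2 * real j - 1" "real (2 * j + 1) = 2 * real j + 1"
      using assms by (simp_all add: of_nat_diff)
    show ?thesis unfolding card_cube m of_nat_power r ..
  qed
  also have "\<dots> \<le> real (Suc m) * ((2 * real j + 1) - (2 * real j - 1)) * (2 * real j + 1) ^ m"
    using assms by (intro power_diff_le) auto
  also have "\<dots> \<le> real (Suc m) * 2 * (3 * real j) ^ m"
    using assms by (intro mult_mono power_mono) auto
  also have "\<dots> = 2 * real (Suc m) * 3 ^ m * real j powr real m"
    using j0 by (simp add: power_mult_distrib powr_realpow)
  also have "\<dots> \<le> 2 * real (Suc m) * 3 ^ Suc m * real j powr real m"
    by (intro mult_right_mono mult_left_mono power_increasing) auto
  finally show ?thesis by (simp add: m)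
qed

lemma sum_powr_le:
  fixes \<alpha> :: real
  assumes "0 < \<alpha>" "\<alpha> < 1"
  shows "(\<Sum>j=1..n. real j powr (- \<alpha>)) \<le> real n powr (1 - \<alpha>) / (1 - \<alpha>)"
proof (induction n)
  case (Suc n)
  have "(1 - \<alpha>) * real (Suc n) powr (- \<alpha>) \<le> real (Suc n) powr (1 - \<alpha>) - real n powr (1 - \<alpha>)"
  proof (cases "n = 0")
    case False
    have "\<exists>z>real n. z < real (Suc n) \<and> real (Suc n) powr (1 - \<alpha>) - real n powr (1 - \<alpha>)
        = (real (Suc n) - real n) * ((1 - \<alpha>) * z powr (- \<alpha>))"
      using False by (intro MVT2) (auto intro!: derivative_eq_intros)
    then obtain z where z: "real n < z" "z < real (Suc n)"
      "real (Suc n) powr (1 - \<alpha>) - real n powr (1 - \<alpha>) = (1 - \<alpha>) * z powr (- \<alpha>)" by auto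
    then show ?thesis using assms by (auto intro!: mult_left_mono powr_mono2')
  qed (use assms in simp)
  then have "real (Suc n) powr (- \<alpha>) \<le> (real (Suc n) powr (1 - \<alpha>) - real n powr (1 - \<alpha>)) / (1 - \<alpha>)"
    using assms by (simp add: field_simps)
  with Suc.IH show ?case by (simp add: diff_divide_distrib)
qed (use assms in simp)

text \<open>A shell of radius j has of order j^(d - 1) points, so it contributes of order j^(-
  \<alpha>). The exponent being above -1, the sum is governed by the largest radius.\<close>

lemma lattice_first_moment:
  fixes \<alpha> :: real
  assumes \<alpha>: "0 < \<alpha>" "\<alpha> < 1"
  shows "(\<Sum>x | supn (x :: int ^ 'd) \<in> {1..n}. real (supn x) powr (- (real CARD('d) + \<alpha>)) * real (supn x))
    \<le> 2 * real CARD('d) * 3 ^ CARD('d) / (1 - \<alpha>) * real n powr (1 - \<alpha>)"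
proof -
  let ?f = "\<lambda>j. real j powr (- (real CARD('d) + \<alpha>)) * real j"
  let ?A = "\<lambda>j. {x :: int ^ 'd. supn x = j}"
  have finA: "finite (?A j)" for j
    by (rule finite_subset[OF _ finite_cube[of j]]) (auto simp: cube_def)
  have "{x :: int ^ 'd. supn x \<in> {1..n}} = (\<Union>j\<in>{1..n}. ?A j)" by auto
  then have "(\<Sum>x | supn (x :: int ^ 'd) \<in> {1..n}. ?f (supn x)) = (\<Sum>j=1..n. \<Sum>x\<in>?A j. ?f (supn x))"
    by (simp only:) (rule sum.UNION_disjoint, use finA in auto)
  also have "\<dots> = (\<Sum>j=1..n. real (card (?A j)) * ?f j)" by simp
  also have "\<dots> \<le> (\<Sum>j=1..n. (2 * real CARD('d) * 3 ^ CARD('d) * real j powr (real CARD('d) - 1)) * ?f j)"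
    by (intro sum_mono mult_right_mono card_supn_eq) auto
  also have "\<dots> = (\<Sum>j=1..n. 2 * real CARD('d) * 3 ^ CARD('d) * real j powr (- \<alpha>))"
  proof (rule sum.cong[OF refl])
    fix j assume "j \<in> {1..n}"
    then have j: "0 < real j" by simp
    have "real j powr (real CARD('d) - 1) * ?f j = real j powr (real CARD('d) - 1) * (real j powr (- (real CARD('d) + \<alpha>)) * real j powr 1)"
      using j by simp
    also have "\<dots> = real j powr (- \<alpha>)" unfolding powr_add[symmetric] by simp
    finally show "(2 * real CARD('d) * 3 ^ CARD('d) * real j powr (real CARD('d) - 1)) * ?f j
      = 2 * real CARD('d) * 3 ^ CARD('d) * real j powr (- \<alpha>)" by (simp only: mult.assoc)
  qed
  also have "\<dots> = 2 * real CARD('d) * 3 ^ CARD('d) * (\<Sum>j=1..n. real j powr (- \<alpha>))"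
    by (simp add: sum_distrib_left)
  also have "\<dots> \<le> 2 * real CARD('d) * 3 ^ CARD('d) * (real n powr (1 - \<alpha>) / (1 - \<alpha>))"
    by (intro mult_left_mono sum_powr_le \<alpha>) simp
  finally show ?thesis by simp
qed

text \<open>Used with u = |x - y| / r. The factor 1 + 1 / (1 + u^q) drops by a multiple of
  u^q / (1 + u^q)^2 when u is doubled, so the dyadic contributions telescope.\<close>

lemma dyadic_profile:
  fixes q c :: real
  assumes q: "0 < q" and c: "0 < c"
  shows "\<exists>B>0. \<forall>u>0. u powr q * exp (- c * u) + B * (1 + 1 / (1 + (2 * u) powr q)) * exp (- c * u)
    \<le> B * (1 + 1 / (1 + u powr q)) * exp (- c * u / 2)"
proof -
  define m where "m = nat \<lceil>q\<rceil>"
  have m: "q \<le> real m" "0 < m" using q by (auto simp: m_def)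
  \<comment> \<open>\<open>L\<close> absorbs the polynomial 1 + u^q into exp (c u / 4). Its square
    costs exp (c u / 2), which is half of the available exponential decay and explains the weaker
    rate on the right.\<close>
  define L where "L = 2 + (4 * real m / c) ^ m"
  have L0: "0 < L" using c by (simp add: L_def add_pos_nonneg)
  have L: "1 + u powr q \<le> L * exp (c * u / 4)" if "0 < u" for u
  proof -
    have 1: "1 \<le> exp (c * u / 4)" using that c by simp
    have "u powr q \<le> 1 + u ^ m"
    proof (cases "1 \<le> u")
      case True
      then have "u powr q \<le> u powr real m" using m by (intro powr_mono)
      then show ?thesis using that by (simp add: powr_realpow)
    next
      case False
      then have "u powr q \<le> 1 powr q" using that q by (intro powr_mono2) auto
      then show ?thesis using that by (simp add: add_increasing2)
    qed
    moreover have "u ^ m \<le> (4 * real m / c) ^ m * exp (c * u / 4)"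
    proof -
      have "c * u / (4 * real m) \<le> exp (c * u / (4 * real m))"
        using exp_ge_add_one_self[of "c * u / (4 * real m)"] by linarith
      then have "(c * u / (4 * real m)) ^ m \<le> exp (c * u / (4 * real m)) ^ m"
        using that c by (intro power_mono) auto
      also have "\<dots> = exp (c * u / 4)" using m(2) by (simp flip: exp_of_nat_mult)
      finally have "(4 * real m / c) ^ m * (c * u / (4 * real m)) ^ m \<le> (4 * real m / c) ^ m * exp (c * u / 4)"
        using c by (intro mult_left_mono) auto
      moreover have "(4 * real m / c) ^ m * (c * u / (4 * real m)) ^ m = u ^ m"
        using c m(2) by (simp flip: power_mult_distrib)
      ultimately show ?thesis by simp
    qed
    ultimately have "1 + u powr q \<le> 2 * 1 + (4 * real m / c) ^ m * exp (c * u / 4)" by linarith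
    also have "\<dots> \<le> L * exp (c * u / 4)" using 1 by (simp add: L_def distrib_right)
    finally show ?thesis .
  qed
  define a where "a = (2::real) powr q"
  have a: "1 < a" unfolding a_def using q by (intro gr_one_powr) auto
  \<comment> \<open>Chosen so that the drop B (a - 1) v / ((1 + v) (1 + a v)) dominates L^2 v / (1 +
    v)^2; the factor \<open>a\<close> pays for 1 + a v \<le> a (1 + v).\<close>
  define B where "B = L\<^sup>2 * a / (a - 1)"
  have B: "0 < B" using L0 a by (simp add: B_def)
  have "u powr q * exp (- c * u) + B * (1 + 1 / (1 + (2 * u) powr q)) * exp (- c * u)
    \<le> B * (1 + 1 / (1 + u powr q)) * exp (- c * u / 2)" if u: "0 < u" for u
  proof -
    define v where "v = u powr q"
    have v: "0 < v" using u by (simp add: v_def)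
    have av: "(2 * u) powr q = a * v" using u by (simp add: a_def v_def powr_mult)
    have e: "exp (- c * u) = exp (- c * u / 2) * exp (- c * u / 2)" by (simp flip: exp_add)
    have "(1 + v)\<^sup>2 \<le> (L * exp (c * u / 4))\<^sup>2"
      using L[OF u] v by (intro power_mono) (auto simp: v_def)
    also have "\<dots> = L\<^sup>2 * exp (c * u / 2)" by (simp add: power_mult_distrib power2_eq_square flip: exp_add)
    finally have L2: "(1 + v)\<^sup>2 * exp (- c * u / 2) \<le> L\<^sup>2"
      by (simp add: exp_minus field_simps)
    have "v * exp (- c * u / 2) \<le> v * (L\<^sup>2 / (1 + v)\<^sup>2)"
      using L2 v by (intro mult_left_mono) (auto simp: field_simps)
    also have "\<dots> = B * ((a - 1) * v / ((1 + v) * (a * (1 + v))))"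
      using a v by (simp add: B_def power2_eq_square)
    also have "\<dots> \<le> B * ((a - 1) * v / ((1 + v) * (1 + a * v)))"
      using a v B by (intro mult_left_mono divide_left_mono mult_pos_pos) (auto simp: algebra_simps add_pos_pos)
    also have "(a - 1) * v / ((1 + v) * (1 + a * v)) = 1 / (1 + v) - 1 / (1 + a * v)"
    proof -
      have "1 + v \<noteq> 0" "1 + a * v \<noteq> 0" using a v by (auto simp: add_nonneg_eq_0_iff)
      then show ?thesis by (simp add: field_simps)
    qed
    finally have "v * exp (- c * u / 2) + B * (1 + 1 / (1 + a * v)) \<le> B * (1 + 1 / (1 + v))"
      by (simp add: algebra_simps)
    then have "(v * exp (- c * u / 2) + B * (1 + 1 / (1 + a * v))) * exp (- c * u / 2)
      \<le> B * (1 + 1 / (1 + v)) * exp (- c * u / 2)" by (intro mult_right_mono) auto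
    moreover have "B * (1 + 1 / (1 + a * v)) * exp (- c * u) \<le> B * (1 + 1 / (1 + a * v)) * exp (- c * u / 2)"
      using B a v u c by (intro mult_left_mono) auto
    moreover have "v * exp (- c * u) = v * exp (- c * u / 2) * exp (- c * u / 2)"
      unfolding e by simp
    ultimately have "v * exp (- c * u) + B * (1 + 1 / (1 + a * v)) * exp (- c * u)
        \<le> B * (1 + 1 / (1 + v)) * exp (- c * u / 2)"
      unfolding distrib_right[of "v * exp (- c * u / 2)"] by linarith
    then show ?thesis by (simp only: av v_def)
  qed
  with B show ?thesis by blast
qed

section \<open>The truncated kernels\<close>

lemma exp_minus_diff_le:
  fixes u v :: real
  assumes "0 \<le> u" "u \<le> v"
  shows "exp (- u) - exp (- v) \<le> v - u"
proof -
  have "exp (- u) - exp (- v) = exp (- u) * (1 - exp (- (v - u)))"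
    by (simp add: right_diff_distrib flip: exp_add)
  also have "\<dots> \<le> 1 * (v - u)"
  proof (rule mult_mono)
    show "1 - exp (- (v - u)) \<le> v - u" using exp_ge_add_one_self[of "- (v - u)"] by linarith
  qed (use assms in auto)
  finally show ?thesis by simp
qed

text \<open>The bounds on J start at \<open>min s1 1\<close>: nonzero lattice vectors have norm at
  least \<open>s1\<close>, and the radii r / 2 at which J is evaluated in the scale comparison are
  at least 1.\<close>

locale power_law_kernel =
  fixes N :: "real ^ 'd \<Rightarrow> real" and J :: "real \<Rightarrow> real" and \<alpha> cl cu s1 s2 :: real
  assumes N: "is_norm N" and \<alpha>: "0 < \<alpha>" "\<alpha> < 1" and s: "0 < s1" "0 < s2"
    and lnorm_lower: "s1 * real (supn x) \<le> lnorm N x" and lnorm_upper: "lnorm N x \<le> s2 * real (supn x)"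
    and J_pos: "0 < r \<Longrightarrow> 0 < J r" and J_antimono: "0 < r \<Longrightarrow> r \<le> r' \<Longrightarrow> J r' \<le> J r"
    and c_pos: "0 < cl" "0 < cu"
    and J_lower: "min s1 1 \<le> r \<Longrightarrow> cl * r powr (- (real CARD('d) + \<alpha>)) \<le> J r"
    and J_upper: "min s1 1 \<le> r \<Longrightarrow> J r \<le> cu * r powr (- (real CARD('d) + \<alpha>))"
begin

abbreviation "\<nu> \<equiv> lnorm N"
abbreviation "P \<equiv> edge_prob (edge_weight (lr_kernel N J))"

text \<open>The cutoff kernel in closed form, with the integral of |J'| evaluated. Subtracting J r,
  rather than only discarding long edges, keeps the change between two cutoffs small for short edges
  as well.\<close>

definition trunc :: "real \<Rightarrow> int ^ 'd \<Rightarrow> int ^ 'd \<Rightarrow> real" where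
  "trunc r x y = (if x \<noteq> y \<and> \<nu> (x - y) \<le> r then J (\<nu> (x - y)) - J r else 0)"

abbreviation "Q r \<equiv> edge_prob (edge_weight (trunc r))"

lemma lnorm_pos: "x \<noteq> 0 \<Longrightarrow> s1 \<le> \<nu> x" "x \<noteq> 0 \<Longrightarrow> 0 < \<nu> x"
proof -
  assume "x \<noteq> 0"
  then have "1 \<le> real (supn x)" using supn_pos[of x] by simp
  then have "s1 * 1 \<le> s1 * real (supn x)" using s by (intro mult_left_mono) auto
  with lnorm_lower[of x] show "s1 \<le> \<nu> x" by simp
  with s show "0 < \<nu> x" by simp
qed

lemma lnorm_commute: "\<nu> (x - y) = \<nu> (y - x)"
  using lnorm_minus[OF N, of "x - y"] by simp

lemma lnorm_subadd: "\<nu> (x + y) \<le> \<nu> x + \<nu> y"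
  by (rule lnorm_triangle[OF N])

sublocale full: lattice_kernel "lr_kernel N J"
proof
  fix x y z :: "int ^ 'd"
  show "lr_kernel N J x y = lr_kernel N J y x"
    by (simp add: lr_kernel_def lattice_dist_lnorm lnorm_commute[of x y])
  show "0 \<le> lr_kernel N J x y"
    using less_imp_le[OF J_pos[OF lnorm_pos(2)], of "x - y"] by (simp add: lr_kernel_def lattice_dist_lnorm)
  show "lr_kernel N J (z + x) (z + y) = lr_kernel N J x y"
    by (simp add: lr_kernel_def lattice_dist_lnorm)
qed

lemma trunc_nonneg: "0 \<le> trunc r x y"
  using J_antimono[OF lnorm_pos(2), of "x - y" r] by (simp add: trunc_def)

lemma trunc_lattice_kernel: "lattice_kernel (trunc r)"
proof
  fix x y z :: "int ^ 'd"
  show "trunc r x y = trunc r y x" unfolding trunc_def lnorm_commute[of x y] by (simp add: eq_commute)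
  show "0 \<le> trunc r x y" by (rule trunc_nonneg)
  show "trunc r (z + x) (z + y) = trunc r x y" by (simp add: trunc_def)
qed

lemma trunc_le_J: "x \<noteq> y \<Longrightarrow> 0 < r \<Longrightarrow> trunc r x y \<le> J (\<nu> (x - y))"
  using J_pos[of r] J_pos[OF lnorm_pos(2), of "x - y"] by (simp add: trunc_def)

lemma trunc_le_full: "0 < r \<Longrightarrow> trunc r x y \<le> lr_kernel N J x y"
  using trunc_le_J[of x y r] by (cases "x = y") (auto simp: lr_kernel_def lattice_dist_lnorm trunc_def)

lemma Q_pair: "Q r b {x, y} = 1 - exp (- b * trunc r x y)"
  by (rule symmetric_kernel.p_pair) (rule lattice_kernel.axioms(1)[OF trunc_lattice_kernel])

lemma probs_Q: "finite V \<Longrightarrow> 0 \<le> b \<Longrightarrow> probs (edges_in V) (Q r b)"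
  by (rule symmetric_kernel.probs_p) (rule lattice_kernel.axioms(1)[OF trunc_lattice_kernel])

lemma Q_nonneg: "0 \<le> b \<Longrightarrow> 0 \<le> Q r b {x, y}"
  using trunc_nonneg[of r x y] by (simp add: Q_pair)

lemma Q_le: "Q r b {x, y} \<le> b * trunc r x y"
  using exp_ge_add_one_self[of "- b * trunc r x y"] by (simp add: Q_pair)

lemma Q_zero: "r < \<nu> (x - y) \<Longrightarrow> Q r b {x, y} = 0"
  by (simp add: Q_pair trunc_def)

lemma Q_le_P: "0 < r \<Longrightarrow> 0 \<le> b \<Longrightarrow> e \<in> edges_in V \<Longrightarrow> Q r b e \<le> P b e"
  using mult_left_mono[OF trunc_le_full, of r b]
  by (auto simp: edges_in_def Q_pair full.p_pair)

lemma tau_Q_le_P: "finite V \<Longrightarrow> 0 < r \<Longrightarrow> 0 \<le> b \<Longrightarrow> tau V (Q r b) x y \<le> tau V (P b) x y"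
  by (intro tau_mono_prob probs_Q full.probs_p Q_le_P)

lemma full_lower:
  assumes "x \<noteq> y"
  shows "cl * s2 powr (- (real CARD('d) + \<alpha>)) * real (supn (x - y)) powr (- (real CARD('d) + \<alpha>)) \<le> lr_kernel N J x y"
proof -
  have xy: "x - y \<noteq> 0" using assms by simp
  have sup: "1 \<le> real (supn (x - y))" using supn_pos[OF xy] by simp
  have "cl * (s2 * real (supn (x - y))) powr (- (real CARD('d) + \<alpha>)) \<le> cl * \<nu> (x - y) powr (- (real CARD('d) + \<alpha>))"
    using c_pos \<alpha> lnorm_pos[OF xy] lnorm_upper by (intro mult_left_mono powr_mono2') auto
  also have "\<dots> \<le> J (\<nu> (x - y))" using lnorm_pos(1)[OF xy] by (intro J_lower) auto
  finally show ?thesis using assms s sup by (simp add: lr_kernel_def lattice_dist_lnorm powr_mult)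
qed

definition percolating :: "real \<Rightarrow> bool" where
  "percolating b \<longleftrightarrow> 0 < measure (percolation (lr_kernel N J) b)
    {\<omega> \<in> space (percolation (lr_kernel N J) b). \<exists>x. infinite (cluster \<omega> x)}"

text \<open>The constant depends on the kernel alone and b enters only through 1 / b, so the
  estimate persists as b approaches a positive critical point from below.\<close>

lemma cube_susceptibility_bound:
  "\<exists>A>0. \<forall>b b' n. 0 < b \<longrightarrow> b < b' \<longrightarrow> \<not> percolating b' \<longrightarrow> 1 \<le> n \<longrightarrow>
    (\<Sum>y\<in>cube n. tau (cube n) (P b) 0 y) \<le> A / b * real n powr \<alpha>"
proof -
  obtain k where k: "2 \<le> k" "1024 * real k powr (real CARD('d) + \<alpha>) \<le> real k ^ CARD('d) * (real k ^ CARD('d) - 1)"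
    using exists_growth_scale[of "CARD('d)" \<alpha>] \<alpha> by auto
  define cl' where "cl' = cl * s2 powr (- (real CARD('d) + \<alpha>))"
  have cl': "0 < cl'" using c_pos s by (simp add: cl'_def)
  define A where "A = 2 * real (5 * k) powr (real CARD('d) + \<alpha>) / cl'"
  have "0 < A" using k(1) cl' by (simp add: A_def)
  moreover have "(\<Sum>y\<in>cube n. tau (cube n) (P b) 0 y) \<le> A / b * real n powr \<alpha>"
    if b: "0 < b" "b < b'" "\<not> percolating b'" and n: "1 \<le> n" for b b' n
  proof -
    have "\<exists>X. \<forall>V x. finite V \<longrightarrow> x \<in> V \<longrightarrow> (\<Sum>y\<in>V. tau V (P b) x y) \<le> X"
      by (rule full.susceptibility_finite[OF _ b(2) b(3)[unfolded percolating_def]]) (use b in simp)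
    then obtain X where X: "\<And>V x. finite V \<Longrightarrow> x \<in> V \<Longrightarrow> (\<Sum>y\<in>V. tau V (P b) x y) \<le> X" by blast
    have "(\<Sum>y\<in>cube n. tau (cube n) (P b) 0 y) \<le> 2 * real (5 * k) powr (real CARD('d) + \<alpha>) / (b * cl') * real n powr \<alpha>"
      by (rule full.cube_susceptibility[OF b(1) cl' \<alpha>(1) _ k(2,1) X n]) (use full_lower in \<open>auto simp: cl'_def\<close>)
    also have "\<dots> = A / b * real n powr \<alpha>" using b cl' by (simp add: A_def field_simps)
    finally show ?thesis .
  qed
  ultimately show ?thesis by blast
qed

text \<open>Without percolation the susceptibility bound would hold at all b; at b = 2 A and n = 1
  it gives 1 / 2, while a cluster always contains its own vertex. Hence the infimum defining the
  critical point is over a nonempty set.\<close>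

lemma percolating_exists: "\<exists>b\<ge>0. percolating b"
proof (rule ccontr)
  assume *: "\<not> ?thesis"
  obtain A where A: "0 < A" "\<And>b b' n. 0 < b \<Longrightarrow> b < b' \<Longrightarrow> \<not> percolating b' \<Longrightarrow> 1 \<le> n \<Longrightarrow>
    (\<Sum>y\<in>cube n. tau (cube n) (P b) 0 y) \<le> A / b * real n powr \<alpha>"
    using cube_susceptibility_bound by blast
  have "(\<Sum>y\<in>cube 1. tau (cube 1) (P (2 * A)) 0 y) \<le> A / (2 * A) * real 1 powr \<alpha>"
    using * A(1) by (intro A(2)[of _ "2 * A + 1"]) auto
  also have "\<dots> < 1" using A(1) by simp
  finally have "(\<Sum>y\<in>cube 1. tau (cube 1) (P (2 * A)) 0 y) < 1" .
  moreover have "tau (cube 1) (P (2 * A)) 0 0 \<le> (\<Sum>y\<in>cube 1. tau (cube 1) (P (2 * A)) 0 (y :: int ^ 'd))"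
    using A(1) by (intro member_le_sum tau_nonneg full.probs_p) auto
  moreover have "tau (cube 1) (P (2 * A)) 0 (0 :: int ^ 'd) = 1"
    unfolding tau_def prb_def by (simp add: finite_edges_in)
  ultimately show False by simp
qed

text \<open>Edges of the truncated kernel have sup length at most r / s1 and weight at most a
  multiple of their length to the power - (d + \<alpha>), so the shell sum applies.\<close>

lemma trunc_first_moment:
  "\<exists>A>0. \<forall>r V. 0 < r \<longrightarrow> finite V \<longrightarrow> (\<Sum>x\<in>V. trunc r 0 x * real (supn x)) \<le> A * r powr (1 - \<alpha>)"
proof -
  define D where "D = 2 * real CARD('d) * 3 ^ CARD('d) / (1 - \<alpha>)"
  have D: "0 < D" using \<alpha> by (simp add: D_def)
  define A where "A = cu * s1 powr (- (real CARD('d) + \<alpha>)) * D * (1 / s1) powr (1 - \<alpha>)"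
  have "0 < A" using D c_pos s by (simp add: A_def)
  moreover have "(\<Sum>x\<in>V. trunc r 0 x * real (supn x)) \<le> A * r powr (1 - \<alpha>)" if r: "0 < r" "finite V" for r V
  proof -
    define n where "n = nat \<lfloor>r / s1\<rfloor>"
    have nr: "real n \<le> r / s1" using r s by (simp add: n_def)
    let ?B = "{x :: int ^ 'd. supn x \<in> {1..n}}"
    have finB: "finite ?B" by (rule finite_subset[OF _ finite_cube[of n]]) (auto simp: cube_def)
    have zero: "trunc r 0 x = 0" if "x \<notin> ?B" for x
    proof (cases "x = 0")
      case False
      then have "n < supn x" using that supn_pos[OF False] by auto
      then have "r / s1 < real (supn x)" unfolding n_def using r s by linarith
      then have "r < s1 * real (supn x)" using s by (simp add: field_simps)
      also have "\<dots> \<le> \<nu> (0 - x)" using lnorm_lower[of x] lnorm_commute[of 0 x] by simp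
      finally show ?thesis by (simp add: trunc_def)
    qed (simp add: trunc_def)
    have le: "trunc r 0 x \<le> cu * s1 powr (- (real CARD('d) + \<alpha>)) * real (supn x) powr (- (real CARD('d) + \<alpha>))" if "x \<in> ?B" for x
    proof -
      have x: "x \<noteq> 0" using that by auto
      have sx: "0 < s1 * real (supn x)" using that s by auto
      have "trunc r 0 x \<le> J (\<nu> (0 - x))" using x r by (intro trunc_le_J) auto
      also have "\<nu> (0 - x) = \<nu> x" using lnorm_commute[of 0 x] by simp
      also have "J (\<nu> x) \<le> cu * \<nu> x powr (- (real CARD('d) + \<alpha>))" using lnorm_pos(1)[OF x] by (intro J_upper) auto
      also have "\<dots> \<le> cu * (s1 * real (supn x)) powr (- (real CARD('d) + \<alpha>))"
        using c_pos \<alpha> sx lnorm_lower by (intro mult_left_mono powr_mono2') auto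
      finally show ?thesis using s by (simp add: powr_mult)
    qed
    have "(\<Sum>x\<in>V. trunc r 0 x * real (supn x)) = (\<Sum>x\<in>V \<inter> ?B. trunc r 0 x * real (supn x))"
      using r(2) zero by (intro sum.mono_neutral_right) auto
    also have "\<dots> \<le> (\<Sum>x\<in>?B. trunc r 0 x * real (supn x))"
      by (intro sum_mono2 finB mult_nonneg_nonneg trunc_nonneg) auto
    also have "\<dots> \<le> (\<Sum>x\<in>?B. cu * s1 powr (- (real CARD('d) + \<alpha>)) * real (supn x) powr (- (real CARD('d) + \<alpha>)) * real (supn x))"
      by (intro sum_mono mult_right_mono le) auto
    also have "\<dots> = cu * s1 powr (- (real CARD('d) + \<alpha>)) * (\<Sum>x\<in>?B. real (supn x) powr (- (real CARD('d) + \<alpha>)) * real (supn x))"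
      by (simp add: sum_distrib_left mult_ac)
    also have "\<dots> \<le> cu * s1 powr (- (real CARD('d) + \<alpha>)) * (D * real n powr (1 - \<alpha>))"
      unfolding D_def using c_pos by (intro mult_left_mono lattice_first_moment \<alpha>) auto
    also have "\<dots> \<le> cu * s1 powr (- (real CARD('d) + \<alpha>)) * (D * (r / s1) powr (1 - \<alpha>))"
      using c_pos D nr \<alpha> by (intro mult_left_mono powr_mono2) auto
    also have "\<dots> = A * r powr (1 - \<alpha>)" using r s by (simp add: A_def powr_divide mult_ac)
    finally show ?thesis .
  qed
  ultimately show ?thesis by blast
qed

text \<open>The average over s counts an edge from a to d at most |d - a| times; as alpha < 1,
  the resulting first moment of the truncated kernel is of order r^(1 - alpha).\<close>

lemma boundary_sum_average:
  assumes b: "0 \<le> b" and r: "0 < r" and n: "1 \<le> n"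
    and A: "\<And>V. finite V \<Longrightarrow> (\<Sum>x\<in>V. trunc r 0 x * real (supn x)) \<le> A"
    and M: "(\<Sum>y\<in>cube (2 * n). tau (cube (2 * n)) (P b) 0 y) \<le> M"
  shows "\<exists>s\<in>{n+1..2*n}. \<forall>V. finite V \<longrightarrow>
    (\<Sum>a\<in>cube s. \<Sum>d\<in>V - cube s. tau (cube s) (Q r b) 0 a * Q r b {a, d}) \<le> M * (b * A) / real n"
proof -
  \<comment> \<open>No edge of the truncated kernel has sup length above \<open>R\<close>, so from
    \<open>cube (2 * n)\<close> all of them end in \<open>W\<close>. Sums over arbitrary finite
    \<open>V\<close> are thus dominated by one sum over \<open>W\<close>, and a radius chosen for
    \<open>W\<close> works for all \<open>V\<close>.\<close>
  define R where "R = nat \<lfloor>r / s1\<rfloor>"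
  define W where "W = (cube (2 * n + R) :: (int ^ 'd) set)"
  define F where "F s = (\<Sum>a\<in>cube s. \<Sum>d\<in>W - cube s. tau (cube s) (Q r b) 0 a * Q r b {a, d})" for s
  let ?C = "cube (2 * n) :: (int ^ 'd) set"
  let ?T = "tau ?C (P b) 0"
  have prP: "probs (edges_in ?C) (P b)" using b by (intro full.probs_p) auto
  have prQ: "probs (edges_in (cube s)) (Q r b)" for s using b by (intro probs_Q) auto
  have T0: "0 \<le> ?T a" for a by (rule tau_nonneg[OF prP])
  have A0: "0 \<le> A" using A[of "{}"] by simp
  have Qout: "Q r b {a, d} = 0" if "a \<in> ?C" "d \<notin> W" for a d
  proof (rule Q_zero)
    have "2 * n + R < supn d" using that by (simp add: W_def cube_def)
    moreover have "supn d \<le> supn a + supn (d - a)" using supn_triangle[of a "d - a"] by simp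
    moreover have "supn a \<le> 2 * n" using that by (simp add: cube_def)
    ultimately have "R < supn (d - a)" by linarith
    then have "r / s1 < real (supn (d - a))" unfolding R_def using r s by linarith
    then have "r < s1 * real (supn (d - a))" using s by (simp add: field_simps)
    also have "\<dots> \<le> \<nu> (a - d)" using lnorm_lower[of "d - a"] lnorm_commute[of a d] by simp
    finally show "r < \<nu> (a - d)" .
  qed
  have FV: "(\<Sum>a\<in>cube s. \<Sum>d\<in>V - cube s. tau (cube s) (Q r b) 0 a * Q r b {a, d}) \<le> F s"
    if s: "s \<in> {n+1..2*n}" and V: "finite V" for s V
    unfolding F_def
  proof (rule sum_mono)
    fix a :: "int ^ 'd" assume a: "a \<in> cube s"
    then have aC: "a \<in> ?C" using s cube_mono[of s "2 * n"] by auto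
    let ?g = "\<lambda>d. tau (cube s) (Q r b) 0 a * Q r b {a, d}"
    have "(\<Sum>d\<in>V - cube s. ?g d) = (\<Sum>d\<in>(V \<inter> W) - cube s. ?g d)"
      using V Qout[OF aC] by (intro sum.mono_neutral_right) auto
    also have "\<dots> \<le> (\<Sum>d\<in>W - cube s. ?g d)"
      by (intro sum_mono2 mult_nonneg_nonneg tau_nonneg[OF prQ] Q_nonneg b) (auto simp: W_def)
    finally show "(\<Sum>d\<in>V - cube s. ?g d) \<le> (\<Sum>d\<in>W - cube s. ?g d)" .
  qed
  have F1: "F s \<le> (\<Sum>a\<in>?C. \<Sum>d\<in>W. of_bool (supn a \<le> s \<and> s < supn d) * (?T a * (b * trunc r a d)))"
    (is "_ \<le> (\<Sum>a\<in>?C. \<Sum>d\<in>W. ?f a d)") if s: "s \<in> {n+1..2*n}" for s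
  proof -
    have sub: "cube s \<subseteq> ?C" using s by (intro cube_mono) auto
    have f0: "0 \<le> ?f a d" for a d
      by (intro mult_nonneg_nonneg T0 b trunc_nonneg) auto
    have "F s \<le> (\<Sum>a\<in>cube s. \<Sum>d\<in>W - cube s. ?f a d)"
      unfolding F_def
    proof (intro sum_mono)
      fix a d :: "int ^ 'd" assume ad: "a \<in> cube s" "d \<in> W - cube s"
      have "tau (cube s) (Q r b) 0 a \<le> tau (cube s) (P b) 0 a" using r b by (intro tau_Q_le_P) auto
      also have "\<dots> \<le> ?T a" by (rule tau_mono_set[OF prP sub])
      finally have "tau (cube s) (Q r b) 0 a * Q r b {a, d} \<le> ?T a * (b * trunc r a d)"
        using T0 Q_le Q_nonneg[OF b] by (intro mult_mono) auto
      then show "tau (cube s) (Q r b) 0 a * Q r b {a, d} \<le> ?f a d" using ad by (simp add: cube_def)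
    qed
    also have "\<dots> \<le> (\<Sum>a\<in>cube s. \<Sum>d\<in>W. ?f a d)"
      by (intro sum_mono sum_mono2 f0) (auto simp: W_def)
    also have "\<dots> \<le> (\<Sum>a\<in>?C. \<Sum>d\<in>W. ?f a d)"
      by (intro sum_mono2 sub sum_nonneg f0) auto
    finally show ?thesis .
  qed
  have "(\<Sum>s=n+1..2*n. F s) \<le> (\<Sum>s=n+1..2*n. \<Sum>a\<in>?C. \<Sum>d\<in>W. of_bool (supn a \<le> s \<and> s < supn d) * (?T a * (b * trunc r a d)))"
    by (intro sum_mono F1)
  also have "\<dots> = (\<Sum>a\<in>?C. \<Sum>s=n+1..2*n. \<Sum>d\<in>W. of_bool (supn a \<le> s \<and> s < supn d) * (?T a * (b * trunc r a d)))"
    by (rule sum.swap)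
  also have "\<dots> = (\<Sum>a\<in>?C. \<Sum>d\<in>W. \<Sum>s=n+1..2*n. of_bool (supn a \<le> s \<and> s < supn d) * (?T a * (b * trunc r a d)))"
    by (rule sum.cong[OF refl], rule sum.swap)
  also have "\<dots> \<le> (\<Sum>a\<in>?C. \<Sum>d\<in>W. real (supn (d - a)) * (?T a * (b * trunc r a d)))"
  proof (intro sum_mono)
    fix a d :: "int ^ 'd"
    have "(\<Sum>s=n+1..2*n. of_bool (supn a \<le> s \<and> s < supn d)) = real (card {s \<in> {n+1..2*n}. supn a \<le> s \<and> s < supn d})"
      by (simp add: sum.If_cases of_bool_def Int_def conj_commute)
    also have "\<dots> \<le> real (card {supn a..<supn d})"
      by (intro of_nat_mono card_mono) auto
    also have "\<dots> \<le> real (supn (d - a))" using supn_triangle[of a "d - a"] by simp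
    finally have le: "(\<Sum>s=n+1..2*n. of_bool (supn a \<le> s \<and> s < supn d)) \<le> real (supn (d - a))" .
    show "(\<Sum>s=n+1..2*n. of_bool (supn a \<le> s \<and> s < supn d) * (?T a * (b * trunc r a d)))
        \<le> real (supn (d - a)) * (?T a * (b * trunc r a d))"
      unfolding sum_distrib_right[symmetric]
      by (intro mult_right_mono le mult_nonneg_nonneg T0 b trunc_nonneg)
  qed
  also have "\<dots> = (\<Sum>a\<in>?C. ?T a * (b * (\<Sum>d\<in>W. trunc r a d * real (supn (d - a)))))"
    by (simp add: sum_distrib_left mult_ac)
  also have "\<dots> \<le> (\<Sum>a\<in>?C. ?T a * (b * A))"
  proof (intro sum_mono mult_left_mono T0 b)
    fix a :: "int ^ 'd"
    have "(\<Sum>d\<in>W. trunc r a d * real (supn (d - a))) = (\<Sum>u\<in>(\<lambda>d. d - a) ` W. trunc r 0 u * real (supn u))"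
    proof -
      have "trunc r a d = trunc r 0 (d - a)" for d
        using lattice_kernel.K_shift[OF trunc_lattice_kernel, of r a 0 "d - a"] by simp
      moreover have "inj_on (\<lambda>d. d - a) W" by (simp add: inj_on_def)
      ultimately show ?thesis by (simp add: sum.reindex)
    qed
    also have "\<dots> \<le> A" by (rule A) (simp add: W_def)
    finally show "(\<Sum>d\<in>W. trunc r a d * real (supn (d - a))) \<le> A" .
  qed
  also have "\<dots> \<le> M * (b * A)"
    unfolding sum_distrib_right[symmetric] using M b A0 by (intro mult_right_mono) auto
  finally have total: "(\<Sum>s=n+1..2*n. F s) \<le> M * (b * A)" .
  \<comment> \<open>Pigeonhole over the n candidate radii: one of them does no worse than the
    average.\<close>
  have "\<exists>s\<in>{n+1..2*n}. F s \<le> M * (b * A) / real n"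
  proof (rule ccontr)
    assume "\<not> ?thesis"
    then have "M * (b * A) / real n < F s" if "s \<in> {n+1..2*n}" for s
      using that not_le by blast
    then have "(\<Sum>s=n+1..2*n. M * (b * A) / real n) < (\<Sum>s=n+1..2*n. F s)"
      using n by (intro sum_strict_mono) auto
    moreover have "(\<Sum>s=n+1..2*n. M * (b * A) / real n) = M * (b * A)" using n by simp
    ultimately show False using total by linarith
  qed
  then show ?thesis using FV order_trans by blast
qed

text \<open>For a cube of radius about \<open>\<kappa>\<close> r the averaged boundary sum is at
  most 1 / 4, and \<open>c\<close> is so small that the exponential weight stays below 2 on the cube
  and one edge beyond it. The weighted boundary sum is then at most 1 / 2, as the global bound
  requires.\<close>

lemma weighted_trunc_susceptibility:
  assumes lo: "0 < lo" "lo \<le> hi"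
  shows "\<exists>c>0. \<exists>G>0. \<forall>b b' r V x. lo \<le> b \<longrightarrow> b \<le> hi \<longrightarrow> b < b' \<longrightarrow> \<not> percolating b' \<longrightarrow>
    1 \<le> r \<longrightarrow> finite V \<longrightarrow> x \<in> V \<longrightarrow>
    (\<Sum>y\<in>V. tau V (Q r b) x y * exp (c * \<nu> (y - x) / r)) \<le> G * r powr \<alpha>"
proof -
  obtain A0 where A0: "0 < A0" "\<And>b b' n. 0 < b \<Longrightarrow> b < b' \<Longrightarrow> \<not> percolating b' \<Longrightarrow> 1 \<le> n \<Longrightarrow>
    (\<Sum>y\<in>cube n. tau (cube n) (P b) 0 y) \<le> A0 / b * real n powr \<alpha>"
    using cube_susceptibility_bound by blast
  obtain Cm where Cm: "0 < Cm" "\<And>r V. 0 < r \<Longrightarrow> finite V \<Longrightarrow>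
    (\<Sum>x\<in>V. trunc r 0 x * real (supn x)) \<le> Cm * r powr (1 - \<alpha>)"
    using trunc_first_moment by blast
  define X where "X = A0 / lo * 2 powr \<alpha>"
  have X: "0 < X" using A0 lo by (simp add: X_def)
  define Y where "Y = 4 * (X * (hi * Cm))"
  have Y: "0 < Y" using X Cm lo by (simp add: Y_def)
  \<comment> \<open>The averaged boundary sum is at most X hi Cm times \<open>\<kappa>\<close> to
    the power \<alpha> - 1, a negative exponent; this choice brings it down to 1 / 4.\<close>
  define \<kappa> where "\<kappa> = max 1 (Y powr (1 / (1 - \<alpha>)))"
  have \<kappa>: "1 \<le> \<kappa>" by (simp add: \<kappa>_def)
  have \<kappa>Y: "X * (hi * Cm) * \<kappa> powr (\<alpha> - 1) \<le> 1 / 4"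
  proof -
    have "Y = (Y powr (1 / (1 - \<alpha>))) powr (1 - \<alpha>)" using Y \<alpha> by (simp add: powr_powr)
    also have "\<dots> \<le> \<kappa> powr (1 - \<alpha>)" using \<alpha> by (intro powr_mono2) (auto simp: \<kappa>_def)
    finally have "Y * \<kappa> powr (\<alpha> - 1) \<le> \<kappa> powr (1 - \<alpha>) * \<kappa> powr (\<alpha> - 1)" by (intro mult_right_mono) auto
    also have "\<dots> = 1" using \<kappa> by (simp flip: powr_add)
    finally show ?thesis by (simp add: Y_def)
  qed
  \<comment> \<open>Points of a cube of radius 2 n \<le> 2 (\<kappa> + 1) r, and points one edge of
    length at most r further, have norm at most E r. With c = ln 2 / E the weight there is at most
    2.\<close>
  define E where "E = 2 * (\<kappa> + 1) * s2 + 1"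
  have E: "0 < E" using \<kappa> s by (simp add: E_def add_pos_pos)
  define c where "c = ln 2 / E"
  have c: "0 < c" using E by (simp add: c_def)
  \<comment> \<open>One factor 2 comes from the weight on the cube, the other from passing from the
    local to the global bound.\<close>
  define G where "G = 4 * X * (\<kappa> + 1) powr \<alpha>"
  have G: "0 < G" using X \<kappa> by (simp add: G_def)
  have "(\<Sum>y\<in>V. tau V (Q r b) x y * exp (c * \<nu> (y - x) / r)) \<le> G * r powr \<alpha>"
    if b: "lo \<le> b" "b \<le> hi" "b < b'" "\<not> percolating b'" and r: "1 \<le> r" and V: "finite V" "x \<in> V" for b b' r V x
  proof -
    have b0: "0 < b" using b lo by simp
    define n where "n = nat \<lceil>\<kappa> * r\<rceil>"
    have \<kappa>r: "1 \<le> \<kappa> * r" using \<kappa> r mult_mono[of 1 \<kappa> 1 r] by simp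
    have n: "\<kappa> * r \<le> real n" "real n \<le> (\<kappa> + 1) * r" "1 \<le> n"
    proof -
      show n1: "\<kappa> * r \<le> real n" unfolding n_def by linarith
      have "real n \<le> \<kappa> * r + 1" unfolding n_def using \<kappa>r by linarith
      then show "real n \<le> (\<kappa> + 1) * r" using r by (simp add: algebra_simps)
      show "1 \<le> n" using n1 \<kappa>r by linarith
    qed
    define M where "M = X * real n powr \<alpha>"
    have M0: "0 \<le> M" using X by (simp add: M_def)
    have M: "(\<Sum>y\<in>cube (2 * n). tau (cube (2 * n)) (P b) 0 y) \<le> M"
    proof -
      have "(\<Sum>y\<in>cube (2 * n). tau (cube (2 * n)) (P b) 0 y) \<le> A0 / b * real (2 * n) powr \<alpha>"
        using n by (intro A0(2)[OF b0 b(3,4)]) auto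
      also have "\<dots> \<le> A0 / lo * real (2 * n) powr \<alpha>"
        using A0 b lo by (intro mult_right_mono divide_left_mono) auto
      finally show ?thesis by (simp add: M_def X_def powr_mult)
    qed
    have "\<exists>s\<in>{n+1..2*n}. \<forall>V. finite V \<longrightarrow>
      (\<Sum>a\<in>cube s. \<Sum>d\<in>V - cube s. tau (cube s) (Q r b) 0 a * Q r b {a, d}) \<le> M * (b * (Cm * r powr (1 - \<alpha>))) / real n"
      using b0 r n by (intro boundary_sum_average M Cm(2)) auto
    then obtain s where s': "s \<in> {n+1..2*n}" and Fs: "\<And>V. finite V \<Longrightarrow>
      (\<Sum>a\<in>cube s. \<Sum>d\<in>V - cube s. tau (cube s) (Q r b) 0 a * Q r b {a, d}) \<le> M * (b * (Cm * r powr (1 - \<alpha>))) / real n"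
      by blast
    have quarter: "M * (b * (Cm * r powr (1 - \<alpha>))) / real n \<le> 1 / 4"
    proof -
      have n0: "0 < real n" using n by simp
      have "M * (b * (Cm * r powr (1 - \<alpha>))) / real n = X * (b * Cm) * r powr (1 - \<alpha>) * (real n powr \<alpha> * real n powr (- 1))"
        using n0 by (simp add: M_def powr_minus field_simps)
      also have "\<dots> = X * (b * Cm) * r powr (1 - \<alpha>) * real n powr (\<alpha> - 1)"
        by (simp add: powr_diff powr_minus field_simps)
      also have "\<dots> \<le> X * (hi * Cm) * r powr (1 - \<alpha>) * (\<kappa> * r) powr (\<alpha> - 1)"
      proof -
        have 1: "real n powr (\<alpha> - 1) \<le> (\<kappa> * r) powr (\<alpha> - 1)"
          using \<kappa>r n(1) \<alpha> by (intro powr_mono2') linarith+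
        have 2: "X * (b * Cm) * r powr (1 - \<alpha>) \<le> X * (hi * Cm) * r powr (1 - \<alpha>)"
          using X b Cm(1) by (intro mult_right_mono mult_left_mono) auto
        show ?thesis by (rule mult_mono[OF 2 1]) (use X lo Cm(1) in auto)
      qed
      also have "\<dots> = X * (hi * Cm) * \<kappa> powr (\<alpha> - 1) * (r powr (1 - \<alpha>) * r powr (\<alpha> - 1))"
        using \<kappa> r by (simp add: powr_mult)
      also have "\<dots> \<le> 1 / 4" using \<kappa>Y r by (simp flip: powr_add)
      finally show ?thesis .
    qed
    define h where "h u = exp (c * \<nu> u / r)" for u :: "int ^ 'd"
    have h1: "h u \<le> 2" if "\<nu> u \<le> 2 * real n * s2 + r" for u
    proof -
      have "2 * real n * s2 \<le> 2 * ((\<kappa> + 1) * r) * s2"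
        using n(2) s by (intro mult_right_mono mult_left_mono) auto
      then have "\<nu> u \<le> 2 * ((\<kappa> + 1) * r) * s2 + r" using that by linarith
      also have "\<dots> = E * r" by (simp add: E_def algebra_simps)
      finally have "c * \<nu> u / r \<le> c * (E * r) / r" using c r by (intro divide_right_mono mult_left_mono) auto
      also have "\<dots> = ln 2" using E r by (simp add: c_def)
      finally have "h u \<le> exp (ln 2)" unfolding h_def by (subst exp_le_cancel_iff)
      then show ?thesis by simp
    qed
    have lnC: "\<nu> a \<le> 2 * real n * s2" if "a \<in> cube s" for a
    proof -
      have "real (supn a) \<le> 2 * real n" using that s' by (simp add: cube_def)
      then have "s2 * real (supn a) \<le> s2 * (2 * real n)" using s by (intro mult_left_mono) auto
      with lnorm_upper[of a] show ?thesis by (simp add: mult_ac)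
    qed
    have prs: "probs (edges_in (cube s)) (Q r b)" using b0 by (intro probs_Q) auto
    have prP: "probs (edges_in (cube (2 * n) :: (int ^ 'd) set)) (P b)" using b0 by (intro full.probs_p) auto
    have "(\<Sum>y\<in>V. tau V (Q r b) x y * h (y - x)) \<le> 2 * (2 * M)"
    proof (rule lattice_kernel.local_to_global[OF trunc_lattice_kernel _ finite_cube[of s] zero_in_cube _ _ _ _ V])
      show "0 \<le> b" using b0 by simp
      show "0 \<le> h u" for u by (simp add: h_def)
      show "h (u + v) \<le> h u * h v" for u v
      proof -
        have "c * \<nu> (u + v) / r \<le> c * \<nu> u / r + c * \<nu> v / r"
          using lnorm_subadd[of u v] c r by (simp add: mult_left_mono divide_right_mono flip: add_divide_distrib distrib_left)
        then show ?thesis by (simp add: h_def flip: exp_add)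
      qed
      have "(\<Sum>y\<in>cube s. tau (cube s) (Q r b) 0 y * h y) \<le> (\<Sum>y\<in>cube s. tau (cube (2 * n)) (P b) 0 y * 2)"
      proof (intro sum_mono mult_mono h1)
        fix y :: "int ^ 'd" assume y: "y \<in> cube s"
        show "\<nu> y \<le> 2 * real n * s2 + r" using lnC[OF y] r by simp
        have "tau (cube s) (Q r b) 0 y \<le> tau (cube s) (P b) 0 y" using r b0 by (intro tau_Q_le_P) auto
        also have "\<dots> \<le> tau (cube (2 * n)) (P b) 0 y" using s' by (intro tau_mono_set[OF prP] cube_mono) auto
        finally show "tau (cube s) (Q r b) 0 y \<le> tau (cube (2 * n)) (P b) 0 y" .
      qed (auto simp: h_def intro: tau_nonneg[OF prP])
      also have "\<dots> \<le> (\<Sum>y\<in>cube (2 * n). tau (cube (2 * n)) (P b) 0 y * 2)"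
        using s' by (intro sum_mono2 mult_nonneg_nonneg tau_nonneg[OF prP] cube_mono) auto
      also have "\<dots> \<le> 2 * M" using M by (simp flip: sum_distrib_right)
      finally show "(\<Sum>y\<in>cube s. tau (cube s) (Q r b) 0 y * h y) \<le> 2 * M" .
      fix V :: "(int ^ 'd) set" assume V: "finite V"
      have "(\<Sum>a\<in>cube s. \<Sum>d\<in>V - cube s. tau (cube s) (Q r b) 0 a * Q r b {a, d} * h d)
         \<le> (\<Sum>a\<in>cube s. \<Sum>d\<in>V - cube s. tau (cube s) (Q r b) 0 a * Q r b {a, d} * 2)"
      proof (intro sum_mono)
        fix a d :: "int ^ 'd" assume ad: "a \<in> cube s"
        show "tau (cube s) (Q r b) 0 a * Q r b {a, d} * h d \<le> tau (cube s) (Q r b) 0 a * Q r b {a, d} * 2"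
        proof (cases "\<nu> (a - d) \<le> r")
          case True
          have "\<nu> d \<le> \<nu> a + \<nu> (d - a)" using lnorm_subadd[of a "d - a"] by simp
          then have "\<nu> d \<le> 2 * real n * s2 + r" using lnC[OF ad] True lnorm_commute[of a d] by simp
          then show ?thesis
            using b0 by (intro mult_left_mono h1 mult_nonneg_nonneg tau_nonneg[OF prs] Q_nonneg) auto
        qed (simp add: Q_zero)
      qed
      also have "\<dots> = (\<Sum>a\<in>cube s. \<Sum>d\<in>V - cube s. tau (cube s) (Q r b) 0 a * Q r b {a, d}) * 2"
        by (simp add: sum_distrib_right)
      also have "\<dots> \<le> 1 / 2" using Fs[OF V] quarter by linarith
      finally show "(\<Sum>a\<in>cube s. \<Sum>d\<in>V - cube s. tau (cube s) (Q r b) 0 a * Q r b {a, d} * h d) \<le> 1 / 2" .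
    qed
    also have "\<dots> \<le> 4 * (X * ((\<kappa> + 1) * r) powr \<alpha>)"
      unfolding M_def using X n(2) \<alpha> by (auto intro!: mult_left_mono powr_mono2)
    also have "\<dots> = G * r powr \<alpha>" using \<kappa> r by (simp add: G_def powr_mult)
    finally show ?thesis by (simp add: h_def)
  qed
  with c G show ?thesis by blast
qed

section \<open>Comparison of the cutoffs r / 2 and r, and the pointwise bound\<close>

lemma trunc_mono: "0 < r \<Longrightarrow> trunc (r / 2) x y \<le> trunc r x y"
  using J_antimono[of "r / 2" r] J_antimono[OF lnorm_pos(2), of "x - y" r] by (simp add: trunc_def)

text \<open>Below r / 2 the increment is J (r / 2) - J r, and between r / 2 and r it is at most J (r
  / 2) by monotonicity. It is of order r^(- d - \<alpha>) even for the shortest edges.\<close>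

lemma trunc_increment: "0 < r \<Longrightarrow> trunc r x y - trunc (r / 2) x y \<le> J (r / 2) * of_bool (\<nu> (x - y) \<le> r)"
  using J_pos[of r] J_antimono[of "r / 2" "\<nu> (x - y)"] J_pos[of "r / 2"] by (auto simp: trunc_def)

text \<open>An edge {a, d} that feels the change has length at most r, so the distance from x to y
  is at most that from x to a, plus r, plus that from d to y. Distributing the exponential weight
  accordingly extracts the decay in x - y at the price of exp c and leaves a product of two weighted
  susceptibilities.\<close>

lemma tau_doubling:
  assumes b: "0 \<le> b" and r: "0 < r" and V: "finite V" "x \<in> V" "y \<in> V" and c: "0 \<le> c"
    and H: "\<And>z. z \<in> V \<Longrightarrow> (\<Sum>y\<in>V. tau V (Q r b) z y * exp (c * \<nu> (y - z) / r)) \<le> H"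
  shows "tau V (Q r b) x y \<le> tau V (Q (r / 2) b) x y + b * J (r / 2) * exp c * H\<^sup>2 * exp (- c * (\<nu> (x - y) / r))"
proof -
  let ?q = "Q r b" and ?p = "Q (r / 2) b"
  let ?t = "tau V ?q"
  have pr: "probs (edges_in V) ?q" "probs (edges_in V) ?p" using b V by (auto intro: probs_Q)
  have t0: "0 \<le> ?t u v" for u v by (rule tau_nonneg[OF pr(1)])
  have J0: "0 \<le> J (r / 2)" using J_pos[of "r / 2"] r by simp
  have inc: "?q {a, d} - ?p {a, d} \<le> b * (J (r / 2) * of_bool (\<nu> (a - d) \<le> r))" for a d
  proof -
    have "?q {a, d} - ?p {a, d} = exp (- (b * trunc (r / 2) a d)) - exp (- (b * trunc r a d))"
      by (simp add: Q_pair)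
    also have "\<dots> \<le> b * trunc r a d - b * trunc (r / 2) a d"
      using b r by (intro exp_minus_diff_le mult_left_mono trunc_mono mult_nonneg_nonneg trunc_nonneg)
    also have "\<dots> = b * (trunc r a d - trunc (r / 2) a d)" by (simp add: right_diff_distrib)
    also have "\<dots> \<le> b * (J (r / 2) * of_bool (\<nu> (a - d) \<le> r))"
      by (intro mult_left_mono trunc_increment r b)
    finally show ?thesis .
  qed
  have mono: "?p e \<le> ?q e" if "e \<in> edges_in V" for e
    using that mult_left_mono[OF trunc_mono[OF r] b] by (auto simp: edges_in_def Q_pair)
  define w where "w u v = exp (c * \<nu> (v - u) / r)" for u v
  have H0: "0 \<le> H"
    by (rule order_trans[OF _ H[OF V(2)]]) (intro sum_nonneg mult_nonneg_nonneg t0, simp)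
  have pair: "(?q {a, d} - ?p {a, d}) * (?t x a * ?t d y)
      \<le> b * J (r / 2) * exp c * exp (- c * (\<nu> (x - y) / r)) * ((?t x a * w x a) * (?t y d * w y d))" for a d
  proof (cases "\<nu> (a - d) \<le> r")
    case True
    have "\<nu> (x - y) \<le> \<nu> (a - x) + (\<nu> (a - d) + \<nu> (d - y))"
      using lnorm_subadd[of "x - a" "(a - d) + (d - y)"] lnorm_subadd[of "a - d" "d - y"] lnorm_commute[of x a] by simp
    then have "\<nu> (x - y) \<le> \<nu> (a - x) + \<nu> (d - y) + r" using True by linarith
    then have "c * \<nu> (x - y) / r \<le> c * (\<nu> (a - x) + \<nu> (d - y) + r) / r"
      using c r by (intro divide_right_mono mult_left_mono) auto
    also have "\<dots> = c * \<nu> (a - x) / r + c * \<nu> (d - y) / r + c"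
      using r by (simp add: field_simps)
    finally have "exp (c * \<nu> (x - y) / r) \<le> w x a * w y d * exp c"
      by (simp add: w_def flip: exp_add)
    then have one: "1 \<le> exp c * exp (- c * (\<nu> (x - y) / r)) * (w x a * w y d)"
      by (simp add: exp_minus field_simps)
    have "(?q {a, d} - ?p {a, d}) * (?t x a * ?t d y) \<le> b * J (r / 2) * (?t x a * ?t d y)"
      using inc[of a d] True by (intro mult_right_mono mult_nonneg_nonneg t0) (simp add: mult_ac)
    also have "\<dots> \<le> b * J (r / 2) * (?t x a * ?t d y) * (exp c * exp (- c * (\<nu> (x - y) / r)) * (w x a * w y d))"
      using mult_left_mono[OF one, of "b * J (r / 2) * (?t x a * ?t d y)"] b J0 t0 by simp
    also have "\<dots> = b * J (r / 2) * exp c * exp (- c * (\<nu> (x - y) / r)) * ((?t x a * w x a) * (?t y d * w y d))"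
      by (simp add: tau_sym[of V ?q d y] mult_ac)
    finally show ?thesis .
  next
    case False
    then have "?q {a, d} - ?p {a, d} \<le> 0" using inc[of a d] by simp
    then have "(?q {a, d} - ?p {a, d}) * (?t x a * ?t d y) \<le> 0"
      by (intro mult_nonpos_nonneg mult_nonneg_nonneg t0)
    moreover have "0 \<le> b * J (r / 2) * exp c * exp (- c * (\<nu> (x - y) / r)) * ((?t x a * w x a) * (?t y d * w y d))"
      using b J0 t0 by (simp add: w_def)
    ultimately show ?thesis by linarith
  qed
  let ?Z = "b * J (r / 2) * exp c * exp (- c * (\<nu> (x - y) / r))"
  have Z0: "0 \<le> ?Z" using b J0 by simp
  have "?t x y \<le> tau V ?p x y + (\<Sum>(a, d) | a \<in> V \<and> d \<in> V \<and> a \<noteq> d. (?q {a, d} - ?p {a, d}) * (?t x a * ?t d y))"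
    by (rule tau_increase[OF pr(2,1) mono V(1)])
  also have "(\<Sum>(a, d) | a \<in> V \<and> d \<in> V \<and> a \<noteq> d. (?q {a, d} - ?p {a, d}) * (?t x a * ?t d y))
    \<le> (\<Sum>(a, d) | a \<in> V \<and> d \<in> V \<and> a \<noteq> d. ?Z * ((?t x a * w x a) * (?t y d * w y d)))"
    by (intro sum_mono) (use pair in auto)
  also have "\<dots> \<le> (\<Sum>(a, d)\<in>V \<times> V. ?Z * ((?t x a * w x a) * (?t y d * w y d)))"
    using V Z0 t0 by (intro sum_mono2) (auto simp: w_def intro!: mult_nonneg_nonneg)
  also have "\<dots> = ?Z * ((\<Sum>a\<in>V. ?t x a * w x a) * (\<Sum>d\<in>V. ?t y d * w y d))"
    unfolding sum_product
    unfolding sum_distrib_left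
    unfolding sum.cartesian_product ..
  also have "\<dots> \<le> ?Z * (H * H)"
    using H[OF V(2)] H[OF V(3)] Z0 H0 t0
    by (intro mult_left_mono mult_mono) (auto simp: w_def intro!: sum_nonneg)
  finally show ?thesis by (simp add: power2_eq_square mult_ac)
qed

text \<open>Doubling r adds an error of order r^(- d - \<alpha>) r^(2 \<alpha>) = r^(- q) with q = d
  - \<alpha>, times the exponential factor. With u = n / r this is n^(- q) u^q exp (- c u), exactly
  what the dyadic profile can absorb, so the errors of all scales add up to order n^(- q).\<close>

lemma trunc_pointwise:
  assumes lo: "0 < lo" "lo \<le> hi"
  shows "\<exists>c>0. \<exists>A>0. \<forall>b b' r V x y. lo \<le> b \<longrightarrow> b \<le> hi \<longrightarrow> b < b' \<longrightarrow> \<not> percolating b' \<longrightarrow>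
    1 \<le> r \<longrightarrow> finite V \<longrightarrow> x \<in> V \<longrightarrow> y \<in> V \<longrightarrow> x \<noteq> y \<longrightarrow>
    tau V (Q r b) x y \<le> A * \<nu> (x - y) powr (- real CARD('d) + \<alpha>) * exp (- c * (\<nu> (x - y) / r))"
proof -
  obtain c G where c: "0 < c" and G: "0 < G" and W: "\<And>b b' r V x. lo \<le> b \<Longrightarrow> b \<le> hi \<Longrightarrow> b < b' \<Longrightarrow>
    \<not> percolating b' \<Longrightarrow> 1 \<le> r \<Longrightarrow> finite V \<Longrightarrow> x \<in> V \<Longrightarrow>
    (\<Sum>y\<in>V. tau V (Q r b) x y * exp (c * \<nu> (y - x) / r)) \<le> G * r powr \<alpha>"
    using weighted_trunc_susceptibility[OF lo] by blast
  define q where "q = real CARD('d) - \<alpha>"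
  have "1 \<le> real CARD('d)" by (simp add: Suc_le_eq)
  then have q: "0 < q" using \<alpha> unfolding q_def by linarith
  obtain B where B: "0 < B" "\<And>u. 0 < u \<Longrightarrow> u powr q * exp (- c * u) + B * (1 + 1 / (1 + (2 * u) powr q)) * exp (- c * u)
    \<le> B * (1 + 1 / (1 + u powr q)) * exp (- c * u / 2)"
    using dyadic_profile[OF q c] by blast
  \<comment> \<open>The first summand covers the error of a doubling step, the second the base case
    r < 2.\<close>
  define D where "D = hi * cu * 2 powr (real CARD('d) + \<alpha>) * exp c * G\<^sup>2 + G * 2 powr real CARD('d)"
  have D0: "0 < D" using lo c_pos G by (simp add: D_def add_pos_pos)
  have "tau V (Q r b) x y \<le> 2 * D * B * \<nu> (x - y) powr (- real CARD('d) + \<alpha>) * exp (- (c / 2) * (\<nu> (x - y) / r))"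
    if b: "lo \<le> b" "b \<le> hi" "b < b'" "\<not> percolating b'" and r: "1 \<le> r" and V: "finite V" "x \<in> V" "y \<in> V" "x \<noteq> y"
    for b b' r V x y
  proof -
    have b0: "0 < b" using b lo by simp
    define n where "n = \<nu> (x - y)"
    have n: "0 < n" using V lnorm_pos(2)[of "x - y"] by (simp add: n_def)
    \<comment> \<open>The bound carried through the induction; the doubling inequality
      \<open>E\<close> says that \<open>\<Psi>\<close> at r dominates \<open>\<Psi>\<close> at r / 2
      plus the error at r.\<close>
    define \<Psi> where "\<Psi> r = D * n powr (- q) * (B * (1 + 1 / (1 + (n / r) powr q)) * exp (- c * (n / r) / 2))" for r
    have E: "D * r powr (- q) * exp (- c * (n / r)) + D * n powr (- q) * (B * (1 + 1 / (1 + (2 * (n / r)) powr q)) * exp (- c * (n / r))) \<le> \<Psi> r"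
      if "1 \<le> r" for r
    proof -
      have r0: "0 < r" using that by simp
      have "n powr (- q) * (n / r) powr q = r powr (- q)"
        using n r0 by (simp add: powr_divide powr_minus field_simps)
      then have "D * r powr (- q) * exp (- c * (n / r)) = D * n powr (- q) * ((n / r) powr q * exp (- c * (n / r)))"
        by (simp add: mult_ac)
      then have "D * r powr (- q) * exp (- c * (n / r)) + D * n powr (- q) * (B * (1 + 1 / (1 + (2 * (n / r)) powr q)) * exp (- c * (n / r)))
        = D * n powr (- q) * ((n / r) powr q * exp (- c * (n / r)) + B * (1 + 1 / (1 + (2 * (n / r)) powr q)) * exp (- c * (n / r)))"
        by (simp add: distrib_left)
      also have "\<dots> \<le> \<Psi> r"
        unfolding \<Psi>_def using n r0 D0 by (intro mult_left_mono B(2)) auto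
      finally show ?thesis .
    qed
    have bound: "tau V (Q r b) x y \<le> \<Psi> r" if "1 \<le> r" "r < 2 ^ k" for r k
      using that
    proof (induction k arbitrary: r)
      case (Suc k)
      have r0: "0 < r" using Suc.prems by simp
      have H: "(\<Sum>y\<in>V. tau V (Q r b) z y * exp (c * \<nu> (y - z) / r)) \<le> G * r powr \<alpha>" if "z \<in> V" for z
        by (rule W[OF b Suc.prems(1) V(1) that])
      have pr: "probs (edges_in V) (Q r b)" using V b0 by (intro probs_Q) auto
      have t0: "0 \<le> tau V (Q r b) u v" for u v by (rule tau_nonneg[OF pr])
      show ?case
      proof (cases "r < 2")
        case True
        \<comment> \<open>In the base case one term of the weighted susceptibility is enough,
          because r is bounded and powers of r are interchangeable up to constants.\<close>
        have "tau V (Q r b) x y * exp (c * n / r) \<le> (\<Sum>y\<in>V. tau V (Q r b) x y * exp (c * \<nu> (y - x) / r))"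
          unfolding n_def lnorm_commute[of x y] using V t0
          by (intro member_le_sum[of y V "\<lambda>y. tau V (Q r b) x y * exp (c * \<nu> (y - x) / r)"]) auto
        also have "\<dots> \<le> G * r powr \<alpha>" by (rule H[OF V(2)])
        finally have "tau V (Q r b) x y \<le> G * r powr \<alpha> * exp (- c * (n / r))"
          by (simp add: exp_minus field_simps)
        also have "r powr \<alpha> = r powr real CARD('d) * r powr (- q)"
          by (simp add: q_def flip: powr_add)
        also have "G * (r powr real CARD('d) * r powr (- q)) * exp (- c * (n / r))
          \<le> G * (2 powr real CARD('d) * r powr (- q)) * exp (- c * (n / r))"
          using G r0 True by (intro mult_right_mono mult_left_mono powr_mono2) auto
        also have "\<dots> \<le> D * r powr (- q) * exp (- c * (n / r))"
          using lo c_pos by (simp add: D_def distrib_right)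
        also have "\<dots> \<le> \<Psi> r"
        proof -
          have "0 \<le> D * n powr (- q) * (B * (1 + 1 / (1 + (2 * (n / r)) powr q)) * exp (- c * (n / r)))"
            using D0 B(1) by (intro mult_nonneg_nonneg add_nonneg_nonneg divide_nonneg_nonneg) auto
          with E[OF Suc.prems(1)] show ?thesis by linarith
        qed
        finally show ?thesis .
      next
        case False
        have "tau V (Q r b) x y \<le> tau V (Q (r / 2) b) x y
            + b * J (r / 2) * exp c * (G * r powr \<alpha>)\<^sup>2 * exp (- c * (n / r))"
          unfolding n_def using b0 r0 V c H by (intro tau_doubling) auto
        also have "tau V (Q (r / 2) b) x y \<le> \<Psi> (r / 2)"
          using Suc.prems False by (intro Suc.IH) auto
        also have "\<Psi> (r / 2) = D * n powr (- q) * (B * (1 + 1 / (1 + (2 * (n / r)) powr q)) * exp (- c * (n / r)))"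
          by (simp add: \<Psi>_def mult.commute)
        also have "b * J (r / 2) * exp c * (G * r powr \<alpha>)\<^sup>2 * exp (- c * (n / r)) \<le> D * r powr (- q) * exp (- c * (n / r))"
        proof (rule mult_right_mono)
          have "J (r / 2) \<le> cu * (r / 2) powr (- (real CARD('d) + \<alpha>))" using False by (intro J_upper) auto
          then have "b * J (r / 2) * exp c * (G * r powr \<alpha>)\<^sup>2 \<le> hi * (cu * (r / 2) powr (- (real CARD('d) + \<alpha>))) * exp c * (G * r powr \<alpha>)\<^sup>2"
            using b b0 J_pos[of "r / 2"] r0 by (intro mult_right_mono mult_mono) auto
          also have "\<dots> = hi * cu * 2 powr (real CARD('d) + \<alpha>) * exp c * G\<^sup>2 * (r powr (- (real CARD('d) + \<alpha>)) * (r powr \<alpha> * r powr \<alpha>))"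
          proof -
            have "(r / 2) powr (- g) = 2 powr g * r powr (- g)" for g
              using r0 by (simp add: powr_divide powr_minus field_simps)
            then show ?thesis by (simp only: power2_eq_square mult_ac)
          qed
          also have "r powr (- (real CARD('d) + \<alpha>)) * (r powr \<alpha> * r powr \<alpha>) = r powr (- q)"
            by (simp add: q_def flip: powr_add)
          also have "hi * cu * 2 powr (real CARD('d) + \<alpha>) * exp c * G\<^sup>2 * r powr (- q) \<le> D * r powr (- q)"
            using G by (intro mult_right_mono) (auto simp: D_def)
          finally show "b * J (r / 2) * exp c * (G * r powr \<alpha>)\<^sup>2 \<le> D * r powr (- q)" .
        qed simp
        finally show ?thesis using E[OF Suc.prems(1)] by linarith
      qed
    qed simp
    obtain k where "r < 2 ^ k" using real_arch_pow[of 2 r] by auto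
    then have "tau V (Q r b) x y \<le> \<Psi> r" by (rule bound[OF r])
    also have "\<dots> \<le> D * n powr (- q) * (B * 2 * exp (- c * (n / r) / 2))"
      unfolding \<Psi>_def using D0 B(1) frac_le[of 1 1 1 "1 + (n / r) powr q"]
      by (intro mult_left_mono mult_right_mono) auto
    also have "\<dots> = 2 * D * B * n powr (- real CARD('d) + \<alpha>) * exp (- (c / 2) * (n / r))"
      by (simp add: q_def)
    finally show ?thesis by (simp add: n_def)
  qed
  moreover have "0 < c / 2" "0 < 2 * D * B" using c D0 B by auto
  ultimately show ?thesis by blast
qed

text \<open>Covers a critical point equal to 0, which cannot be approached by smaller
  parameters.\<close>

lemma tau_at_zero:
  assumes "finite V" "x \<in> V" "x \<noteq> y"
  shows "tau V (Q r 0) x y = 0"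
proof -
  have pr: "probs (edges_in V) (Q r 0)" using assms by (intro probs_Q) auto
  have "tau V (Q r 0) x y \<le> tau {x} (Q r 0) x y + (\<Sum>a\<in>{x}. \<Sum>b\<in>V - {x}. tau {x} (Q r 0) x a * Q r 0 {a, b} * tau V (Q r 0) b y)"
    using assms by (intro simon_lieb[OF pr]) auto
  also have "\<dots> = 0" using assms by (simp add: tau_outside Q_pair)
  finally show ?thesis using tau_nonneg[OF pr, of x y] by linarith
qed

text \<open>In a fixed cube the two-point function is continuous in b, being built from finitely
  many edges, so bounds below the critical point extend to it; the passage to infinite volume comes
  after this limit. Restricting to b in [bc / 2, bc] fixes the constants.\<close>

lemma trunc_two_point:
  "\<exists>c>0. \<exists>A>0. \<forall>r\<ge>1. \<forall>x y. x \<noteq> y \<longrightarrow>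
    two_point (trunc r) (critical_point (lr_kernel N J)) x y
      \<le> A * \<nu> (x - y) powr (- real CARD('d) + \<alpha>) * exp (- c * (\<nu> (x - y) / r))"
proof -
  define S where "S = {b. 0 \<le> b \<and> percolating b}"
  define bc where "bc = critical_point (lr_kernel N J)"
  have bc: "bc = Inf S" by (simp add: bc_def critical_point_def S_def percolating_def)
  have S: "S \<noteq> {}" using percolating_exists by (auto simp: S_def)
  have bc0: "0 \<le> bc" unfolding bc using S by (intro cInf_greatest) (auto simp: S_def)
  have sub: "\<not> percolating b" if "0 \<le> b" "b < bc" for b
  proof
    assume "percolating b"
    then have "bc \<le> b" unfolding bc using that by (intro cInf_lower) (auto simp: S_def intro!: bdd_belowI[of _ 0])
    with that show False by simp
  qed
  have exh: "exhausted_kernel (trunc r) cube" for r :: real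
  proof -
    interpret lattice_kernel "trunc r" by (rule trunc_lattice_kernel)
    show ?thesis by (rule exhausted_kernel_axioms)
  qed
  have limit: "two_point (trunc r) bc x y \<le> U"
    if "\<And>n. x \<in> cube n \<Longrightarrow> y \<in> cube n \<Longrightarrow> tau (cube n) (Q r bc) x y \<le> U" for r x y U
  proof (rule exhausted_kernel.two_point_le[OF exh bc0])
    fix n
    define m where "m = max n (max (supn x) (supn y))"
    have "tau (cube n) (Q r bc) x y \<le> tau (cube m) (Q r bc) x y"
      using bc0 by (intro tau_mono_set probs_Q cube_mono) (auto simp: m_def)
    also have "\<dots> \<le> U" by (rule that) (auto simp: m_def cube_def)
    finally show "tau (cube n) (Q r bc) x y \<le> U" .
  qed
  show ?thesis
  proof (cases "bc = 0")
    case True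
    have "two_point (trunc r) bc x y \<le> 1 * \<nu> (x - y) powr (- real CARD('d) + \<alpha>) * exp (- 1 * (\<nu> (x - y) / r))"
      if "x \<noteq> y" for r x y
    proof (rule limit)
      fix n assume "x \<in> cube n"
      then have "tau (cube n) (Q r bc) x y = 0" unfolding True using that by (intro tau_at_zero) auto
      then show "tau (cube n) (Q r bc) x y \<le> 1 * \<nu> (x - y) powr (- real CARD('d) + \<alpha>) * exp (- 1 * (\<nu> (x - y) / r))"
        by simp
    qed
    then show ?thesis unfolding bc_def by (intro exI[of _ "1::real"] conjI allI impI) simp_all
  next
    case False
    with bc0 have bcp: "0 < bc" by simp
    obtain c A where cA: "0 < c" "0 < A" and bound: "\<And>b b' r V x y. bc / 2 \<le> b \<Longrightarrow> b \<le> bc \<Longrightarrow> b < b' \<Longrightarrow>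
      \<not> percolating b' \<Longrightarrow> 1 \<le> r \<Longrightarrow> finite V \<Longrightarrow> x \<in> V \<Longrightarrow> y \<in> V \<Longrightarrow> x \<noteq> y \<Longrightarrow>
      tau V (Q r b) x y \<le> A * \<nu> (x - y) powr (- real CARD('d) + \<alpha>) * exp (- c * (\<nu> (x - y) / r))"
      using trunc_pointwise[of "bc / 2" bc] bcp by auto
    have "two_point (trunc r) bc x y \<le> A * \<nu> (x - y) powr (- real CARD('d) + \<alpha>) * exp (- c * (\<nu> (x - y) / r))"
      (is "_ \<le> ?U") if r: "1 \<le> r" and xy: "x \<noteq> y" for r x y
    proof (rule limit)
      fix n assume xyn: "x \<in> cube n" "y \<in> cube n"
      have "((\<lambda>b. tau (cube n) (Q r b) x y) \<longlongrightarrow> tau (cube n) (Q r bc) x y) (at_left bc)"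
        unfolding tau_def prb_def
        by (intro tendsto_expect finite_edges_in finite_cube) (auto simp: edge_prob_def intro!: tendsto_intros)
      moreover have "eventually (\<lambda>b. tau (cube n) (Q r b) x y \<le> ?U) (at_left bc)"
      proof -
        have "eventually (\<lambda>b. b \<in> {bc / 2<..<bc}) (at_left bc)"
          using bcp by (intro eventually_at_leftI[of "bc / 2"]) auto
        then show ?thesis
        proof eventually_elim
          case (elim b)
          \<comment> \<open>The bound at b asks for a nonpercolating parameter strictly above b; the
            midpoint to \<open>bc\<close> provides one.\<close>
          have "\<not> percolating ((b + bc) / 2)" using elim bcp by (intro sub) auto
          then show ?case using elim r xy xyn by (intro bound[of b "(b + bc) / 2"]) auto
        qed
      qed
      ultimately show "tau (cube n) (Q r bc) x y \<le> ?U"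
        by (rule tendsto_upperbound) simp
    qed
    with cA show ?thesis unfolding bc_def by blast
  qed
qed

end

theorem mainTheorem20:
  fixes N :: "real ^ 'd \<Rightarrow> real"
    and J \<delta> :: "real \<Rightarrow> real"
    and \<alpha> C r\<^sub>0 :: real
  assumes "is_norm N"
    and "0 < \<alpha>"
    and "\<And>r. 0 < r \<Longrightarrow> 0 < J r"
    and "antimono_on {0<..} J"
    and "\<And>r. 0 < r \<Longrightarrow> J differentiable (at r)"
    and "(J \<longlongrightarrow> 0) at_top"
    and "0 < C"
    and "\<And>r. 0 < r \<Longrightarrow>
           \<bar>deriv J r\<bar> = C * (1 + \<delta> r) * r powr (- real CARD('d) - \<alpha> - 1)"
    and "set_borel_measurable borel {0<..} \<delta>"
    and "(\<delta> \<longlongrightarrow> 0) at_top"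
    and "0 < r\<^sub>0"
    and "set_integrable lborel {r\<^sub>0..} (\<lambda>r. \<bar>\<delta> r\<bar> / r)"
    and "\<alpha> < 1"
  shows "\<exists>c>0. \<exists>A>0. \<forall>r\<ge>1. \<forall>x y :: int ^ 'd. x \<noteq> y \<longrightarrow>
           two_point (cutoff_kernel N J r) (critical_point (lr_kernel N J)) x y
             \<le> A * lattice_dist N x y powr (- real CARD('d) + \<alpha>)
                 * exp (- c * (lattice_dist N x y / r))"
proof -
  obtain s1 s2 where s: "0 < s1" "0 < s2"
    "\<And>x. s1 * real (supn x) \<le> lnorm N x" "\<And>x. lnorm N x \<le> s2 * real (supn x)"
    using lnorm_equivalence[OF assms(1)] by blast
  define \<gamma> where "\<gamma> = real CARD('d) + \<alpha>"
  have \<gamma>: "0 < \<gamma>" using assms(2) by (simp add: \<gamma>_def add_nonneg_pos)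
  have J': "\<bar>deriv J r\<bar> = C * (1 + \<delta> r) * r powr (- \<gamma> - 1)" if "0 < r" for r
    using assms(8)[OF that] by (simp add: \<gamma>_def)
  have "\<exists>cl>0. \<exists>cu>0. \<forall>r\<ge>min s1 1. cl * r powr (- \<gamma>) \<le> J r \<and> J r \<le> cu * r powr (- \<gamma>)"
    using s by (intro power_law_bounds[OF assms(3-7) \<gamma> J' assms(10)]) auto
  then obtain cl cu where c: "0 < cl" "0 < cu"
    "\<And>r. min s1 1 \<le> r \<Longrightarrow> cl * r powr (- \<gamma>) \<le> J r" "\<And>r. min s1 1 \<le> r \<Longrightarrow> J r \<le> cu * r powr (- \<gamma>)"
    by blast
  interpret power_law_kernel N J \<alpha> cl cu s1 s2
    by unfold_locales (use assms s c in \<open>auto simp: \<gamma>_def monotone_on_def\<close>)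
  have eq: "cutoff_kernel N J r = trunc r" for r
  proof (intro ext)
    fix x y
    show "cutoff_kernel N J r x y = trunc r x y"
    proof (cases "x \<noteq> y \<and> lnorm N (x - y) \<le> r")
      case True
      then have "(LBINT s:{lnorm N (x - y)..r}. \<bar>deriv J s\<bar>) = J (lnorm N (x - y)) - J r"
        using lnorm_pos(2)[of "x - y"] by (intro integral_abs_deriv[OF assms(4,5) J' assms(9)]) auto
      with True show ?thesis by (simp add: cutoff_kernel_def trunc_def lattice_dist_lnorm)
    qed (auto simp: cutoff_kernel_def trunc_def lattice_dist_lnorm)
  qed
  show ?thesis using trunc_two_point unfolding eq lattice_dist_lnorm .
qed

end
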